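(* Let $T$ be a forward expansive correspondence on a compact metric space $X$ with the specification property. Then $(T,\mathcal{E})$ has an abundance of ergodic path measures for every continuous $\mathcal{E}:\mathcal{M}(\Gamma_T)\to\mathbb{R}$.
   Context: For a compact metric space $Y$, $\mathcal{M}(Y)$ is the set of Borel probability measures on $Y$ with the weak-star topology. For $S:Y\to Y$ continuous, $\mathcal{M}(Y,S)$ is the set of $S$-invariant elements of $\mathcal{M}(Y)$ and $h_\nu(S)$ is Kolmogorov--Sinai entropy. Let $(X,d)$ be a compact metric space. A correspondence $T$ on $X$ assigns to each $x\in X$ a nonempty closed set $T(x)\subset X$ such that $\Gamma_T=\{(x,y)\in X^2:y\in T(x)\}$ is closed in $X^2$. An admissible orbit segment is a tuple $(x_0,\dots,x_n)$ with $x_{j+1}\in T(x_j)$ for $0\le j<n$. The orbit space is $\Omega_T=\{(x_j)_{j\ge0}:x_{j+1}\in T(x_j)\ \forall j\ge 0\}$ with the product topology, shift $\sigma((x_j)_{j\geq 0})=(x_{j+1})_{j\geq 0}$, and projection $p_2:\Omega_T\to\Gamma_T$, $p_2((x_j)_{j\geq 0})=(x_0,x_1)$. $T$ is forward expansive if there is $\varepsilon_0>0$ such that any two distinct $\boldsymbol{x},\boldsymbol{y}\in\Omega_T$ satisfy $d(x_j,y_j)>\varepsilon_0$ for some $j\ge0$. Specification property: for every $\varepsilon>0$ there is $M\in\mathbb{N}$ such that for all admissible orbit segments $(x^{(i)}_j)_{j=0}^{n_i}$, $1\le i\le k$, and integers $0=a_1<\cdots<a_k$ with $a_{i+1}-(a_i+n_i+1)>M$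 for $1\le i<k$, there is $\boldsymbol{y}\in\Omega_T$ with $d(y_{a_i+j},x^{(i)}_j)<\varepsilon$ for $1\le i\le k$, $0\le j\le n_i$. Put $\widehat{\mathcal{E}}(\nu)=\mathcal{E}((p_2)_*\nu)$ for $\nu\in\mathcal{M}(\Omega_T)$. $(T,\mathcal{E})$ has an abundance of ergodic path measures if for every $\nu\in\mathcal{M}(\Omega_T,\sigma)$ and $\eta>0$ there is an ergodic $\rho\in\mathcal{M}(\Omega_T,\sigma)$ with $h_\rho(\sigma)+\widehat{\mathcal{E}}(\rho)>h_\nu(\sigma)+\widehat{\mathcal{E}}(\nu)-\eta$. *)

theory Defs
  imports "HOL-Probability.Probability"
begin

section \<open>Borel probability measures and invariant measures\<close>

definition borel_prob_measures :: "'b::topological_space set \<Rightarrow> 'b measure set" where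
  "borel_prob_measures Y =
     {\<mu>. prob_space \<mu> \<and> sets \<mu> = sets (restrict_space borel Y)}"

text \<open>The coarsest topology making \<open>\<mu> \<mapsto> \<integral> f d\<mu>\<close> continuous for every continuous
  \<open>f : Y \<rightarrow> \<real>\<close>; its underlying space is \<open>borel_prob_measures Y\<close>.\<close>
definition weak_star_topology :: "'b::topological_space set \<Rightarrow> 'b measure topology" where
  "weak_star_topology Y =
     topology_generated_by
       {{\<mu> \<in> borel_prob_measures Y. (\<integral>y. f y \<partial>\<mu>) \<in> U} | (f :: 'b \<Rightarrow> real) U.
          continuous_on Y f \<and> open U}"

definition invariant_measures ::
  "'b::topological_space set \<Rightarrow> ('b \<Rightarrow> 'b) \<Rightarrow> 'b measure set" where
  "invariant_measures Y S = {\<nu> \<in> borel_prob_measures Y. distr \<nu> \<nu> S = \<nu>}"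

definition ergodic_measures ::
  "'b::topological_space set \<Rightarrow> ('b \<Rightarrow> 'b) \<Rightarrow> 'b measure set" where
  "ergodic_measures Y S =
     {\<nu> \<in> invariant_measures Y S.
        \<forall>A \<in> sets \<nu>. S -` A \<inter> space \<nu> = A \<longrightarrow> measure \<nu> A = 0 \<or> measure \<nu> A = 1}"


section \<open>Kolmogorov--Sinai entropy\<close>

definition finite_partitions :: "'b measure \<Rightarrow> 'b set set set" where
  "finite_partitions \<nu> = {P. finite P \<and> P \<subseteq> sets \<nu> \<and> partition_on (space \<nu>) P}"

text \<open>Since \<open>ln 0 = 0\<close> in HOL, null cells contribute \<open>0\<close>.\<close>
definition partition_entropy :: "'b measure \<Rightarrow> 'b set set \<Rightarrow> real" where
  "partition_entropy \<nu> P = - (\<Sum>A\<in>P. measure \<nu> A * ln (measure \<nu> A))"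

text \<open>The join of \<open>P, S\<^sup>-\<^sup>1 P, \<dots>, S\<^sup>-\<^sup>(\<^sup>n\<^sup>-\<^sup>1\<^sup>) P\<close>.\<close>
definition iterated_join ::
  "'b measure \<Rightarrow> ('b \<Rightarrow> 'b) \<Rightarrow> 'b set set \<Rightarrow> nat \<Rightarrow> 'b set set" where
  "iterated_join \<nu> S P n =
     {{y \<in> space \<nu>. \<forall>j<n. (S ^^ j) y \<in> A j} | A. \<forall>j<n. A j \<in> P} - {{}}"

text \<open>For invariant \<open>\<nu>\<close> the limit exists by subadditivity.\<close>
definition entropy_wrt_partition :: "'b measure \<Rightarrow> ('b \<Rightarrow> 'b) \<Rightarrow> 'b set set \<Rightarrow> real" where
  "entropy_wrt_partition \<nu> S P =
     lim (\<lambda>n. partition_entropy \<nu> (iterated_join \<nu> S P n) / real n)"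

definition KS_entropy :: "'b measure \<Rightarrow> ('b \<Rightarrow> 'b) \<Rightarrow> ereal" where
  "KS_entropy \<nu> S = (SUP P \<in> finite_partitions \<nu>. ereal (entropy_wrt_partition \<nu> S P))"


section \<open>Correspondences\<close>

definition corr_graph :: "'a set \<Rightarrow> ('a \<Rightarrow> 'a set) \<Rightarrow> ('a \<times> 'a) set" where
  "corr_graph X T = {(x, y) \<in> X \<times> X. y \<in> T x}"

definition correspondence :: "'a::metric_space set \<Rightarrow> ('a \<Rightarrow> 'a set) \<Rightarrow> bool" where
  "correspondence X T \<longleftrightarrow>
     (\<forall>x\<in>X. T x \<noteq> {} \<and> closedin (top_of_set X) (T x)) \<and>
     closedin (top_of_set (X \<times> X)) (corr_graph X T)"

text \<open>The segment \<open>(x 0, \<dots>, x n)\<close>; later values of \<open>x\<close> are irrelevant.\<close>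
definition orbit_segment :: "'a set \<Rightarrow> ('a \<Rightarrow> 'a set) \<Rightarrow> nat \<Rightarrow> (nat \<Rightarrow> 'a) \<Rightarrow> bool" where
  "orbit_segment X T n x \<longleftrightarrow> (\<forall>j\<le>n. x j \<in> X) \<and> (\<forall>j<n. x (Suc j) \<in> T (x j))"

definition orbit_space :: "'a set \<Rightarrow> ('a \<Rightarrow> 'a set) \<Rightarrow> (nat \<Rightarrow> 'a) set" where
  "orbit_space X T = {x. \<forall>j. x j \<in> X \<and> x (Suc j) \<in> T (x j)}"

definition shift :: "(nat \<Rightarrow> 'a) \<Rightarrow> nat \<Rightarrow> 'a" where
  "shift x = (\<lambda>j. x (Suc j))"

definition proj2 :: "(nat \<Rightarrow> 'a) \<Rightarrow> 'a \<times> 'a" where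
  "proj2 x = (x 0, x 1)"

definition forward_expansive :: "'a::metric_space set \<Rightarrow> ('a \<Rightarrow> 'a set) \<Rightarrow> bool" where
  "forward_expansive X T \<longleftrightarrow>
     (\<exists>\<epsilon>\<^sub>0>0. \<forall>x \<in> orbit_space X T. \<forall>y \<in> orbit_space X T.
        x \<noteq> y \<longrightarrow> (\<exists>j. dist (x j) (y j) > \<epsilon>\<^sub>0))"

text \<open>The \<open>i\<close>-th segment is \<open>(x i 0, \<dots>, x i (n i))\<close>, for \<open>1 \<le> i \<le> k\<close>.\<close>
definition specification_property :: "'a::metric_space set \<Rightarrow> ('a \<Rightarrow> 'a set) \<Rightarrow> bool" where
  "specification_property X T \<longleftrightarrow>
     (\<forall>\<epsilon>>0. \<exists>M::nat. \<forall>(k::nat) (n::nat \<Rightarrow> nat) (x::nat \<Rightarrow> nat \<Rightarrow> 'a) (a::nat \<Rightarrow> int).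
        k \<ge> 1 \<longrightarrow>
        (\<forall>i\<in>{1..k}. orbit_segment X T (n i) (x i)) \<longrightarrow>
        a 1 = 0 \<longrightarrow>
        (\<forall>i\<in>{1..<k}. a i < a (i + 1)) \<longrightarrow>
        (\<forall>i\<in>{1..<k}. a (i + 1) - (a i + int (n i) + 1) > int M) \<longrightarrow>
        (\<exists>y \<in> orbit_space X T. \<forall>i\<in>{1..k}. \<forall>j\<le>n i.
           dist (y (nat (a i) + j)) (x i j) < \<epsilon>))"

definition path_energy ::
  "'a::metric_space set \<Rightarrow> ('a \<Rightarrow> 'a set) \<Rightarrow> (('a \<times> 'a) measure \<Rightarrow> real) \<Rightarrow>
   (nat \<Rightarrow> 'a) measure \<Rightarrow> real" where
  "path_energy X T E \<nu> = E (distr \<nu> (restrict_space borel (corr_graph X T)) proj2)"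

definition abundance_of_ergodic_path_measures ::
  "'a::metric_space set \<Rightarrow> ('a \<Rightarrow> 'a set) \<Rightarrow> (('a \<times> 'a) measure \<Rightarrow> real) \<Rightarrow> bool" where
  "abundance_of_ergodic_path_measures X T E \<longleftrightarrow>
     (\<forall>\<nu> \<in> invariant_measures (orbit_space X T) shift. \<forall>\<eta>::real. \<eta> > 0 \<longrightarrow>
        (\<exists>\<rho> \<in> ergodic_measures (orbit_space X T) shift.
           KS_entropy \<rho> shift + ereal (path_energy X T E \<rho>)
             > KS_entropy \<nu> shift + ereal (path_energy X T E \<nu>) - ereal \<eta>))"

end

theory Submission
  imports Defs "HOL-Real_Asymp.Real_Asymp"
begin

text \<open>Cut a \<open>\<nu>\<close>-random orbit into its first \<open>n\<close> steps and glue independent copies of such segments by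
  the specification property, with gaps of bounded length. The independent segments form a Bernoulli
  process. Orbits of \<open>T\<close> shadowing them are coded, by expansivity, by sequences over a finite alphabet
  that factor onto this Bernoulli process, so the set of shift-invariant lifts of the Bernoulli measure is
  compact and convex. It has an extreme point, which is ergodic because the Bernoulli measure is. Its
  image on the orbit space is ergodic for a power of the shift, and averaging over one period gives an
  ergodic \<open>\<rho>\<close>. Shadowing and the bounded gaps make the integrals of continuous functions of two consecutive
  coordinates close to those of \<open>\<nu>\<close>. For the entropy, let the letters of the segments be the cells of a
  partition most of whose mass lies in disjoint compact cells. The letters in these cells can be read off
  the shadowing orbit, and Fano's inequality bounds what is lost on the remaining ones; since the
  segments are independent, no ergodicity of \<open>\<nu>\<close> is needed. By expansivity the partition generates, so its
  entropy rate is the entropy of \<open>\<nu>\<close>.\<close>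

section \<open>Entropy of simple random variables\<close>

text \<open>Pushing the Bernoulli measure forward along a choice of shadowing orbits would not do,
  because such a choice need not commute with any power of the shift. The labels therefore record
  the shadowing orbit as extra data, and ergodicity is recovered among all ways of adding such data.
  A second obstacle is that shadowing does not respect cells: a point near the boundary of a cell
  may be read in a neighbouring one. Hence the letters come in two kinds, those of compact kernels,
  which survive a perturbation, and those of the remainders. Fano's inequality is applied letter by
  letter and not to whole words, so that its loss per step depends on the number of letters and not
  on the length of the words. This dictates the order of choices: the partition, the mass
  \<open>q\<close> of the remainders, the separation of the kernels and with it the precision
  \<open>\<epsilon>\<close>, the gap \<open>M\<close> belonging to \<open>\<epsilon>\<close>, and
  last the length \<open>n\<close>, which makes the share of time spent in gaps small.\<close>

definition law :: "'b measure \<Rightarrow> ('b \<Rightarrow> 'x) \<Rightarrow> 'x \<Rightarrow> real" where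
  "law M X x = measure M {\<omega> \<in> space M. X \<omega> = x}"

definition rv_entropy :: "'b measure \<Rightarrow> ('b \<Rightarrow> 'x) \<Rightarrow> real" where
  "rv_entropy M X = - (\<Sum>x\<in>X ` space M. law M X x * ln (law M X x))"

lemma law_nonneg [simp]: "0 \<le> law M X x"
  by (simp add: law_def)

lemma law_outside: "x \<notin> X ` space M \<Longrightarrow> law M X x = 0"
proof -
  assume "x \<notin> X ` space M"
  then have "{\<omega> \<in> space M. X \<omega> = x} = {}" by auto
  then show ?thesis unfolding law_def by (simp only: measure_empty)
qed

lemma simple_function_level_sets:
  assumes "simple_function M X"
  shows "{\<omega> \<in> space M. X \<omega> = x} \<in> sets M"
    and "{\<omega> \<in> space M. X \<omega> \<in> B} \<in> sets M"
proof -
  have m: "X \<in> measurable M (count_space UNIV)"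
    by (rule measurable_simple_function[OF assms])
  show "{\<omega> \<in> space M. X \<omega> = x} \<in> sets M"
    using measurable_sets[OF m, of "{x}"] by (simp add: vimage_def Collect_conj_eq Int_commute)
  show "{\<omega> \<in> space M. X \<omega> \<in> B} \<in> sets M"
    using measurable_sets[OF m, of B] by (simp add: vimage_def Collect_conj_eq Int_commute)
qed

lemma measure_simple_function:
  assumes "prob_space M" "simple_function M X" "finite A" "X ` space M \<subseteq> A"
  shows "measure M {\<omega> \<in> space M. X \<omega> \<in> B} = (\<Sum>x\<in>A \<inter> B. law M X x)"
proof -
  interpret prob_space M by fact
  have "{\<omega> \<in> space M. X \<omega> \<in> B} = (\<Union>x\<in>A \<inter> B. {\<omega> \<in> space M. X \<omega> = x})"
    using assms(4) by auto
  also have "measure M \<dots> = (\<Sum>x\<in>A \<inter> B. measure M {\<omega> \<in> space M. X \<omega> = x})"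
    using assms(3) simple_function_level_sets[OF assms(2)]
    by (intro finite_measure_finite_Union) (auto simp: disjoint_family_on_def)
  finally show ?thesis by (simp add: law_def)
qed

lemma sum_law:
  assumes "prob_space M" "simple_function M X" "finite A" "X ` space M \<subseteq> A"
  shows "(\<Sum>x\<in>A. law M X x) = 1"
  using measure_simple_function[OF assms, of UNIV] prob_space.prob_space[OF assms(1)] by simp

lemma law_le_1: "prob_space M \<Longrightarrow> law M X x \<le> 1"
  by (simp add: law_def prob_space.prob_le_1)

lemma law_comp:
  assumes "prob_space M" "simple_function M X" "finite A" "X ` space M \<subseteq> A"
  shows "law M (\<lambda>\<omega>. f (X \<omega>)) y = (\<Sum>x\<in>{x\<in>A. f x = y}. law M X x)"
  using measure_simple_function[OF assms, of "{x. f x = y}"]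
  by (simp add: law_def[of M "\<lambda>\<omega>. f (X \<omega>)"] Int_def)

lemma rv_entropy_superset:
  assumes "finite A" "X ` space M \<subseteq> A"
  shows "rv_entropy M X = - (\<Sum>x\<in>A. law M X x * ln (law M X x))"
  unfolding rv_entropy_def
  using assms by (subst sum.mono_neutral_left[of A]) (auto simp: law_outside)

lemma rv_entropy_cong:
  assumes "\<And>\<omega>. \<omega> \<in> space M \<Longrightarrow> X \<omega> = Y \<omega>"
  shows "rv_entropy M X = rv_entropy M Y"
proof -
  have "law M X = law M Y" using assms by (auto simp: law_def fun_eq_iff intro!: arg_cong[where f="measure M"])
  moreover have "X ` space M = Y ` space M" using assms by auto
  ultimately show ?thesis by (simp add: rv_entropy_def)
qed

text \<open>Sums the inequality \<open>ln t \<le> t - 1\<close> at \<open>t = r x / p x\<close>,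
  weighted by \<open>p x\<close>. Positivity of \<open>r\<close> on the support of \<open>p\<close>
  is assumed because with \<open>ln 0 = 0\<close> a missing atom would go unpunished. Subadditivity,
  Fano's inequality and concavity below differ only in the choice of \<open>r\<close>.\<close>

lemma gibbs:
  fixes p r :: "'x \<Rightarrow> real"
  assumes "finite A" "\<And>x. x \<in> A \<Longrightarrow> 0 \<le> p x" "\<And>x. x \<in> A \<Longrightarrow> 0 \<le> r x"
    "\<And>x. x \<in> A \<Longrightarrow> 0 < p x \<Longrightarrow> 0 < r x" "(\<Sum>x\<in>A. r x) \<le> (\<Sum>x\<in>A. p x)"
  shows "(\<Sum>x\<in>A. p x * ln (r x)) \<le> (\<Sum>x\<in>A. p x * ln (p x))"
proof -
  have "p x * ln (r x) - p x * ln (p x) \<le> r x - p x" if x: "x \<in> A" for x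
  proof (cases "p x = 0")
    case False
    then have p: "0 < p x" and r: "0 < r x" using assms(2,4) x by force+
    have "p x * ln (r x) - p x * ln (p x) = p x * ln (r x / p x)"
      using p r by (simp add: ln_div right_diff_distrib)
    also have "\<dots> \<le> p x * (r x / p x - 1)"
      using p r by (intro mult_left_mono ln_le_minus_one) auto
    also have "\<dots> = r x - p x" using p by (simp add: field_simps)
    finally show ?thesis .
  qed (use assms(3) x in auto)
  then have "(\<Sum>x\<in>A. p x * ln (r x) - p x * ln (p x)) \<le> (\<Sum>x\<in>A. r x - p x)"
    by (rule sum_mono)
  then show ?thesis using assms(5) by (simp add: sum_subtractf)
qed

lemma rv_entropy_nonneg:
  assumes "prob_space M"
  shows "0 \<le> rv_entropy M X"
proof -
  have "law M X x * ln (law M X x) \<le> 0" for x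
    using law_le_1[OF assms, of X x] law_nonneg[of M X x]
    by (cases "law M X x = 0") (auto intro!: mult_nonneg_nonpos simp: less_le)
  then show ?thesis by (simp add: rv_entropy_def sum_nonpos)
qed

text \<open>An atom of \<open>X\<close> is at most the atom of its image under \<open>f\<close>, and
  \<open>ln\<close> is monotone; regrouping the sum over the fibres of \<open>f\<close> gives the
  bound.\<close>

lemma rv_entropy_comp_le:
  assumes "prob_space M" "simple_function M X"
  shows "rv_entropy M (\<lambda>\<omega>. f (X \<omega>)) \<le> rv_entropy M X"
proof -
  let ?A = "X ` space M" and ?Y = "\<lambda>\<omega>. f (X \<omega>)"
  have fin: "finite ?A" using assms(2) by (simp add: simple_function_def)
  note lc = law_comp[OF assms fin order_refl]
  have "(\<Sum>y\<in>f ` ?A. law M ?Y y * ln (law M ?Y y))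
      = (\<Sum>y\<in>f ` ?A. \<Sum>x\<in>{x\<in>?A. f x = y}. law M X x * ln (law M ?Y y))"
    by (intro sum.cong refl) (subst lc, simp add: sum_distrib_right lc)
  also have "\<dots> = (\<Sum>x\<in>?A. law M X x * ln (law M ?Y (f x)))"
    using sum.image_gen[OF fin, of "\<lambda>x. law M X x * ln (law M ?Y (f x))" f] by (auto intro!: sum.cong)
  also have "\<dots> \<ge> (\<Sum>x\<in>?A. law M X x * ln (law M X x))"
  proof (rule sum_mono)
    fix x assume x: "x \<in> ?A"
    have "law M X x \<le> law M ?Y (f x)"
      unfolding lc using fin x by (intro member_le_sum) auto
    then show "law M X x * ln (law M X x) \<le> law M X x * ln (law M ?Y (f x))"
      using less_le_trans[of 0 "law M X x" "law M ?Y (f x)"]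
      by (cases "law M X x = 0") (auto intro!: mult_left_mono simp: less_le)
  qed
  finally show ?thesis by (simp add: rv_entropy_def image_image)
qed

lemma law_Pair_sum:
  assumes "prob_space M" "simple_function M X" "simple_function M Y"
  shows "(\<Sum>x\<in>X ` space M. law M (\<lambda>\<omega>. (X \<omega>, Y \<omega>)) (x, y)) = law M Y y"
    and "(\<Sum>y\<in>Y ` space M. law M (\<lambda>\<omega>. (X \<omega>, Y \<omega>)) (x, y)) = law M X x"
proof -
  let ?A = "X ` space M \<times> Y ` space M"
  have fin: "finite (X ` space M)" "finite (Y ` space M)"
    using assms by (simp_all add: simple_function_def)
  then have "finite ?A" "(\<lambda>\<omega>. (X \<omega>, Y \<omega>)) ` space M \<subseteq> ?A" by auto
  note lc = law_comp[OF assms(1) simple_function_Pair[OF assms(2,3)] this]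
  show "(\<Sum>x\<in>X ` space M. law M (\<lambda>\<omega>. (X \<omega>, Y \<omega>)) (x, y)) = law M Y y"
  proof (cases "y \<in> Y ` space M")
    case True
    then have "{x \<in> ?A. snd x = y} = (\<lambda>x. (x, y)) ` (X ` space M)" by auto
    then show ?thesis using lc[of snd y] by (simp add: sum.reindex inj_on_def)
  next
    case False
    then have "law M (\<lambda>\<omega>. (X \<omega>, Y \<omega>)) (x, y) = 0" for x
      by (intro law_outside) auto
    then show ?thesis using False by (simp add: law_outside)
  qed
  show "(\<Sum>y\<in>Y ` space M. law M (\<lambda>\<omega>. (X \<omega>, Y \<omega>)) (x, y)) = law M X x"
  proof (cases "x \<in> X ` space M")
    case True
    then have "{z \<in> ?A. fst z = x} = (\<lambda>y. (x, y)) ` (Y ` space M)" by auto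
    then show ?thesis using lc[of fst x] by (simp add: sum.reindex inj_on_def)
  next
    case False
    then have "law M (\<lambda>\<omega>. (X \<omega>, Y \<omega>)) (x, y) = 0" for y
      by (intro law_outside) auto
    then show ?thesis using False by (simp add: law_outside)
  qed
qed

lemma law_Pair_le:
  assumes "prob_space M" "simple_function M X" "simple_function M Y"
  shows "law M (\<lambda>\<omega>. (X \<omega>, Y \<omega>)) (x, y) \<le> law M X x"
    and "law M (\<lambda>\<omega>. (X \<omega>, Y \<omega>)) (x, y) \<le> law M Y y"
proof -
  interpret prob_space M by fact
  show "law M (\<lambda>\<omega>. (X \<omega>, Y \<omega>)) (x, y) \<le> law M X x"
    "law M (\<lambda>\<omega>. (X \<omega>, Y \<omega>)) (x, y) \<le> law M Y y"
    unfolding law_def using simple_function_level_sets[OF assms(2)] simple_function_level_sets[OF assms(3)]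
    by (auto intro!: finite_measure_mono)
qed

lemma rv_entropy_Pair_expand:
  assumes "prob_space M" "simple_function M X" "simple_function M Y"
  defines "A \<equiv> X ` space M \<times> Y ` space M"
  shows "rv_entropy M (\<lambda>\<omega>. (X \<omega>, Y \<omega>))
      = - (\<Sum>z\<in>A. law M (\<lambda>\<omega>. (X \<omega>, Y \<omega>)) z * ln (law M (\<lambda>\<omega>. (X \<omega>, Y \<omega>)) z))"
    and "rv_entropy M Y = - (\<Sum>z\<in>A. law M (\<lambda>\<omega>. (X \<omega>, Y \<omega>)) z * ln (law M Y (snd z)))"
    and "rv_entropy M X = - (\<Sum>z\<in>A. law M (\<lambda>\<omega>. (X \<omega>, Y \<omega>)) z * ln (law M X (fst z)))"
    and "(\<Sum>z\<in>A. law M (\<lambda>\<omega>. (X \<omega>, Y \<omega>)) z) = 1"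
proof -
  have fin: "finite (X ` space M)" "finite (Y ` space M)"
    using assms by (simp_all add: simple_function_def)
  then have finA: "finite A" "(\<lambda>\<omega>. (X \<omega>, Y \<omega>)) ` space M \<subseteq> A" by (auto simp: A_def)
  then show "rv_entropy M (\<lambda>\<omega>. (X \<omega>, Y \<omega>))
      = - (\<Sum>z\<in>A. law M (\<lambda>\<omega>. (X \<omega>, Y \<omega>)) z * ln (law M (\<lambda>\<omega>. (X \<omega>, Y \<omega>)) z))"
    by (rule rv_entropy_superset)
  note lp = law_Pair_sum[OF assms(1-3)]
  have "(\<Sum>z\<in>A. law M (\<lambda>\<omega>. (X \<omega>, Y \<omega>)) z * ln (law M Y (snd z)))
      = (\<Sum>y\<in>Y ` space M. \<Sum>x\<in>X ` space M. law M (\<lambda>\<omega>. (X \<omega>, Y \<omega>)) (x, y) * ln (law M Y y))"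
    unfolding A_def by (subst sum.swap) (simp add: sum.cartesian_product case_prod_beta)
  then show "rv_entropy M Y = - (\<Sum>z\<in>A. law M (\<lambda>\<omega>. (X \<omega>, Y \<omega>)) z * ln (law M Y (snd z)))"
    by (simp add: rv_entropy_def lp(1) flip: sum_distrib_right)
  have "(\<Sum>z\<in>A. law M (\<lambda>\<omega>. (X \<omega>, Y \<omega>)) z * ln (law M X (fst z)))
      = (\<Sum>x\<in>X ` space M. \<Sum>y\<in>Y ` space M. law M (\<lambda>\<omega>. (X \<omega>, Y \<omega>)) (x, y) * ln (law M X x))"
    unfolding A_def by (simp add: sum.cartesian_product case_prod_beta)
  then show "rv_entropy M X = - (\<Sum>z\<in>A. law M (\<lambda>\<omega>. (X \<omega>, Y \<omega>)) z * ln (law M X (fst z)))"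
    by (simp add: rv_entropy_def lp(2) flip: sum_distrib_right)
  show "(\<Sum>z\<in>A. law M (\<lambda>\<omega>. (X \<omega>, Y \<omega>)) z) = 1"
    by (rule sum_law[OF assms(1) simple_function_Pair[OF assms(2,3)] finA])
qed

lemma rv_entropy_Pair_le:
  assumes "prob_space M" "simple_function M X" "simple_function M Y"
  shows "rv_entropy M (\<lambda>\<omega>. (X \<omega>, Y \<omega>)) \<le> rv_entropy M X + rv_entropy M Y"
proof -
  let ?A = "X ` space M \<times> Y ` space M" and ?p = "law M (\<lambda>\<omega>. (X \<omega>, Y \<omega>))"
  let ?r = "\<lambda>z. law M X (fst z) * law M Y (snd z)"
  have fin: "finite (X ` space M)" "finite (Y ` space M)"
    using assms by (simp_all add: simple_function_def)
  note ex = rv_entropy_Pair_expand[OF assms]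
  have pos: "0 < law M X (fst z) \<and> 0 < law M Y (snd z)" if "0 < ?p z" for z
    using that law_Pair_le[OF assms, of "fst z" "snd z"] by auto
  have "(\<Sum>z\<in>?A. ?r z) = (\<Sum>x\<in>X ` space M. law M X x) * (\<Sum>y\<in>Y ` space M. law M Y y)"
    by (simp add: sum_product sum.cartesian_product case_prod_beta)
  also have "\<dots> = 1" using sum_law[OF assms(1,2) fin(1)] sum_law[OF assms(1,3) fin(2)] by simp
  finally have "(\<Sum>z\<in>?A. ?p z * ln (?r z)) \<le> (\<Sum>z\<in>?A. ?p z * ln (?p z))"
    using fin pos ex(4) by (intro gibbs) auto
  moreover have "(\<Sum>z\<in>?A. ?p z * ln (?r z))
      = (\<Sum>z\<in>?A. ?p z * ln (law M X (fst z)) + ?p z * ln (law M Y (snd z)))"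
  proof (rule sum.cong[OF refl])
    fix z assume "z \<in> ?A"
    show "?p z * ln (?r z) = ?p z * ln (law M X (fst z)) + ?p z * ln (law M Y (snd z))"
      using pos[of z] by (cases "?p z = 0") (auto simp: ln_mult distrib_left less_le)
  qed
  ultimately show ?thesis unfolding ex(1-3) by (simp add: sum.distrib)
qed

section \<open>Fano's inequality\<close>

definition fano_bound :: "nat \<Rightarrow> real \<Rightarrow> real" where
  "fano_bound c q = - ln (1 - q) + q * ln (c / q)"

text \<open>Gibbs against the law of \<open>Y\<close> times a kernel that gives \<open>1 - q\<close>
  to the guess \<open>\<psi> y\<close> and \<open>q / c\<close> to every other value. The kernel is
  built from the bound \<open>q\<close> and not from the true error probability, so an upper
  estimate of the error suffices.\<close>

lemma fano:
  assumes "prob_space M" "simple_function M X" "simple_function M Y"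
    and q: "0 < q" "q < 1" and c: "card (X ` space M) \<le> c"
    and err: "measure M {\<omega> \<in> space M. X \<omega> \<noteq> \<psi> (Y \<omega>)} \<le> q"
  shows "rv_entropy M (\<lambda>\<omega>. (X \<omega>, Y \<omega>)) \<le> rv_entropy M Y + fano_bound c q"
proof -
  interpret prob_space M by fact
  let ?A = "X ` space M \<times> Y ` space M" and ?p = "law M (\<lambda>\<omega>. (X \<omega>, Y \<omega>))"
  let ?s = "\<lambda>z. if fst z = \<psi> (snd z) then 1 - q else q / c"
  let ?r = "\<lambda>z. law M Y (snd z) * ?s z"
  have fin: "finite (X ` space M)" "finite (Y ` space M)"
    using assms by (simp_all add: simple_function_def)
  have c0: "c > 0"
    using c fin(1) not_empty by (metis card_gt_0_iff image_is_empty le_zero_eq neq0_conv)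
  note ex = rv_entropy_Pair_expand[OF assms(1-3)]
  have pos: "0 < law M Y (snd z)" if "0 < ?p z" for z
    using that law_Pair_le[OF assms(1-3), of "fst z" "snd z"] by auto
  have spos: "0 < ?s z" for z using q c0 by auto
  \<comment> \<open>The guess may lie outside the range of \<open>X\<close>, so the kernel has mass
    at most one, which is what \<open>gibbs\<close> asks for.\<close>
  have "(\<Sum>x\<in>X ` space M. ?s (x, y)) \<le> 1" for y
  proof -
    have "(\<Sum>x\<in>X ` space M. ?s (x, y)) \<le> (\<Sum>x\<in>X ` space M. (if x = \<psi> y then 1 - q else 0) + q / c)"
      using q by (intro sum_mono) auto
    also have "\<dots> \<le> (1 - q) + card (X ` space M) * (q / c)"
      using fin q by (simp add: sum.distrib)
    also have "\<dots> \<le> (1 - q) + c * (q / c)"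
      using q c by (intro add_left_mono mult_right_mono) auto
    finally show ?thesis using c0 by simp
  qed
  then have "(\<Sum>y\<in>Y ` space M. law M Y y * (\<Sum>x\<in>X ` space M. ?s (x, y))) \<le> (\<Sum>y\<in>Y ` space M. law M Y y * 1)"
    by (intro sum_mono mult_left_mono) auto
  also have "\<dots> = 1" using sum_law[OF assms(1,3) fin(2)] by simp
  also have "(\<Sum>y\<in>Y ` space M. law M Y y * (\<Sum>x\<in>X ` space M. ?s (x, y))) = (\<Sum>z\<in>?A. ?r z)"
    unfolding sum_distrib_left
    by (subst sum.swap) (simp add: sum.cartesian_product case_prod_beta)
  finally have "(\<Sum>z\<in>?A. ?p z * ln (?r z)) \<le> (\<Sum>z\<in>?A. ?p z * ln (?p z))"
    using fin pos spos ex(4) by (intro gibbs mult_nonneg_nonneg mult_pos_pos less_imp_le[OF spos]) auto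
  moreover have "(\<Sum>z\<in>?A. ?p z * ln (?r z)) = (\<Sum>z\<in>?A. ?p z * ln (law M Y (snd z)) + ?p z * ln (?s z))"
  proof (rule sum.cong[OF refl])
    fix z assume "z \<in> ?A"
    show "?p z * ln (?r z) = ?p z * ln (law M Y (snd z)) + ?p z * ln (?s z)"
    proof (cases "?p z = 0")
      case False
      then have "0 < ?p z" by (simp add: less_le)
      then have "ln (?r z) = ln (law M Y (snd z)) + ln (?s z)"
        using pos[of z] spos[of z] ln_mult_pos[of "law M Y (snd z)" "?s z"] by blast
      then show ?thesis by (simp only: distrib_left)
    qed simp
  qed
  moreover have "- fano_bound c q \<le> (\<Sum>z\<in>?A. ?p z * ln (?s z))"
  proof -
    define e where "e = (\<Sum>z\<in>{z\<in>?A. fst z \<noteq> \<psi> (snd z)}. ?p z)"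
    have split: "sum g ?A = sum g {z\<in>?A. fst z = \<psi> (snd z)} + sum g {z\<in>?A. fst z \<noteq> \<psi> (snd z)}" for g :: "_ \<Rightarrow> real"
      using fin by (subst sum.union_disjoint[symmetric]) (auto intro!: sum.cong)
    have "e = measure M {\<omega> \<in> space M. X \<omega> \<noteq> \<psi> (Y \<omega>)}"
      using measure_simple_function[OF assms(1) simple_function_Pair[OF assms(2,3)], of ?A "{z. fst z \<noteq> \<psi> (snd z)}"] fin
      by (force simp: e_def Int_def)
    then have e: "e \<le> q" using err by simp
    have e0: "0 \<le> e" unfolding e_def by (intro sum_nonneg) auto
    have "(\<Sum>z\<in>?A. ?p z * ln (?s z)) = (1 - e) * ln (1 - q) + e * ln (q / c)"
      using split[of "\<lambda>z. ?p z * ln (?s z)"] split[of ?p] ex(4)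
      by (simp add: e_def flip: sum_distrib_right)
    \<comment> \<open>Both logarithms are at most zero since \<open>q < 1 \<le> c\<close>, so
      replacing the weights \<open>1 - e\<close> and \<open>e\<close> by the larger \<open>1\<close>
      and \<open>q\<close> can only lower the sum.\<close>
    moreover have "(1 - e) * ln (1 - q) \<ge> 1 * ln (1 - q)"
      using e0 q by (intro mult_right_mono_neg) auto
    moreover have "e * ln (q / c) \<ge> q * ln (q / c)"
      using e q c0 by (intro mult_right_mono_neg) auto
    moreover have "ln (q / c) = - ln (c / q)" using q c0 by (simp add: ln_div)
    ultimately show ?thesis by (simp add: fano_bound_def)
  qed
  ultimately show ?thesis unfolding ex(1,2) by (simp add: sum.distrib)
qed

lemma fano_bound_tendsto: "(fano_bound c \<longlongrightarrow> 0) (at_right 0)"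
proof (cases "c = 0")
  case True
  then show ?thesis unfolding fano_bound_def by simp real_asymp
next
  case False
  then have "real c > 0" by simp
  then show ?thesis unfolding fano_bound_def by real_asymp
qed

lemma simple_function_map_upt:
  assumes "\<And>l. l < s \<Longrightarrow> simple_function M (X l)"
  shows "simple_function M (\<lambda>\<omega>. map (\<lambda>l. X l \<omega>) [0..<s])"
  using assms
proof (induction s)
  case (Suc s)
  have "simple_function M (\<lambda>\<omega>. (\<lambda>(u, x). u @ [x]) (map (\<lambda>l. X l \<omega>) [0..<s], X s \<omega>))"
    using Suc by (intro simple_function_compose1[where g="\<lambda>(u, x). u @ [x]"] simple_function_Pair) auto
  then show ?case by simp
qed simp

text \<open>The letters are adjoined to \<open>Y\<close> one at a time, each at the price of one
  Fano bound. The constant \<open>c\<close> bounds a single alphabet and not the number of strings,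
  which keeps the loss per letter independent of \<open>s\<close>.\<close>

lemma fano_list:
  fixes X :: "nat \<Rightarrow> 'b \<Rightarrow> 'c" and Y :: "'b \<Rightarrow> 'd"
  assumes "prob_space M" "\<And>l. l < s \<Longrightarrow> simple_function M (X l)" "simple_function M Y"
    and q: "0 < q" "q < 1" and c: "\<And>l. l < s \<Longrightarrow> card (X l ` space M) \<le> c"
    and err: "\<And>l. l < s \<Longrightarrow> measure M {\<omega> \<in> space M. X l \<omega> \<noteq> \<psi> l (Y \<omega>)} \<le> q"
  shows "rv_entropy M (\<lambda>\<omega>. map (\<lambda>l. X l \<omega>) [0..<s]) \<le> rv_entropy M Y + real s * fano_bound c q"
proof -
  have "rv_entropy M (\<lambda>\<omega>. (map (\<lambda>l. X l \<omega>) [0..<s], Y \<omega>)) \<le> rv_entropy M Y + real s * fano_bound c q"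
    using assms(2) c err
  proof (induction s)
    case 0
    show ?case using rv_entropy_comp_le[OF assms(1,3), of "\<lambda>y. ([], y)"] by simp
  next
    case (Suc s)
    let ?Z = "\<lambda>\<omega>. (map (\<lambda>l. X l \<omega>) [0..<s], Y \<omega>)"
    have Z: "simple_function M ?Z"
      using Suc.prems(1) by (intro simple_function_Pair simple_function_map_upt assms(3)) auto
    have "rv_entropy M (\<lambda>\<omega>. (map (\<lambda>l. X l \<omega>) [0..<Suc s], Y \<omega>))
        = rv_entropy M (\<lambda>\<omega>. (\<lambda>(x, u, y). (u @ [x], y)) (X s \<omega>, ?Z \<omega>))" by simp
    also have "\<dots> \<le> rv_entropy M (\<lambda>\<omega>. (X s \<omega>, ?Z \<omega>))"
      by (intro rv_entropy_comp_le[OF assms(1)] simple_function_Pair Z Suc.prems(1)) simp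
    \<comment> \<open>The guess for the new letter reads \<open>Y\<close> and ignores the letters
      adjoined before.\<close>
    also have "\<dots> \<le> rv_entropy M ?Z + fano_bound c q"
      using Suc.prems by (intro fano[where \<psi>="\<lambda>z. \<psi> s (snd z)"] assms(1) Z q) auto
    also have "\<dots> \<le> rv_entropy M Y + real (Suc s) * fano_bound c q"
      using Suc by (simp add: algebra_simps)
    finally show ?case .
  qed
  moreover have "rv_entropy M (\<lambda>\<omega>. map (\<lambda>l. X l \<omega>) [0..<s])
      \<le> rv_entropy M (\<lambda>\<omega>. (map (\<lambda>l. X l \<omega>) [0..<s], Y \<omega>))"
    using rv_entropy_comp_le[OF assms(1) simple_function_Pair[OF simple_function_map_upt[OF assms(2)] assms(3)], where f=fst]
    by simp
  ultimately show ?thesis by linarith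
qed

section \<open>Entropy of images and of mixtures\<close>

lemma law_distr:
  assumes "f \<in> measurable M N" "simple_function N X"
  shows "law (distr M N f) X x = law M (\<lambda>\<omega>. X (f \<omega>)) x"
  using measurable_space[OF assms(1)] simple_function_level_sets(1)[OF assms(2), of x]
  by (auto simp: law_def measure_distr[OF assms(1)] intro!: arg_cong[where f="measure M"])

lemma simple_function_comp_measurable:
  assumes "f \<in> measurable M N" "simple_function N X"
  shows "simple_function M (\<lambda>\<omega>. X (f \<omega>))"
  unfolding simple_function_def
proof
  have "(\<lambda>\<omega>. X (f \<omega>)) ` space M \<subseteq> X ` space N"
    using measurable_space[OF assms(1)] by auto
  then show "finite ((\<lambda>\<omega>. X (f \<omega>)) ` space M)"
    using assms(2) finite_subset by (auto simp: simple_function_def)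
  have "(\<lambda>\<omega>. X (f \<omega>)) \<in> measurable M (count_space UNIV)"
    using measurable_compose[OF assms(1) measurable_simple_function[OF assms(2)]] .
  then show "\<forall>x\<in>(\<lambda>\<omega>. X (f \<omega>)) ` space M. (\<lambda>\<omega>. X (f \<omega>)) -` {x} \<inter> space M \<in> sets M"
    by (auto intro: measurable_sets)
qed

lemma rv_entropy_distr:
  assumes "f \<in> measurable M N" "simple_function N X"
  shows "rv_entropy (distr M N f) X = rv_entropy M (\<lambda>\<omega>. X (f \<omega>))"
proof -
  have "finite (X ` space N)" "(\<lambda>\<omega>. X (f \<omega>)) ` space M \<subseteq> X ` space N"
    using assms(2) measurable_space[OF assms(1)] by (auto simp: simple_function_def)
  then show ?thesis
    by (simp add: rv_entropy_def[of "distr M N f"] rv_entropy_superset[of "X ` space N" _ M] law_distr[OF assms])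
qed

text \<open>Concavity of entropy: Gibbs for each component against the mixture. A component is at
  most \<open>L\<close> times the mixture, which gives the support condition. The components may be
  different variables on different spaces, because only their laws enter.\<close>

lemma rv_entropy_mixture_ge:
  fixes \<mu> :: "nat \<Rightarrow> 'b measure"
  assumes "L > 0" "prob_space \<rho>" "simple_function \<rho> X"
    and j: "\<And>j. j < L \<Longrightarrow> prob_space (\<mu> j)" "\<And>j. j < L \<Longrightarrow> simple_function (\<mu> j) (Y j)"
    and mix: "\<And>x. law \<rho> X x = (\<Sum>j<L. law (\<mu> j) (Y j) x) / L"
  shows "(\<Sum>j<L. rv_entropy (\<mu> j) (Y j)) / L \<le> rv_entropy \<rho> X"
proof -
  let ?A = "X ` space \<rho> \<union> (\<Union>j<L. Y j ` space (\<mu> j))"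
  have fin: "finite ?A" using assms by (auto simp: simple_function_def)
  have "(\<Sum>x\<in>?A. law (\<mu> j) (Y j) x * ln (law \<rho> X x)) \<le> - rv_entropy (\<mu> j) (Y j)" if jL: "j < L" for j
  proof -
    have "law (\<mu> j) (Y j) x \<le> L * law \<rho> X x" for x
      using assms(1) jL member_le_sum[of j "{..<L}" "\<lambda>j. law (\<mu> j) (Y j) x"] by (simp add: mix)
    then have pos: "0 < law (\<mu> j) (Y j) x \<Longrightarrow> 0 < law \<rho> X x" for x
      using assms(1) law_nonneg[of \<rho> X x] by (metis less_le_trans mult_zero_right order_le_less not_less)
    have sub: "Y j ` space (\<mu> j) \<subseteq> ?A" using jL by auto
    have "(\<Sum>x\<in>?A. law (\<mu> j) (Y j) x * ln (law \<rho> X x)) \<le> (\<Sum>x\<in>?A. law (\<mu> j) (Y j) x * ln (law (\<mu> j) (Y j) x))"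
      using fin pos sum_law[OF assms(2,3) fin] sum_law[OF j(1) j(2) fin sub] jL by (intro gibbs) auto
    also have "\<dots> = - rv_entropy (\<mu> j) (Y j)"
      using rv_entropy_superset[OF fin sub] by simp
    finally show ?thesis .
  qed
  then have "(\<Sum>j<L. \<Sum>x\<in>?A. law (\<mu> j) (Y j) x * ln (law \<rho> X x)) \<le> (\<Sum>j<L. - rv_entropy (\<mu> j) (Y j))"
    by (intro sum_mono) auto
  also have "(\<Sum>j<L. \<Sum>x\<in>?A. law (\<mu> j) (Y j) x * ln (law \<rho> X x)) = (\<Sum>x\<in>?A. L * law \<rho> X x * ln (law \<rho> X x))"
    using assms(1) by (subst sum.swap) (simp add: mix flip: sum_distrib_right)
  also have "\<dots> = - (L * rv_entropy \<rho> X)"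
    using rv_entropy_superset[OF fin, of X \<rho>] by (simp add: sum_distrib_left mult.assoc)
  finally show ?thesis using assms(1) by (simp add: sum_negf field_simps)
qed

section \<open>Entropy of an invariant measure with respect to a partition\<close>

text \<open>Divide \<open>n\<close> by a fixed \<open>m\<close> whose ratio nearly attains the
  infimum; the remainder costs at most the maximum \<open>C\<close> over \<open>r < m\<close>. Since
  the limit is the infimum it bounds each single ratio from below, and this second conclusion later
  gives the entropy of words of one fixed length.\<close>

lemma fekete:
  fixes a :: "nat \<Rightarrow> real"
  assumes sub: "\<And>m n. a (m + n) \<le> a m + a n" and nn: "\<And>n. 0 \<le> a n"
  obtains l where "(\<lambda>n. a n / n) \<longlonglongrightarrow> l" "\<And>n. n > 0 \<Longrightarrow> n * l \<le> a n"
proof -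
  define l where "l = (INF n\<in>{0<..}. a n / real n)"
  have bdd: "bdd_below ((\<lambda>n. a n / real n) ` {0<..})"
    by (rule bdd_belowI[of _ 0]) (auto simp: nn)
  have l_le: "l \<le> a n / n" if "n > 0" for n
    unfolding l_def using that by (intro cINF_lower bdd) auto
  have mult: "a (k * m) \<le> k * a m" if "k > 0" for k m
    using that
  proof (induction k rule: nat_induct_non_zero)
    case (Suc k)
    then show ?case using sub[of m "k * m"] by (simp add: algebra_simps)
  qed simp
  have "(\<lambda>n. a n / n) \<longlonglongrightarrow> l"
  proof (rule LIMSEQ_I)
    fix e :: real assume e: "e > 0"
    have "\<exists>x\<in>(\<lambda>n. a n / real n) ` {0<..}. x < l + e / 2"
      unfolding l_def using e bdd by (subst cInf_less_iff[symmetric]) auto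
    then obtain m where m: "m > 0" "a m / m < l + e / 2" by auto
    define C where "C = Max (a ` {..<m})"
    have C: "a r \<le> C" if "r < m" for r using that by (auto simp: C_def)
    obtain N :: nat where N: "N > 0" "C / N < e / 2" "N \<ge> m"
    proof -
      obtain N0 :: nat where "real N0 > 2 * C / e" using reals_Archimedean2 by blast
      then have "C < e / 2 * N0" using e by (simp add: field_simps)
      also have "\<dots> \<le> e / 2 * max N0 m" using e by (intro mult_left_mono) auto
      finally have "C / (max N0 m) < e / 2" using m by (simp add: field_simps)
      then show ?thesis using that[of "max N0 m"] m by auto
    qed
    have "norm (a n / n - l) < e" if n: "n \<ge> N" for n
    proof -
      have n0: "n > 0" and nm: "n div m > 0" using n N m by (auto simp: div_greater_zero_iff)
      have "a n \<le> a (n div m * m) + a (n mod m)" using sub[of "n div m * m" "n mod m"] by simp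
      also have "\<dots> \<le> (n div m) * a m + C"
        using mult[OF nm, of m] C m by (intro add_mono) auto
      also have "(n div m) * a m = (n div m * m) * (a m / m)" using m by simp
      \<comment> \<open>Rounding \<open>n div m * m\<close> up to \<open>n\<close> is allowed
        because \<open>a m\<close> is nonnegative.\<close>
      also have "\<dots> \<le> n * (a m / m)"
        using nn m by (intro mult_right_mono of_nat_mono) (auto simp: div_times_less_eq_dividend)
      finally have "a n / n \<le> a m / m + C / n" using n0 by (simp add: field_simps)
      moreover have "C / n \<le> C / N"
        using n N nn[of 0] C[of 0] m by (intro divide_left_mono) auto
      ultimately have "a n / n < l + e" using m N(2) by linarith
      then show ?thesis using l_le[OF n0] e by (auto simp: abs_less_iff)
    qed
    then show "\<exists>no. \<forall>n\<ge>no. norm (a n / n - l) < e" by blast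
  qed
  moreover have "n * l \<le> a n" if "n > 0" for n using l_le[OF that] that by (simp add: field_simps)
  ultimately show ?thesis by (rule that)
qed

definition itinerary :: "('b \<Rightarrow> 'b) \<Rightarrow> ('b \<Rightarrow> 'x) \<Rightarrow> nat \<Rightarrow> 'b \<Rightarrow> 'x list" where
  "itinerary S X n y = map (\<lambda>j. X ((S ^^ j) y)) [0..<n]"

lemma itinerary_nth [simp]: "j < n \<Longrightarrow> itinerary S X n y ! j = X ((S ^^ j) y)"
  by (simp add: itinerary_def)

lemma length_itinerary [simp]: "length (itinerary S X n y) = n"
  by (simp add: itinerary_def)

lemma itinerary_add: "itinerary S X (m + n) y = itinerary S X m y @ itinerary S X n ((S ^^ m) y)"
proof (rule nth_equalityI)
  fix j assume "j < length (itinerary S X (m + n) y)"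
  moreover have "(S ^^ j) y = (S ^^ (j - m)) ((S ^^ m) y)" if "m \<le> j"
    using that by (metis comp_apply funpow_add le_add_diff_inverse2)
  ultimately show "itinerary S X (m + n) y ! j = (itinerary S X m y @ itinerary S X n ((S ^^ m) y)) ! j"
    by (auto simp: nth_append)
qed simp

lemma itinerary_eq_iff:
  "itinerary S X n y = itinerary S X n z \<longleftrightarrow> (\<forall>j<n. X ((S ^^ j) y) = X ((S ^^ j) z))"
  by (auto simp: itinerary_def)

definition entropy_rate :: "'b measure \<Rightarrow> ('b \<Rightarrow> 'b) \<Rightarrow> ('b \<Rightarrow> 'x) \<Rightarrow> real" where
  "entropy_rate M S X = lim (\<lambda>n. rv_entropy M (itinerary S X n) / n)"

lemma distr_funpow:
  assumes f: "f \<in> measurable M M" and "distr M M f = M"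
  shows "distr M M (f ^^ j) = M"
proof (induction j)
  case (Suc j)
  have "distr M M (f ^^ Suc j) = distr (distr M M (f ^^ j)) M f"
    by (simp add: distr_distr f measurable_compose_n)
  then show ?case by (simp only: Suc assms(2))
qed (simp add: distr_id2[of M M])

locale mpt = prob_space M for M :: "'b measure" +
  fixes S :: "'b \<Rightarrow> 'b"
  assumes S_meas: "S \<in> measurable M M" and S_inv: "distr M M S = M"
begin

lemmas funpow_meas = measurable_compose_n[OF S_meas]

lemmas funpow_inv = distr_funpow[OF S_meas S_inv]

lemma simple_itinerary:
  assumes "simple_function M X"
  shows "simple_function M (itinerary S X n)"
  unfolding itinerary_def
  by (intro simple_function_map_upt simple_function_comp_measurable[OF funpow_meas assms])

lemma rv_entropy_funpow:
  assumes "simple_function M X"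
  shows "rv_entropy M (\<lambda>y. X ((S ^^ j) y)) = rv_entropy M X"
  using rv_entropy_distr[OF funpow_meas assms, of j] by (simp add: funpow_inv)

text \<open>An itinerary cut at time \<open>m\<close> is a pair whose second half has, by
  invariance, the entropy of an initial itinerary; the subadditivity obtained feeds
  \<open>fekete\<close>.\<close>

lemma entropy_rate_limit:
  assumes "simple_function M X"
  shows "(\<lambda>n. rv_entropy M (itinerary S X n) / n) \<longlonglongrightarrow> entropy_rate M S X"
    and "n * entropy_rate M S X \<le> rv_entropy M (itinerary S X n)"
proof -
  let ?a = "\<lambda>n. rv_entropy M (itinerary S X n)"
  note si = simple_itinerary[OF assms]
  have "?a (m + n) \<le> ?a m + ?a n" for m n
  proof -
    have "?a (m + n) = rv_entropy M (\<lambda>y. (\<lambda>(u, v). u @ v) (itinerary S X m y, itinerary S X n ((S ^^ m) y)))"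
      by (simp add: itinerary_add[abs_def])
    also have "\<dots> \<le> rv_entropy M (\<lambda>y. (itinerary S X m y, itinerary S X n ((S ^^ m) y)))"
      by (intro rv_entropy_comp_le prob_space_axioms simple_function_Pair si
          simple_function_comp_measurable[OF funpow_meas si])
    also have "\<dots> \<le> ?a m + rv_entropy M (\<lambda>y. itinerary S X n ((S ^^ m) y))"
      by (intro rv_entropy_Pair_le prob_space_axioms si simple_function_comp_measurable[OF funpow_meas si])
    finally show ?thesis by (simp add: rv_entropy_funpow[OF si])
  qed
  then obtain l where l: "(\<lambda>n. ?a n / n) \<longlonglongrightarrow> l" "\<And>n. n > 0 \<Longrightarrow> n * l \<le> ?a n"
    using fekete[of ?a] rv_entropy_nonneg[OF prob_space_axioms] by metis
  then have "entropy_rate M S X = l" by (simp add: entropy_rate_def limI)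
  then show "(\<lambda>n. ?a n / n) \<longlonglongrightarrow> entropy_rate M S X" using l by simp
  show "n * entropy_rate M S X \<le> ?a n"
    using l(2)[of n] \<open>entropy_rate M S X = l\<close> rv_entropy_nonneg[OF prob_space_axioms]
    by (cases "n = 0") auto
qed

end

section \<open>Partitions as level sets of simple functions, and generators\<close>

lemma partition_entropy_level_sets:
  "partition_entropy M ((\<lambda>v. {y \<in> space M. X y = v}) ` (X ` space M)) = rv_entropy M X"
proof -
  have "inj_on (\<lambda>v. {y \<in> space M. X y = v}) (X ` space M)"
    by (auto simp: inj_on_def)
  then show ?thesis by (simp add: partition_entropy_def rv_entropy_def law_def sum.reindex)
qed

text \<open>Converts the joins in the definition of entropy into random variables, on which all
  estimates are made. Discarding the empty intersection corresponds to keeping only itineraries that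
  occur.\<close>

lemma iterated_join_level_sets:
  assumes "S \<in> space M \<rightarrow> space M"
  shows "iterated_join M S ((\<lambda>v. {y \<in> space M. X y = v}) ` (X ` space M)) n
    = (\<lambda>u. {y \<in> space M. itinerary S X n y = u}) ` (itinerary S X n ` space M)" (is "?L = ?R")
proof
  have fp: "(S ^^ j) y \<in> space M" if "y \<in> space M" for j y
    using that assms by (induction j) auto
  show "?L \<subseteq> ?R"
  proof
    fix C assume "C \<in> ?L"
    then obtain A where A: "C = {y \<in> space M. \<forall>j<n. (S ^^ j) y \<in> A j}" "C \<noteq> {}"
      "\<forall>j<n. A j \<in> (\<lambda>v. {y \<in> space M. X y = v}) ` (X ` space M)"
      by (auto simp: iterated_join_def)
    then have "\<forall>j<n. \<exists>v. A j = {y \<in> space M. X y = v}" by blast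
    then obtain v where v: "\<And>j. j < n \<Longrightarrow> A j = {y \<in> space M. X y = v j}" by metis
    obtain z where z: "z \<in> C" using A(2) by auto
    have "C = {y \<in> space M. itinerary S X n y = itinerary S X n z}"
      using z v fp by (auto simp: A(1) itinerary_eq_iff)
    then show "C \<in> ?R" using z A(1) by auto
  qed
  show "?R \<subseteq> ?L"
  proof
    fix C assume "C \<in> ?R"
    then obtain z where z: "z \<in> space M" "C = {y \<in> space M. itinerary S X n y = itinerary S X n z}"
      by auto
    then have "C = {y \<in> space M. \<forall>j<n. (S ^^ j) y \<in> {y \<in> space M. X y = X ((S ^^ j) z)}}"
      using fp by (auto simp: itinerary_eq_iff)
    then show "C \<in> ?L"
      unfolding iterated_join_def using z fp
      by (auto intro!: exI[of _ "\<lambda>j. {y \<in> space M. X y = X ((S ^^ j) z)}"])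
  qed
qed

lemma entropy_wrt_partition_level_sets:
  assumes "S \<in> space M \<rightarrow> space M"
  shows "entropy_wrt_partition M S ((\<lambda>v. {y \<in> space M. X y = v}) ` (X ` space M)) = entropy_rate M S X"
  unfolding entropy_wrt_partition_def entropy_rate_def iterated_join_level_sets[OF assms]
    partition_entropy_level_sets ..

lemma level_sets_in_finite_partitions:
  assumes "simple_function M X"
  shows "(\<lambda>v. {y \<in> space M. X y = v}) ` (X ` space M) \<in> finite_partitions M"
  using assms simple_function_level_sets[OF assms]
  by (auto simp: finite_partitions_def partition_on_def disjoint_def simple_function_def)

text \<open>The map sending a point to its own cell does this, which is why the simple functions in
  the generator lemma are set-valued.\<close>

lemma finite_partition_level_setsE:
  assumes "P \<in> finite_partitions M"
  obtains X :: "'b \<Rightarrow> 'b set" where "simple_function M X" "P = (\<lambda>v. {y \<in> space M. X y = v}) ` (X ` space M)"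
proof -
  have P: "finite P" "P \<subseteq> sets M" "\<Union> P = space M" "disjoint P" "{} \<notin> P"
    using assms by (auto simp: finite_partitions_def partition_on_def)
  define X where "X y = (THE A. A \<in> P \<and> y \<in> A)" for y
  have X: "X y = A" if "A \<in> P" "y \<in> A" for A y
    unfolding X_def using that P(4) by (intro the_equality) (auto simp: disjoint_def)
  have lev: "{y \<in> space M. X y = A} = A" if "A \<in> P" for A
  proof
    show "{y \<in> space M. X y = A} \<subseteq> A"
    proof
      fix y assume y: "y \<in> {y \<in> space M. X y = A}"
      then obtain B where "B \<in> P" "y \<in> B" using P(3) by auto
      then show "y \<in> A" using X y by auto
    qed
    show "A \<subseteq> {y \<in> space M. X y = A}" using that X P(3) by auto
  qed
  have range: "X ` space M = P"
  proof
    show "X ` space M \<subseteq> P" using X P(3) by (metis (no_types, lifting) UnionE image_subsetI)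
    show "P \<subseteq> X ` space M"
    proof
      fix A assume A: "A \<in> P"
      then obtain y where "y \<in> A" using P(5) by (metis all_not_in_conv)
      then show "A \<in> X ` space M" using A X P(3) by (metis UnionI imageI)
    qed
  qed
  have "simple_function M X"
    unfolding simple_function_def range using P(1,2) lev
    by (auto simp: vimage_def Int_def conj_commute)
  moreover have "P = (\<lambda>v. {y \<in> space M. X y = v}) ` (X ` space M)"
    unfolding range using lev by auto
  ultimately show ?thesis by (rule that)
qed

context mpt
begin

lemma S_space: "S \<in> space M \<rightarrow> space M"
  using measurable_space[OF S_meas] by auto

lemma entropy_rate_le_KS:
  assumes "simple_function M X"
  shows "ereal (entropy_rate M S X) \<le> KS_entropy M S"
  unfolding KS_entropy_def entropy_wrt_partition_level_sets[OF S_space, symmetric]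
  by (rule SUP_upper[OF level_sets_in_finite_partitions[OF assms]])

text \<open>Fano's inequality is applied to each coordinate of the itinerary of \<open>f\<close>, guessed from the
  itinerary of \<open>g\<close>.\<close>

lemma KS_entropy_le_generator:
  assumes g: "simple_function M g"
    and gen: "\<And>(f :: 'b \<Rightarrow> 'b set) q. simple_function M f \<Longrightarrow> 0 < q \<Longrightarrow>
      \<exists>m \<psi>. measure M {y \<in> space M. f y \<noteq> \<psi> (itinerary S g m y)} \<le> q"
  shows "KS_entropy M S \<le> ereal (entropy_rate M S g)"
  unfolding KS_entropy_def
proof (rule SUP_least)
  fix P assume "P \<in> finite_partitions M"
  then obtain f :: "'b \<Rightarrow> 'b set" where f: "simple_function M f" and P: "P = (\<lambda>v. {y \<in> space M. f y = v}) ` (f ` space M)"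
    by (rule finite_partition_level_setsE)
  define c where "c = card (f ` space M)"
  have bound: "entropy_rate M S f \<le> entropy_rate M S g + fano_bound c q" if q: "0 < q" "q < 1" for q
  proof -
    obtain m \<psi> where m: "measure M {y \<in> space M. f y \<noteq> \<psi> (itinerary S g m y)} \<le> q"
      using gen[OF f q(1)] by blast
    let ?H = "\<lambda>n. rv_entropy M (itinerary S f n)" and ?G = "\<lambda>n. rv_entropy M (itinerary S g n)"
    \<comment> \<open>The guess of \<open>f\<close> at time \<open>l < n\<close> reads the window of
      length \<open>m\<close> starting at \<open>l\<close> in the itinerary of \<open>g\<close>;
      with length \<open>n + m\<close> every window fits.\<close>
    have le1: "?H n \<le> ?G (n + m) + n * fano_bound c q" for n
    proof -
      have "?H n = rv_entropy M (\<lambda>y. map (\<lambda>l. f ((S ^^ l) y)) [0..<n])"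
        by (simp add: itinerary_def[abs_def])
      also have "\<dots> \<le> ?G (n + m) + n * fano_bound c q"
      proof (rule fano_list[where \<psi>="\<lambda>l u. \<psi> (take m (drop l u))"])
        fix l assume l: "l < n"
        show "simple_function M (\<lambda>y. f ((S ^^ l) y))"
          by (rule simple_function_comp_measurable[OF funpow_meas f])
        have "(\<lambda>y. f ((S ^^ l) y)) ` space M \<subseteq> f ` space M"
          using measurable_space[OF funpow_meas] by auto
        then show "card ((\<lambda>y. f ((S ^^ l) y)) ` space M) \<le> c"
          unfolding c_def using f by (intro card_mono) (auto simp: simple_function_def)
        have tk: "take m (drop l (itinerary S g (n + m) y)) = itinerary S g m ((S ^^ l) y)" for y
        proof -
          have eq: "n + m = l + (m + (n - l))" using l by simp
          show ?thesis unfolding eq itinerary_add by simp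
        qed
        let ?E = "{y \<in> space M. f y \<noteq> \<psi> (itinerary S g m y)}"
        have E: "?E \<in> sets M"
          using simple_function_level_sets(2)[OF simple_function_Pair[OF f simple_itinerary[OF g]], where B="{z. fst z \<noteq> \<psi> (snd z)}"]
          by simp
        have "{y \<in> space M. f ((S ^^ l) y) \<noteq> \<psi> (take m (drop l (itinerary S g (n + m) y)))} = (S ^^ l) -` ?E \<inter> space M"
          unfolding tk using measurable_space[OF funpow_meas] by auto
        also have "measure M \<dots> = measure (distr M M (S ^^ l)) ?E"
          by (rule measure_distr[OF funpow_meas E, symmetric])
        also have "\<dots> \<le> q" using m by (simp add: funpow_inv)
        finally show "measure M {y \<in> space M. f ((S ^^ l) y) \<noteq> \<psi> (take m (drop l (itinerary S g (n + m) y)))} \<le> q" .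
      qed (use q simple_itinerary[OF g] prob_space_axioms in auto)
      finally show ?thesis .
    qed
    \<comment> \<open>Dividing by \<open>n + m\<close> lets the limit of the entropy rate apply; the
      correcting factor \<open>(n + m) / n\<close> tends to one.\<close>
    then have le: "\<forall>\<^sub>F n in sequentially. ?H n / n \<le> ?G (n + m) / (n + m) * ((n + m) / n) + fano_bound c q"
    proof (intro eventually_sequentiallyI[of 1])
      fix n :: nat assume n: "1 \<le> n"
      have "?G (n + m) / (n + m) * ((n + m) / n) = ?G (n + m) / n" using n by simp
      then show "?H n / n \<le> ?G (n + m) / (n + m) * ((n + m) / n) + fano_bound c q"
        using le1[of n] n by (simp add: field_simps)
    qed
    have "(\<lambda>n. ?G (n + m) / real (n + m)) \<longlonglongrightarrow> entropy_rate M S g"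
      using LIMSEQ_ignore_initial_segment[OF entropy_rate_limit(1)[OF g], of m] by simp
    moreover have "(\<lambda>n. real (n + m) / real n) \<longlonglongrightarrow> 1"
      by real_asymp
    ultimately have "(\<lambda>n. ?G (n + m) / real (n + m) * (real (n + m) / real n) + fano_bound c q)
        \<longlonglongrightarrow> entropy_rate M S g * 1 + fano_bound c q"
      by (intro tendsto_intros)
    from tendsto_le[OF _ this entropy_rate_limit(1)[OF f] ] le show ?thesis by simp
  qed
  \<comment> \<open>The alphabet size \<open>c\<close> depends on \<open>f\<close> alone, so the
    loss vanishes as \<open>q\<close> tends to zero.\<close>
  have "((\<lambda>q. entropy_rate M S g + fano_bound c q) \<longlongrightarrow> entropy_rate M S g + 0) (at_right 0)"
    by (intro tendsto_intros fano_bound_tendsto)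
  moreover have "\<forall>\<^sub>F q in at_right 0. entropy_rate M S f \<le> entropy_rate M S g + fano_bound c q"
    using bound by (auto simp: eventually_at_right_field intro!: exI[of _ 1])
  ultimately have "entropy_rate M S f \<le> entropy_rate M S g + 0"
    by (rule tendsto_lowerbound) simp
  then show "ereal (entropy_wrt_partition M S P) \<le> ereal (entropy_rate M S g)"
    unfolding P entropy_wrt_partition_level_sets[OF S_space] by simp
qed

end

section \<open>Measures on symbol sequences\<close>

definition seq_space :: "(nat \<Rightarrow> nat) measure" where
  "seq_space = PiM UNIV (\<lambda>_. count_space UNIV)"

definition prefix :: "nat \<Rightarrow> (nat \<Rightarrow> 'x) \<Rightarrow> 'x list" where
  "prefix n b = map b [0..<n]"

definition cyl :: "'x list \<Rightarrow> (nat \<Rightarrow> 'x) set" where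
  "cyl u = {b. prefix (length u) b = u}"

lemma space_seq_space [simp]: "space seq_space = UNIV"
  by (simp add: seq_space_def space_PiM)

lemma length_prefix [simp]: "length (prefix n b) = n"
  by (simp add: prefix_def)

lemma nth_prefix [simp]: "i < n \<Longrightarrow> prefix n b ! i = b i"
  by (simp add: prefix_def)

lemma prefix_eq_iff: "prefix n b = u \<longleftrightarrow> length u = n \<and> (\<forall>i<n. b i = u ! i)"
  by (auto simp: list_eq_iff_nth_eq)

lemma prefix_Suc: "prefix (Suc n) b = prefix n b @ [b n]"
  by (simp add: prefix_def)

lemma prefix_Suc_Cons: "prefix (Suc n) b = b 0 # prefix n (shift b)"
  by (auto simp: list_eq_iff_nth_eq nth_Cons shift_def split: nat.splits)

lemma take_prefix: "m \<le> n \<Longrightarrow> take m (prefix n b) = prefix m b"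
  by (auto simp: list_eq_iff_nth_eq)

lemma shift_funpow: "(shift ^^ n) b i = b (i + n)"
  by (induction n arbitrary: i) (auto simp: shift_def)

lemma drop_prefix: "drop m (prefix n b) = prefix (n - m) ((shift ^^ m) b)"
  by (auto simp: list_eq_iff_nth_eq shift_funpow add.commute)

lemma component_measurable [measurable]: "(\<lambda>b. b i) \<in> measurable seq_space (count_space UNIV)"
  unfolding seq_space_def by measurable

lemma measurable_shift [measurable]: "shift \<in> measurable seq_space seq_space"
proof -
  have "(\<lambda>b j. b (Suc j)) \<in> measurable seq_space seq_space"
    unfolding seq_space_def by (rule measurable_PiM_single') auto
  then show ?thesis by (simp add: shift_def[abs_def])
qed

lemma measurable_prefix [measurable]: "prefix n \<in> measurable seq_space (count_space UNIV)"
proof (subst measurable_count_space_eq2_countable, safe)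
  fix u :: "nat list"
  have "{b \<in> space seq_space. length u = n \<and> (\<forall>i<n. b i = u ! i)} \<in> sets seq_space"
    by measurable
  also have "{b \<in> space seq_space. length u = n \<and> (\<forall>i<n. b i = u ! i)} = prefix n -` {u} \<inter> space seq_space"
    by (auto simp: prefix_eq_iff)
  finally show "prefix n -` {u} \<inter> space seq_space \<in> sets seq_space" .
qed auto

lemma sets_cyl [measurable]: "cyl u \<in> sets seq_space"
  using measurable_sets[OF measurable_prefix, of "{u}" "length u"]
  by (simp add: cyl_def vimage_def)

lemma cyl_Nil [simp]: "cyl [] = UNIV"
  by (simp add: cyl_def prefix_def)

lemma cyl_Int: "length u \<le> length v \<Longrightarrow> cyl u \<inter> cyl v = (if take (length u) v = u then cyl v else {})"
  by (auto simp: cyl_def) (metis take_prefix)+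

text \<open>The empty set is adjoined because incompatible cylinders are disjoint; the family is
  then closed under intersection.\<close>

definition cylinders :: "(nat \<Rightarrow> nat) set set" where
  "cylinders = insert {} (range cyl)"

lemma Int_stable_cylinders: "Int_stable cylinders"
proof (rule Int_stableI)
  fix A B assume "A \<in> cylinders" "B \<in> cylinders"
  then consider "A = {} \<or> B = {}" | u v where "A = cyl u" "B = cyl v"
    by (auto simp: cylinders_def)
  then show "A \<inter> B \<in> cylinders"
  proof cases
    case (2 u v)
    then show ?thesis
      using cyl_Int[of u v] cyl_Int[of v u]
      by (cases "length u \<le> length v") (auto simp: cylinders_def Int_commute)
  qed (auto simp: cylinders_def)
qed

lemma sigma_sets_cylinders: "sets seq_space = sigma_sets UNIV cylinders"
proof
  have "cylinders \<subseteq> sets seq_space" by (auto simp: cylinders_def)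
  then show "sigma_sets UNIV cylinders \<subseteq> sets seq_space"
    using sets.sigma_sets_subset[of cylinders seq_space] by simp
  have "{f. f i \<in> A} \<in> sigma_sets UNIV cylinders" for i and A :: "nat set"
  proof -
    have "{f. f i \<in> A} = (\<Union>u\<in>{u. length u = Suc i \<and> u ! i \<in> A}. cyl u)"
      by (auto simp: cyl_def intro!: exI[of _ "prefix (Suc i) _"])
    moreover have "(\<Union>u\<in>{u. length u = Suc i \<and> u ! i \<in> A}. cyl u) \<in> sigma_sets UNIV cylinders"
      by (rule sigma_sets_UNION) (auto simp: cylinders_def)
    ultimately show ?thesis by simp
  qed
  then show "sets seq_space \<subseteq> sigma_sets UNIV cylinders"
    unfolding seq_space_def sets_PiM_single
    by (simp add: PiE_UNIV_domain) (intro sigma_sets_mono, auto)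
qed

lemma seq_measure_eqI:
  assumes "prob_space M" "prob_space N" "sets M = sets seq_space" "sets N = sets seq_space"
    and eq: "\<And>u. measure M (cyl u) = measure N (cyl u)"
  shows "M = N"
proof (rule measure_eqI_generator_eq[OF Int_stable_cylinders, where A="\<lambda>_. UNIV"])
  interpret M: prob_space M by fact
  interpret N: prob_space N by fact
  show "emeasure M X = emeasure N X" if "X \<in> cylinders" for X
    using that eq by (auto simp: cylinders_def M.emeasure_eq_measure N.emeasure_eq_measure)
  show "sets M = sigma_sets UNIV cylinders" "sets N = sigma_sets UNIV cylinders"
    by (simp_all add: assms sigma_sets_cylinders)
  show "range (\<lambda>_. UNIV) \<subseteq> cylinders"
    by (auto simp: cylinders_def intro: range_eqI[where x="[]"])
  show "emeasure M UNIV \<noteq> \<infinity>" by simp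
qed auto

section \<open>Words over a finite alphabet and measures with prescribed cylinder masses\<close>

lemma pmf_map_finite:
  assumes "finite A" "set_pmf F \<subseteq> A"
  shows "pmf (map_pmf h F) x = (\<Sum>y\<in>{y\<in>A. h y = x}. pmf F y)"
proof -
  have "pmf (map_pmf h F) x = measure F (h -` {x} \<inter> set_pmf F)"
    by (simp add: pmf_map measure_Int_set_pmf)
  also have "\<dots> = measure F ({y\<in>A. h y = x} \<inter> set_pmf F)"
    using assms(2) by (intro arg_cong[where f="measure F"]) auto
  also have "\<dots> = (\<Sum>y\<in>{y\<in>A. h y = x}. pmf F y)"
    using assms(1) by (simp add: measure_Int_set_pmf measure_measure_pmf_finite)
  finally show ?thesis .
qed

lemma finite_words: "finite Bt \<Longrightarrow> finite {u. set u \<subseteq> Bt \<and> length u = n}"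
  by (rule finite_lists_length_eq)

lemma sum_words_snoc:
  fixes f :: "'x list \<Rightarrow> real"
  shows "(\<Sum>v\<in>{v. (set v \<subseteq> Bt \<and> length v = Suc (length u)) \<and> butlast v = u}. f v)
    = (if set u \<subseteq> Bt then \<Sum>b\<in>Bt. f (u @ [b]) else 0)"
proof (cases "set u \<subseteq> Bt")
  case True
  have "{v. (set v \<subseteq> Bt \<and> length v = Suc (length u)) \<and> butlast v = u} = (\<lambda>b. u @ [b]) ` Bt"
  proof (intro equalityI subsetI)
    fix v assume v: "v \<in> {v. (set v \<subseteq> Bt \<and> length v = Suc (length u)) \<and> butlast v = u}"
    then have "v = u @ [last v]" "last v \<in> set v"
      by (auto simp: append_butlast_last_id[symmetric] simp del: append_butlast_last_id intro!: last_in_set)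
         (metis append_butlast_last_id length_0_conv nat.simps(3))
    then show "v \<in> (\<lambda>b. u @ [b]) ` Bt" using v by blast
  qed (use True in auto)
  then show ?thesis using True by (simp add: sum.reindex inj_on_def)
next
  case False
  then have "{v. (set v \<subseteq> Bt \<and> length v = Suc (length u)) \<and> butlast v = u} = {}"
    by (auto dest: in_set_butlastD)
  then show ?thesis using False by (simp only: sum.empty if_False)
qed

lemma sum_words_Cons:
  fixes f :: "'x list \<Rightarrow> real"
  shows "(\<Sum>v\<in>{v. (set v \<subseteq> Bt \<and> length v = Suc (length u)) \<and> tl v = u}. f v)
    = (if set u \<subseteq> Bt then \<Sum>b\<in>Bt. f (b # u) else 0)"
proof (cases "set u \<subseteq> Bt")
  case True
  have "{v. (set v \<subseteq> Bt \<and> length v = Suc (length u)) \<and> tl v = u} = (\<lambda>b. b # u) ` Bt"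
    using True by (auto simp: length_Suc_conv)
  then show ?thesis using True by (simp add: sum.reindex inj_on_def)
next
  case False
  then have "{v. (set v \<subseteq> Bt \<and> length v = Suc (length u)) \<and> tl v = u} = {}"
    by (auto simp: length_Suc_conv)
  then show ?thesis using False by (simp only: sum.empty if_False)
qed

text \<open>The library states Kolmogorov's extension theorem for the class \<open>polish_space\<close>, which has no
  instance \<open>nat\<close>; letters are therefore embedded into the reals.\<close>

lemma measure_from_cylinders:
  fixes g :: "nat list \<Rightarrow> real"
  assumes fin: "finite Bt" and nn: "\<And>u. 0 \<le> g u" and one: "g [] = 1"
    and out: "\<And>u. \<not> set u \<subseteq> Bt \<Longrightarrow> g u = 0"
    and right: "\<And>u. g u = (\<Sum>b\<in>Bt. g (u @ [b]))"
  obtains \<theta> where "prob_space \<theta>" "sets \<theta> = sets seq_space" "\<And>u. measure \<theta> (cyl u) = g u"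
proof -
  define W where "W n = {u. set u \<subseteq> Bt \<and> length u = n}" for n
  have finW: "finite (W n)" for n unfolding W_def by (rule finite_words[OF fin])
  have snoc: "(\<Sum>v\<in>{v\<in>W (Suc (length u)). butlast v = u}. g v) = g u" for u
    using sum_words_snoc[where Bt=Bt and u=u and f=g] right[of u] out[of u] by (auto simp: W_def)
  have sum1: "(\<Sum>u\<in>W n. g u) = 1" for n
  proof (induction n)
    case 0
    have "W 0 = {[]}" by (auto simp: W_def)
    then show ?case by (simp add: one)
  next
    case (Suc n)
    have "butlast ` W (Suc n) \<subseteq> W n" by (auto simp: W_def dest: in_set_butlastD)
    then have "(\<Sum>v\<in>W (Suc n). g v) = (\<Sum>u\<in>W n. \<Sum>v\<in>{v\<in>W (Suc n). butlast v = u}. g v)"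
      by (rule sum.group[OF finW finW, symmetric])
    also have "\<dots> = (\<Sum>u\<in>W n. g u)"
      using snoc by (intro sum.cong) (auto simp: W_def)
    finally show ?case using Suc by simp
  qed
  \<comment> \<open>\<open>G n\<close> is to be the law of the first \<open>n\<close> letters.
    Consistency of \<open>g\<close> says that \<open>butlast\<close> carries
    \<open>G (Suc n)\<close> to \<open>G n\<close>, and this is the source of projectivity.\<close>
  define G where "G n = embed_pmf (\<lambda>u. if u \<in> W n then g u else 0)" for n
  have pmfG: "pmf (G n) u = (if u \<in> W n then g u else 0)" for n u
    unfolding G_def
  proof (rule pmf_embed_pmf)
    have "(\<integral>\<^sup>+ u. ennreal (if u \<in> W n then g u else 0) \<partial>count_space UNIV) = (\<Sum>u\<in>W n. ennreal (g u))"
      by (subst nn_integral_count_space'[where A="W n"]) (auto simp: finW)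
    also have "\<dots> = ennreal (\<Sum>u\<in>W n. g u)" using nn by (intro sum_ennreal) auto
    finally show "(\<integral>\<^sup>+ u. ennreal (if u \<in> W n then g u else 0) \<partial>count_space UNIV) = 1"
      by (simp add: sum1)
  qed (auto simp: nn)
  have setG: "set_pmf (G n) \<subseteq> W n" for n by (auto simp: set_pmf_eq pmfG)
  have lenG: "u \<in> set_pmf (G n) \<Longrightarrow> length u = n" for u n using setG[of n] by (auto simp: W_def)
  have butG: "map_pmf butlast (G (Suc n)) = G n" for n
  proof (rule pmf_eqI)
    fix u
    have *: "pmf (map_pmf butlast (G (Suc n))) u = (\<Sum>v\<in>{v\<in>W (Suc n). butlast v = u}. g v)"
      unfolding pmf_map_finite[OF finW setG] by (intro sum.cong) (auto simp: pmfG)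
    show "pmf (map_pmf butlast (G (Suc n))) u = pmf (G n) u"
    proof (cases "length u = n")
      case True
      then show ?thesis using snoc[of u] out[of u] by (auto simp: * pmfG W_def)
    next
      case False
      then have "{v\<in>W (Suc n). butlast v = u} = {}" by (auto simp: W_def)
      then show ?thesis using False by (simp only: * sum.empty pmfG) (simp add: W_def)
    qed
  qed
  have takeG: "map_pmf (take n) (G (n + k)) = G n" for n k
  proof (induction k)
    case 0
    have "map_pmf (take n) (G n) = map_pmf id (G n)"
      by (rule pmf.map_cong0) (auto dest: lenG)
    then show ?case by simp
  next
    case (Suc k)
    have "map_pmf (take n) (G (n + Suc k)) = map_pmf (take n \<circ> butlast) (G (n + Suc k))"
      by (rule pmf.map_cong0) (auto dest!: lenG simp: take_butlast)
    also have "\<dots> = map_pmf (take n) (map_pmf butlast (G (Suc (n + k))))"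
      by (simp add: pmf.map_comp)
    finally show ?case using Suc by (simp only: butG)
  qed
  \<comment> \<open>A prefix longer than every index in \<open>J\<close> determines the marginal on
    \<open>J\<close>. Inserting \<open>0\<close> covers the empty \<open>J\<close>.\<close>
  define mx where "mx J = Suc (Max (insert 0 J))" for J :: "nat set"
  have mx: "finite J \<Longrightarrow> j \<in> J \<Longrightarrow> j < mx J" for j J by (simp add: mx_def le_imp_less_Suc)
  have mx_mono: "J \<subseteq> H \<Longrightarrow> finite H \<Longrightarrow> mx J \<le> mx H" for J H
    unfolding mx_def by (auto intro!: Max_mono)
  define P :: "nat set \<Rightarrow> (nat \<Rightarrow> real) measure" where
    "P J = distr (measure_pmf (G (mx J))) (PiM J (\<lambda>_. borel)) (\<lambda>u. \<lambda>j\<in>J. real (u ! j))" for J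
  have meas: "(\<lambda>u. \<lambda>j\<in>J. real (u ! j)) \<in> measurable (measure_pmf F) (PiM J (\<lambda>_. borel))"
    for J and F :: "nat list pmf"
    by (auto simp: measurable_def space_PiM)
  have P_ge: "P J = distr (measure_pmf (G n)) (PiM J (\<lambda>_. borel)) (\<lambda>u. \<lambda>j\<in>J. real (u ! j))"
    if "finite J" "mx J \<le> n" for J n
  proof -
    have "G (mx J) = map_pmf (take (mx J)) (G n)" using takeG[of "mx J" "n - mx J"] that by simp
    then have "P J = distr (distr (measure_pmf (G n)) (count_space UNIV) (take (mx J))) (PiM J (\<lambda>_. borel)) (\<lambda>u. \<lambda>j\<in>J. real (u ! j))"
      unfolding P_def by (simp add: map_pmf_rep_eq)
    also have "\<dots> = distr (measure_pmf (G n)) (PiM J (\<lambda>_. borel)) ((\<lambda>u. \<lambda>j\<in>J. real (u ! j)) \<circ> take (mx J))"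
      by (rule distr_distr) (auto simp: measurable_def space_PiM)
    also have "\<dots> = distr (measure_pmf (G n)) (PiM J (\<lambda>_. borel)) (\<lambda>u. \<lambda>j\<in>J. real (u ! j))"
      using mx[OF that(1)] by (intro distr_cong refl) (auto simp: fun_eq_iff restrict_def)
    finally show ?thesis .
  qed
  interpret polish_projective UNIV P
  proof (intro polish_projective.intro projective_family.intro)
    fix J H :: "nat set" assume JH: "J \<subseteq> H" "finite H"
    then have fJ: "finite J" by (rule finite_subset)
    have "distr (P H) (PiM J (\<lambda>_. borel)) (\<lambda>f. restrict f J)
        = distr (measure_pmf (G (mx H))) (PiM J (\<lambda>_. borel)) ((\<lambda>f. restrict f J) \<circ> (\<lambda>u. \<lambda>j\<in>H. real (u ! j)))"
      unfolding P_def using JH(1) by (intro distr_distr meas measurable_restrict_subset)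
    also have "(\<lambda>f. restrict f J) \<circ> (\<lambda>u. \<lambda>j\<in>H. real (u ! j)) = (\<lambda>u. \<lambda>j\<in>J. real (u ! j))"
      using JH(1) by (auto simp: fun_eq_iff restrict_def)
    finally show "P J = distr (P H) (PiM J (\<lambda>_. borel)) (\<lambda>f. restrict f J)"
      by (simp only: P_ge[OF fJ mx_mono[OF JH]])
  next
    fix J :: "nat set"
    show "prob_space (P J)" unfolding P_def
      by (intro prob_space.prob_space_distr meas prob_space_measure_pmf)
  qed
  \<comment> \<open>The floor undoes the embedding of the letters into the reals and is measurable
    on all of them.\<close>
  define h where "h = (\<lambda>(x :: nat \<Rightarrow> real) i. nat \<lfloor>x i\<rfloor>)"
  have h[measurable]: "h \<in> measurable (PiM UNIV (\<lambda>_. borel)) seq_space"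
    unfolding seq_space_def h_def by (rule measurable_PiM_single') auto
  define \<theta> where "\<theta> = distr lim seq_space h"
  have h': "h \<in> measurable lim seq_space" using h by (simp cong: measurable_cong_sets)
  have "measure \<theta> (cyl u) = g u" for u
  proof -
    let ?n = "length u" let ?J = "{..<length u}"
    let ?F = "{f \<in> space (PiM ?J (\<lambda>_. borel :: real measure)). \<forall>i\<in>?J. nat \<lfloor>f i\<rfloor> = u ! i}"
    have F: "?F \<in> sets (PiM ?J (\<lambda>_. borel))" by measurable
    have "measure \<theta> (cyl u) = measure lim (h -` cyl u \<inter> space lim)"
      unfolding \<theta>_def by (rule measure_distr[OF h']) simp
    also have "h -` cyl u \<inter> space lim = prod_emb UNIV (\<lambda>_. borel) ?J ?F"
      by (auto simp: h_def cyl_def prefix_eq_iff prod_emb_def space_PiM)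
    also have "measure lim \<dots> = measure (P ?J) ?F"
      by (rule measure_lim_emb) (auto simp: F)
    also have "\<dots> = measure (G (mx ?J)) ((\<lambda>v. \<lambda>j\<in>?J. real (v ! j)) -` ?F \<inter> space (measure_pmf (G (mx ?J))))"
      unfolding P_def by (rule measure_distr[OF meas F])
    also have "\<dots> = measure (G (mx ?J)) (take ?n -` {u})"
    proof (rule measure_pmf.finite_measure_eq_AE)
      have "mx ?J \<ge> ?n" using mx[of ?J "?n - 1"] by (cases "?n = 0") auto
      then show "AE v in G (mx ?J). (v \<in> (\<lambda>v. \<lambda>j\<in>?J. real (v ! j)) -` ?F \<inter> space (measure_pmf (G (mx ?J)))) = (v \<in> take ?n -` {u})"
        by (auto simp: AE_measure_pmf_iff space_PiM list_eq_iff_nth_eq dest!: lenG)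
    qed auto
    also have "\<dots> = pmf (map_pmf (take ?n) (G (mx ?J))) u" by (simp add: pmf_map)
    also have "\<dots> = g u"
    proof -
      have "mx ?J \<ge> ?n" using mx[of ?J "?n - 1"] by (cases "?n = 0") auto
      then have "map_pmf (take ?n) (G (mx ?J)) = G ?n" using takeG[of ?n "mx ?J - ?n"] by simp
      then show ?thesis using out[of u] by (auto simp: pmfG W_def)
    qed
    finally show ?thesis .
  qed
  moreover have "prob_space \<theta>" unfolding \<theta>_def by (rule P.prob_space_distr[OF h'])
  moreover have "sets \<theta> = sets seq_space" by (simp add: \<theta>_def)
  ultimately show ?thesis using that by blast
qed

section \<open>Ergodic lifts of Bernoulli measures\<close>

lemma map_take_drop_replicate_pmf:
  assumes "i + k \<le> N"
  shows "map_pmf (\<lambda>w. take k (drop i w)) (replicate_pmf N p) = replicate_pmf k p"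
proof -
  define r where "r = N - (i + k)"
  have N: "N = i + (k + r)" using assms by (simp add: r_def)
  have "map_pmf (\<lambda>w. take k (drop i w)) (replicate_pmf N p)
      = replicate_pmf i p \<bind> (\<lambda>xs. replicate_pmf k p \<bind> (\<lambda>ys. replicate_pmf r p \<bind> (\<lambda>zs. return_pmf (take k (drop i (xs @ ys @ zs))))))"
    unfolding N replicate_pmf_distrib by (simp add: map_bind_pmf bind_assoc_pmf bind_return_pmf)
  also have "\<dots> = replicate_pmf i p \<bind> (\<lambda>xs. replicate_pmf k p \<bind> (\<lambda>ys. replicate_pmf r p \<bind> (\<lambda>zs. return_pmf ys)))"
    by (intro bind_pmf_cong refl) (auto simp: set_replicate_pmf)
  also have "\<dots> = replicate_pmf k p" by (simp add: bind_pmf_const bind_return_pmf')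
  finally show ?thesis .
qed

text \<open>Two blocks separated by \<open>r\<close> letters are independent; this supplies the
  pairwise independence needed in the proof of \<open>ergodic_lift\<close>.\<close>

lemma map_two_blocks_replicate_pmf:
  "map_pmf (\<lambda>v. (take k v, take k (drop (k + r) v))) (replicate_pmf (k + (r + k)) p)
    = pair_pmf (replicate_pmf k p) (replicate_pmf k p)"
proof -
  have "map_pmf (\<lambda>v. (take k v, take k (drop (k + r) v))) (replicate_pmf (k + (r + k)) p)
      = replicate_pmf k p \<bind> (\<lambda>xs. replicate_pmf r p \<bind> (\<lambda>ys. replicate_pmf k p \<bind>
          (\<lambda>zs. return_pmf (take k (xs @ ys @ zs), take k (drop (k + r) (xs @ ys @ zs))))))"
    unfolding replicate_pmf_distrib by (simp add: map_bind_pmf bind_assoc_pmf bind_return_pmf)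
  also have "\<dots> = replicate_pmf k p \<bind> (\<lambda>xs. replicate_pmf r p \<bind> (\<lambda>ys. replicate_pmf k p \<bind> (\<lambda>zs. return_pmf (xs, zs))))"
    by (intro bind_pmf_cong refl) (auto simp: set_replicate_pmf)
  finally show ?thesis by (simp add: bind_pmf_const pair_pmf_def)
qed

text \<open>Bessel's inequality for the centred indicators of the events \<open>E i\<close>.\<close>

lemma (in prob_space) uniform_correlation_eq:
  fixes E :: "nat \<Rightarrow> 'a set"
  assumes [measurable]: "A \<in> events" "\<And>i. E i \<in> events"
    and P: "\<And>i. prob (E i) = P" and PP: "\<And>i j. i \<noteq> j \<Longrightarrow> prob (E i \<inter> E j) = P * P"
    and q: "\<And>i. prob (A \<inter> E i) = q"
  shows "q = prob A * P"
proof -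
  define c where "c = q - prob A * P"
  have bound: "N * c\<^sup>2 \<le> 1" for N :: nat
  proof (cases "N = 0")
    case False
    \<comment> \<open>The expected square of \<open>(\<Sum>i<N. ?X i x) - t * ?A x\<close> is at
      most \<open>N - 2 * t * (N * c) + t\<^sup>2\<close>. This is least at
      \<open>t = N * c\<close>, where nonnegativity becomes
      \<open>N * c\<^sup>2 \<le> 1\<close>.\<close>
    define t where "t = N * c"
    let ?X = "\<lambda>i x. indicator (E i) x - P :: real"
    let ?A = "indicator A :: 'a \<Rightarrow> real"
    have P01: "0 \<le> P" "P \<le> 1" using P[of 0] by (metis measure_nonneg, metis prob_le_1)
    have int[simp]: "integrable M (\<lambda>x. indicator B x :: real)" if "B \<in> events" for B
      using that by (simp add: emeasure_eq_measure)
    have XX: "expectation (\<lambda>x. ?X i x * ?X j x) = (if i = j then P - P * P else 0)" for i j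
    proof -
      have "(\<lambda>x. ?X i x * ?X j x) = (\<lambda>x. indicator (E i \<inter> E j) x - P * indicator (E j) x - P * indicator (E i) x + P * P)"
        by (auto simp: fun_eq_iff algebra_simps indicator_inter_arith)
      then have "expectation (\<lambda>x. ?X i x * ?X j x) = prob (E i \<inter> E j) - P * P - P * P + P * P"
        by (simp add: P prob_space)
      then show ?thesis using PP[of i j] P[of i] by auto
    qed
    have AX: "expectation (\<lambda>x. ?A x * ?X i x) = c" for i
    proof -
      have "(\<lambda>x. ?A x * ?X i x) = (\<lambda>x. indicator (A \<inter> E i) x - P * ?A x)"
        by (auto simp: fun_eq_iff algebra_simps indicator_inter_arith)
      then show ?thesis by (simp add: q c_def mult.commute)
    qed
    have AA: "expectation (\<lambda>x. ?A x * ?A x) = prob A"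
      by (simp add: indicator_inter_arith[symmetric])
    have intX: "integrable M (\<lambda>x. ?X i x * ?X j x)" for i j
      by (intro integrable_const_bound[where B="(1 + \<bar>P\<bar>) * (1 + \<bar>P\<bar>)"] AE_I2)
         (use P01 in \<open>auto simp: abs_mult indicator_def intro!: mult_mono\<close>)
    have intAX: "integrable M (\<lambda>x. ?A x * ?X i x)" for i
      by (intro integrable_const_bound[where B="1 + \<bar>P\<bar>"] AE_I2) (auto simp: indicator_def)
    have intA: "integrable M (\<lambda>x. ?A x * ?A x)"
      by (simp add: indicator_inter_arith[symmetric])
    have "0 \<le> expectation (\<lambda>x. ((\<Sum>i<N. ?X i x) - t * ?A x)\<^sup>2)"
      by (intro integral_nonneg_AE AE_I2) auto
    also have "(\<lambda>x. ((\<Sum>i<N. ?X i x) - t * ?A x)\<^sup>2)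
        = (\<lambda>x. (\<Sum>i<N. \<Sum>j<N. ?X i x * ?X j x) - 2 * t * (\<Sum>i<N. ?A x * ?X i x) + t\<^sup>2 * (?A x * ?A x))"
      by (simp add: fun_eq_iff power2_diff power2_eq_square sum_product sum_distrib_left algebra_simps)
    also have "expectation \<dots> = (\<Sum>i<N. \<Sum>j<N. (if i = j then P - P * P else 0)) - 2 * t * (\<Sum>i<N. c) + t\<^sup>2 * prob A"
    proof -
      obtain XXf AXf AAf where f: "XXf = (\<lambda>i j x. ?X i x * ?X j x)" "AXf = (\<lambda>i x. ?A x * ?X i x)"
        "AAf = (\<lambda>x. ?A x * ?A x)" by blast
      have [simp]: "integrable M (XXf i j)" "integrable M (AXf i)" "integrable M AAf" for i j
        using intX intAX intA by (simp_all add: f)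
      have "expectation (\<lambda>x. (\<Sum>i<N. \<Sum>j<N. XXf i j x) - 2 * t * (\<Sum>i<N. AXf i x) + t\<^sup>2 * AAf x)
          = (\<Sum>i<N. \<Sum>j<N. expectation (XXf i j)) - 2 * t * (\<Sum>i<N. expectation (AXf i)) + t\<^sup>2 * expectation AAf"
        by simp
      then show ?thesis by (simp only: f XX AX AA)
    qed
    also have "\<dots> = N * (P - P * P) - 2 * t * (N * c) + t\<^sup>2 * prob A" by simp
    also have "\<dots> \<le> N * 1 - 2 * t * (N * c) + t\<^sup>2 * 1"
    proof -
      have "0 \<le> P * P" by simp
      then have "P - P * P \<le> 1" using P01 by linarith
      then have "real N * (P - P * P) \<le> real N * 1" by (intro mult_left_mono) auto
      moreover have "t\<^sup>2 * prob A \<le> t\<^sup>2 * 1" by (intro mult_left_mono) auto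
      ultimately show ?thesis by linarith
    qed
    also have "\<dots> = N * (1 - N * c\<^sup>2)" by (simp add: t_def power2_eq_square algebra_simps)
    finally show ?thesis using False by (simp add: zero_le_mult_iff)
  qed simp
  have "c = 0"
  proof (rule ccontr)
    assume "c \<noteq> 0"
    then have "c\<^sup>2 > 0" by simp
    then obtain N :: nat where "N > 1 / c\<^sup>2" using reals_Archimedean2 by blast
    then show False using bound[of N] \<open>c\<^sup>2 > 0\<close> by (simp add: field_simps)
  qed
  then show ?thesis by (simp add: c_def)
qed

section \<open>Lifts of a Bernoulli measure as functions on words\<close>

lemma tendsto_coord:
  assumes "(f \<longlongrightarrow> (l :: 'i \<Rightarrow> 'a::topological_space)) F"
  shows "((\<lambda>n. f n j) \<longlongrightarrow> l j) F"
  using continuous_on_tendsto_compose[OF continuous_on_product_coordinates assms] by auto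

lemma compact_unit_functions: "compact {g :: 'i \<Rightarrow> real. \<forall>u. 0 \<le> g u \<and> g u \<le> 1}"
proof -
  have "compactin (product_topology (\<lambda>_. euclidean) UNIV) (PiE UNIV (\<lambda>_ :: 'i. {0..1 :: real}))"
    by (subst compactin_PiE) auto
  then have "compact (PiE UNIV (\<lambda>_ :: 'i. {0..1 :: real}))"
    by (simp add: euclidean_product_topology)
  also have "PiE UNIV (\<lambda>_ :: 'i. {0..1 :: real}) = {g. \<forall>u. 0 \<le> g u \<and> g u \<le> 1}"
    by auto
  finally show ?thesis .
qed

text \<open>\<open>Lang\<close> is closed under factors, like the language of a subshift, and
  \<open>lift\<close> says that the letter map \<open>proj\<close> reaches every word over the
  support of \<open>p\<close>. Lifts are demanded for finite words only, with no consistency between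
  the lifts of a word and of its parts.\<close>

locale factorial_lift =
  fixes Bt :: "nat set" and Lang :: "nat list set" and proj :: "nat \<Rightarrow> 'w::countable" and p :: "'w pmf"
  assumes finite_Bt: "finite Bt"
    and Lang_sub: "u \<in> Lang \<Longrightarrow> set u \<subseteq> Bt"
    and Lang_butlast: "u @ [b] \<in> Lang \<Longrightarrow> u \<in> Lang"
    and Lang_tl: "b # u \<in> Lang \<Longrightarrow> u \<in> Lang"
    and lift: "set w \<subseteq> set_pmf p \<Longrightarrow> \<exists>u\<in>Lang. map proj u = w"
begin

text \<open>Such a \<open>g\<close> lists the cylinder masses of a shift-invariant measure carried
  by \<open>Lang\<close> whose image under \<open>proj\<close> is Bernoulli: the sum over last
  letters expresses consistency, the sum over first letters invariance. As functions on words these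
  measures lie in a product of unit intervals, where compactness is elementary.\<close>

definition admissible :: "(nat list \<Rightarrow> real) \<Rightarrow> bool" where
  "admissible g \<longleftrightarrow> (\<forall>u. 0 \<le> g u \<and> g u \<le> 1) \<and> (\<forall>u. u \<notin> Lang \<longrightarrow> g u = 0) \<and> g [] = 1
    \<and> (\<forall>u. g u = (\<Sum>b\<in>Bt. g (u @ [b]))) \<and> (\<forall>u. g u = (\<Sum>b\<in>Bt. g (b # u)))
    \<and> (\<forall>w. (\<Sum>u\<in>{u. (set u \<subseteq> Bt \<and> length u = length w) \<and> map proj u = w}. g u)
          = pmf (replicate_pmf (length w) p) w)"

lemma Lang_take: "u \<in> Lang \<Longrightarrow> take n u \<in> Lang"
proof (induction u rule: rev_induct)
  case (snoc b u)
  then show ?case using Lang_butlast[of u b] by (cases "n \<le> length u") auto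
qed simp

lemma Lang_drop: "u \<in> Lang \<Longrightarrow> drop n u \<in> Lang"
proof (induction n arbitrary: u)
  case (Suc n)
  then show ?case using Lang_tl[of "hd u" "tl u"] by (cases u) simp_all
qed simp

text \<open>Since \<open>Bt\<close> is finite, each single condition involves finitely many values
  of \<open>g\<close> and is therefore closed in the product topology.\<close>

lemma closed_admissible: "closed {g. admissible g}"
proof -
  have c: "continuous_on UNIV (\<lambda>g :: nat list \<Rightarrow> real. g u)" for u
    by (rule continuous_on_product_coordinates)
  show ?thesis unfolding admissible_def
    by (intro closed_Collect_conj closed_Collect_all closed_Collect_imp open_Collect_const
        closed_Collect_eq closed_Collect_le continuous_on_const c continuous_on_sum)
qed

lemma admissible_bounds: "admissible g \<Longrightarrow> 0 \<le> g u \<and> g u \<le> 1"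
  by (drule admissible_def[THEN iffD1], drule conjunct1) (rule spec)

lemma compact_admissible: "compact {g. admissible g}"
proof -
  have "{g. admissible g} \<subseteq> {g. \<forall>u. 0 \<le> g u \<and> g u \<le> 1}"
    using admissible_bounds by blast
  then have "{g. \<forall>u. 0 \<le> g u \<and> g u \<le> 1} \<inter> {g. admissible g} = {g. admissible g}"
    by (rule Int_absorb1)
  from back_subst[of compact, OF compact_Int_closed[OF compact_unit_functions closed_admissible] this]
  show ?thesis .
qed

text \<open>The law of a lifted i.i.d. word of length \<open>2m\<close>, averaged over the first \<open>m\<close> positions, satisfies
  all constraints up to a defect \<open>1/m\<close> in left consistency.\<close>

lemma admissible_exists: "\<exists>g. admissible g"
proof -
  define bsel where "bsel w = (SOME u. u \<in> Lang \<and> map proj u = w)" for w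
  have bsel: "bsel w \<in> Lang" "map proj (bsel w) = w" if "set w \<subseteq> set_pmf p" for w
    using someI_ex[OF lift[OF that, unfolded Bex_def]] by (auto simp: bsel_def)
  \<comment> \<open>In \<open>2 * m\<close> letters a window of length at most \<open>m\<close> fits
    at each of the first \<open>m\<close> positions. \<open>bsel\<close> lifts whole words and need
    not respect their factors, so \<open>\<mu> m\<close> need not be stationary.\<close>
  define \<mu> where "\<mu> m = map_pmf bsel (replicate_pmf (2 * m) p)" for m
  have setw: "w \<in> set_pmf (replicate_pmf n p) \<Longrightarrow> set w \<subseteq> set_pmf p \<and> length w = n" for w n
    by (auto simp: set_replicate_pmf)
  have \<mu>L: "v \<in> set_pmf (\<mu> m) \<Longrightarrow> v \<in> Lang \<and> length v = 2 * m" for v m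
  proof -
    assume "v \<in> set_pmf (\<mu> m)"
    then obtain w where w: "w \<in> set_pmf (replicate_pmf (2 * m) p)" "v = bsel w" by (auto simp: \<mu>_def)
    with setw[OF w(1)] bsel[of w] show ?thesis by (metis length_map)
  qed
  define F where "F m i k = map_pmf (\<lambda>v. take k (drop i v)) (\<mu> m)" for m i k
  define W where "W n = {u. set u \<subseteq> Bt \<and> length u = n}" for n
  have finW: "finite (W n)" for n unfolding W_def by (rule finite_words[OF finite_Bt])
  have FL: "u \<in> set_pmf (F m i k) \<Longrightarrow> u \<in> Lang" for u m i k
    using \<mu>L by (auto simp: F_def intro!: Lang_take Lang_drop)
  have FW: "set_pmf (F m i k) \<subseteq> W k" if "i + k \<le> 2 * m" for m i k
  proof
    fix u assume u: "u \<in> set_pmf (F m i k)"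
    then obtain v where "v \<in> set_pmf (\<mu> m)" "u = take k (drop i v)" unfolding F_def by auto
    then have "length u = k" using \<mu>L that by simp
    then show "u \<in> W k" using Lang_sub[OF FL[OF u]] by (simp add: W_def)
  qed
  have Fbut: "map_pmf butlast (F m i (Suc k)) = F m i k" if "i + Suc k \<le> 2 * m" for m i k
    unfolding F_def pmf.map_comp
  proof (rule pmf.map_cong0)
    fix v assume "v \<in> set_pmf (\<mu> m)"
    then have "length v = 2 * m" using \<mu>L by blast
    then show "(butlast \<circ> (\<lambda>v. take (Suc k) (drop i v))) v = take k (drop i v)"
      using that by (simp add: butlast_take)
  qed
  have Ftl: "map_pmf tl (F m i (Suc k)) = F m (Suc i) k" if "i + Suc k \<le> 2 * m" for m i k
    unfolding F_def pmf.map_comp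
  proof (rule pmf.map_cong0)
    fix v
    show "(tl \<circ> (\<lambda>v. take (Suc k) (drop i v))) v = take k (drop (Suc i) v)"
      by (simp only: comp_def tl_take drop_Suc tl_drop diff_Suc_1)
  qed
  have Fproj: "map_pmf (map proj) (F m i k) = replicate_pmf k p" if "i + k \<le> 2 * m" for m i k
  proof -
    have "map_pmf (map proj) (F m i k) = map_pmf (\<lambda>w. take k (drop i w)) (replicate_pmf (2 * m) p)"
      unfolding F_def \<mu>_def pmf.map_comp
    proof (rule pmf.map_cong0)
      fix w assume "w \<in> set_pmf (replicate_pmf (2 * m) p)"
      then have "take k (drop i (map proj (bsel w))) = take k (drop i w)" using setw bsel(2) by simp
      then show "(map proj \<circ> ((\<lambda>v. take k (drop i v)) \<circ> bsel)) w = take k (drop i w)"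
        by (simp add: take_map drop_map)
    qed
    then show ?thesis using map_take_drop_replicate_pmf[OF that] by simp
  qed
  define g where "g m u = (\<Sum>i<m. pmf (F m i (length u)) u) / m" for m u
  have bnd: "0 \<le> g m u \<and> g m u \<le> 1" for m u
  proof -
    have "(\<Sum>i<m. pmf (F m i (length u)) u) \<le> (\<Sum>i<m. 1)" by (intro sum_mono pmf_le_1)
    then show ?thesis by (auto simp: g_def divide_le_eq sum_nonneg)
  qed
  \<comment> \<open>There are countably many words, so the product is metrizable and compactness
    yields a convergent subsequence.\<close>
  have "\<exists>l\<in>{g. \<forall>u. 0 \<le> g u \<and> g u \<le> 1}. \<exists>r. strict_mono r \<and> (g \<circ> r) \<longlonglongrightarrow> l"
    using compact_unit_functions[where 'i="nat list"] bnd unfolding compact_def by blast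
  then obtain l r where l: "\<And>u. 0 \<le> l u \<and> l u \<le> 1" and r: "strict_mono r" "(g \<circ> r) \<longlonglongrightarrow> l" by blast
  have lim: "(\<lambda>n. g (r n) u) \<longlonglongrightarrow> l u" for u
    using tendsto_coord[OF r(2), of u] by (simp add: comp_def)
  have ev: "eventually (\<lambda>n. P (r n)) sequentially" if "\<And>m. m \<ge> M \<Longrightarrow> P m" for M P
    using that seq_suble[OF r(1)] by (intro eventually_sequentiallyI[of M]) (meson le_trans)
  have "admissible l"
    unfolding admissible_def
  proof (intro conjI allI impI)
    fix u show "0 \<le> l u" "l u \<le> 1" using l by auto
  next
    fix u assume u: "u \<notin> Lang"
    then have "pmf (F m i (length u)) u = 0" for m i
      using FL[of u m i "length u"] by (meson pmf_eq_0_set_pmf)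
    then have "(\<lambda>n. g (r n) u) = (\<lambda>_. 0)" by (simp add: g_def fun_eq_iff)
    then show "l u = 0" using lim[of u] by (simp add: LIMSEQ_const_iff)
  next
    have "pmf (F m i 0) [] = 1" for m i by (simp add: F_def)
    then have "g m [] = 1" if "m \<ge> 1" for m using that by (simp add: g_def)
    then have "eventually (\<lambda>n. g (r n) [] = 1) sequentially" by (rule ev)
    then have "(\<lambda>n. g (r n) []) \<longlonglongrightarrow> 1" by (rule tendsto_eventually)
    then show "l [] = 1" using lim LIMSEQ_unique by blast
  next
    fix u
    have "g m u = (\<Sum>b\<in>Bt. g m (u @ [b]))" if m: "m \<ge> Suc (length u)" for m
    proof (cases "set u \<subseteq> Bt")
      case True
      have "pmf (F m i (length u)) u = (\<Sum>b\<in>Bt. pmf (F m i (Suc (length u))) (u @ [b]))" if "i < m" for i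
      proof -
        have "pmf (F m i (length u)) u = pmf (map_pmf butlast (F m i (Suc (length u)))) u"
          using Fbut[of i "length u" m] that m by simp
        also have "\<dots> = (\<Sum>v\<in>{v\<in>W (Suc (length u)). butlast v = u}. pmf (F m i (Suc (length u))) v)"
          using that m by (intro pmf_map_finite finW FW) auto
        finally show ?thesis using sum_words_snoc[where Bt=Bt and u=u and f="pmf (F m i (Suc (length u)))"] True
          by (simp add: W_def)
      qed
      then show ?thesis by (simp add: g_def sum_divide_distrib[symmetric] sum.swap[of _ Bt])
    next
      case False
      then have "v \<notin> Lang" if "set u \<subseteq> set v" for v using Lang_sub[of v] that by auto
      then have "pmf (F m i k) v = 0" if "set u \<subseteq> set v" for m i k v
        using FL[of v m i k] that by (meson pmf_eq_0_set_pmf)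
      then have z: "g m v = 0" if "set u \<subseteq> set v" for v using that by (simp add: g_def)
      have "g m u = 0" by (rule z) simp
      moreover have "(\<Sum>b\<in>Bt. g m (u @ [b])) = 0" by (intro sum.neutral ballI z) auto
      ultimately show ?thesis by simp
    qed
    then have "eventually (\<lambda>n. g (r n) u = (\<Sum>b\<in>Bt. g (r n) (u @ [b]))) sequentially" by (rule ev)
    moreover have "(\<lambda>n. \<Sum>b\<in>Bt. g (r n) (u @ [b])) \<longlonglongrightarrow> (\<Sum>b\<in>Bt. l (u @ [b]))"
      by (intro tendsto_sum lim)
    ultimately have "(\<lambda>n. g (r n) u) \<longlonglongrightarrow> (\<Sum>b\<in>Bt. l (u @ [b]))"
      by (simp add: tendsto_cong)
    then show "l u = (\<Sum>b\<in>Bt. l (u @ [b]))" using lim LIMSEQ_unique by blast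
  next
    fix u
    have "\<bar>(\<Sum>b\<in>Bt. g m (b # u)) - g m u\<bar> \<le> 1 / m" if m: "m \<ge> Suc (length u)" for m
    proof (cases "set u \<subseteq> Bt")
      case True
      let ?Q = "\<lambda>i. pmf (F m i (length u)) u"
      have "?Q (Suc i) = (\<Sum>b\<in>Bt. pmf (F m i (Suc (length u))) (b # u))" if "i < m" for i
      proof -
        have "?Q (Suc i) = pmf (map_pmf tl (F m i (Suc (length u)))) u"
          using Ftl[of i "length u" m] that m by simp
        also have "\<dots> = (\<Sum>v\<in>{v\<in>W (Suc (length u)). tl v = u}. pmf (F m i (Suc (length u))) v)"
          using that m by (intro pmf_map_finite finW FW) auto
        finally show ?thesis using sum_words_Cons[where Bt=Bt and u=u and f="pmf (F m i (Suc (length u)))"] True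
          by (simp add: W_def)
      qed
      then have "(\<Sum>b\<in>Bt. g m (b # u)) = (\<Sum>i<m. ?Q (Suc i)) / m"
        by (simp add: g_def sum_divide_distrib[symmetric] sum.swap[of _ Bt])
      \<comment> \<open>Removing the first letter moves the window one position on, so the defect
        telescopes to a difference of two end terms.\<close>
      then have "(\<Sum>b\<in>Bt. g m (b # u)) - g m u = (\<Sum>i<m. ?Q (Suc i) - ?Q i) / m"
        by (simp add: g_def sum_subtractf diff_divide_distrib)
      also have "\<dots> = (?Q m - ?Q 0) / m" by (simp only: sum_lessThan_telescope[of ?Q])
      also have "\<bar>\<dots>\<bar> \<le> 1 / m"
      proof -
        have "\<bar>?Q m - ?Q 0\<bar> \<le> 1"
          using pmf_le_1[of "F m m (length u)" u] pmf_le_1[of "F m 0 (length u)" u]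
            pmf_nonneg[of "F m m (length u)" u] pmf_nonneg[of "F m 0 (length u)" u] by linarith
        then show ?thesis by (simp add: divide_right_mono)
      qed
      finally show ?thesis .
    next
      case False
      then have "v \<notin> Lang" if "set u \<subseteq> set v" for v using Lang_sub[of v] that by auto
      then have "pmf (F m i k) v = 0" if "set u \<subseteq> set v" for m i k v
        using FL[of v m i k] that by (meson pmf_eq_0_set_pmf)
      then have z: "g m v = 0" if "set u \<subseteq> set v" for v using that by (simp add: g_def)
      have "g m u = 0" by (rule z) simp
      moreover have "(\<Sum>b\<in>Bt. g m (b # u)) = 0" by (intro sum.neutral ballI z) auto
      ultimately show ?thesis by simp
    qed
    then have "eventually (\<lambda>n. norm ((\<Sum>b\<in>Bt. g (r n) (b # u)) - g (r n) u) \<le> 1 / real (r n)) sequentially"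
      unfolding real_norm_def by (rule ev)
    moreover have "(\<lambda>n. 1 / real (r n)) \<longlonglongrightarrow> 0"
      using LIMSEQ_subseq_LIMSEQ[OF lim_1_over_n r(1)] by (simp add: comp_def)
    ultimately have "(\<lambda>n. (\<Sum>b\<in>Bt. g (r n) (b # u)) - g (r n) u) \<longlonglongrightarrow> 0"
      by (rule Lim_null_comparison)
    moreover have "(\<lambda>n. (\<Sum>b\<in>Bt. g (r n) (b # u)) - g (r n) u) \<longlonglongrightarrow> (\<Sum>b\<in>Bt. l (b # u)) - l u"
      by (intro tendsto_diff tendsto_sum lim)
    ultimately have "(\<Sum>b\<in>Bt. l (b # u)) - l u = 0" using LIMSEQ_unique by blast
    then show "l u = (\<Sum>b\<in>Bt. l (b # u))" by simp
  next
    fix w :: "'w list"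
    let ?U = "{u. (set u \<subseteq> Bt \<and> length u = length w) \<and> map proj u = w}"
    have "(\<Sum>u\<in>?U. g m u) = pmf (replicate_pmf (length w) p) w" if m: "m \<ge> Suc (length w)" for m
    proof -
      have "(\<Sum>u\<in>?U. pmf (F m i (length u)) u) = pmf (replicate_pmf (length w) p) w" if "i < m" for i
      proof -
        have "pmf (map_pmf (map proj) (F m i (length w))) w = (\<Sum>u\<in>{u\<in>W (length w). map proj u = w}. pmf (F m i (length w)) u)"
          using m that by (intro pmf_map_finite finW FW) auto
        also have "\<dots> = (\<Sum>u\<in>?U. pmf (F m i (length u)) u)"
          by (rule sum.cong) (auto simp: W_def)
        finally show ?thesis using Fproj[of i "length w" m] m that by simp
      qed
      then have "(\<Sum>i<m. \<Sum>u\<in>?U. pmf (F m i (length u)) u) = m * pmf (replicate_pmf (length w) p) w"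
        by simp
      then have "(\<Sum>u\<in>?U. \<Sum>i<m. pmf (F m i (length u)) u) = m * pmf (replicate_pmf (length w) p) w"
        by (subst sum.swap)
      then have "(\<Sum>u\<in>?U. \<Sum>i<m. pmf (F m i (length u)) u) / m = pmf (replicate_pmf (length w) p) w"
        using m by simp
      then show ?thesis by (simp only: g_def sum_divide_distrib)
    qed
    then have "eventually (\<lambda>n. (\<Sum>u\<in>?U. g (r n) u) = pmf (replicate_pmf (length w) p) w) sequentially" by (rule ev)
    then have "(\<lambda>n. \<Sum>u\<in>?U. g (r n) u) \<longlonglongrightarrow> pmf (replicate_pmf (length w) p) w"
      by (rule tendsto_eventually)
    moreover have "(\<lambda>n. \<Sum>u\<in>?U. g (r n) u) \<longlonglongrightarrow> (\<Sum>u\<in>?U. l u)"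
      by (intro tendsto_sum lim)
    ultimately show "(\<Sum>u\<in>?U. l u) = pmf (replicate_pmf (length w) p) w" using LIMSEQ_unique by blast
  qed
  then show ?thesis by blast
qed

text \<open>A maximiser of a strictly convex continuous functional is an extreme point.\<close>

lemma admissible_extreme:
  obtains g where "admissible g"
    "\<And>a g1 g2. admissible g1 \<Longrightarrow> admissible g2 \<Longrightarrow> 0 < a \<Longrightarrow> a < 1 \<Longrightarrow>
      (\<And>u. g u = a * g1 u + (1 - a) * g2 u) \<Longrightarrow> g1 = g"
proof -
  \<comment> \<open>The squares make the functional strictly convex. The weights
    \<open>(1/2)^k\<close> make the series converge uniformly for functions with values in the unit
    interval, hence continuous there.\<close>
  define \<Phi> where "\<Phi> g = (\<Sum>k. (1/2)^k * (g (from_nat k :: nat list))\<^sup>2 :: real)" for g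
  have half: "summable (\<lambda>k. (1/2)^k :: real)" by (rule summable_geometric) simp
  have bound: "norm ((1/2)^k * (g (from_nat k))\<^sup>2) \<le> (1/2)^k" if "admissible g" for g and k :: nat
  proof -
    have "0 \<le> g (from_nat k)" "g (from_nat k) \<le> 1" using admissible_bounds[OF that] by auto
    then have "(g (from_nat k))\<^sup>2 \<le> 1" by (simp add: power_le_one)
    then have "(1/2)^k * (g (from_nat k))\<^sup>2 \<le> (1/2)^k * 1" by (intro mult_left_mono) auto
    then show ?thesis by simp
  qed
  have summ: "summable (\<lambda>k. (1/2)^k * (g (from_nat k))\<^sup>2)" if "admissible g" for g
    by (rule summable_comparison_test'[OF half, of 0]) (rule bound[OF that])
  have "uniform_limit {g. admissible g} (\<lambda>n g. \<Sum>k<n. (1/2)^k * (g (from_nat k))\<^sup>2)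
      (\<lambda>g. \<Sum>k. (1/2)^k * (g (from_nat k))\<^sup>2) sequentially"
    by (rule Weierstrass_m_test[OF _ half]) (use bound in auto)
  then have ul: "uniform_limit {g. admissible g} (\<lambda>n g. \<Sum>k<n. (1/2)^k * (g (from_nat k))\<^sup>2) \<Phi> sequentially"
    by (simp add: \<Phi>_def[abs_def])
  have "continuous_on {g. admissible g} (\<lambda>g. g u)" for u
    by (rule continuous_on_subset[OF continuous_on_product_coordinates]) simp
  then have "continuous_on {g. admissible g} (\<lambda>g. \<Sum>k<n. (1/2)^k * (g (from_nat k))\<^sup>2)" for n
    by (intro continuous_on_sum continuous_on_mult continuous_on_const continuous_on_power)
  then have "continuous_on {g. admissible g} \<Phi>"
    by (intro uniform_limit_theorem[OF _ ul] always_eventually allI) simp_all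
  then obtain g where g: "admissible g" and max: "\<And>h. admissible h \<Longrightarrow> \<Phi> h \<le> \<Phi> g"
    using continuous_attains_sup[OF compact_admissible] admissible_exists by auto
  have "g1 = g" if adm: "admissible g1" "admissible g2" and a: "0 < a" "a < 1"
    and conv: "\<And>u. g u = a * g1 u + (1 - a) * g2 u" for a g1 g2
  proof -
    define d where "d k = (1/2)^k * (g1 (from_nat k) - g2 (from_nat k))\<^sup>2" for k
    \<comment> \<open>The convexity defect of the square is
      \<open>a * (1 - a) * (x - y)\<^sup>2\<close>. Maximality of \<open>g\<close> makes the sum of
      these nonnegative terms at most zero, so \<open>g1\<close> and \<open>g2\<close> agree on
      every word.\<close>
    have d_eq: "a * (1 - a) * d k = a * ((1/2)^k * (g1 (from_nat k))\<^sup>2) + (1 - a) * ((1/2)^k * (g2 (from_nat k))\<^sup>2)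
        - (1/2)^k * (g (from_nat k))\<^sup>2" for k
      by (simp add: d_def conv power2_eq_square algebra_simps)
    have "(\<lambda>k. a * (1 - a) * d k) sums (a * \<Phi> g1 + (1 - a) * \<Phi> g2 - \<Phi> g)"
      unfolding d_eq \<Phi>_def by (intro sums_diff sums_add sums_mult summable_sums summ adm g)
    moreover have "a * \<Phi> g1 + (1 - a) * \<Phi> g2 - \<Phi> g \<le> 0"
    proof -
      have "a * \<Phi> g1 + (1 - a) * \<Phi> g2 \<le> a * \<Phi> g + (1 - a) * \<Phi> g"
        using a by (intro add_mono mult_left_mono max adm) auto
      then show ?thesis by (simp add: algebra_simps)
    qed
    moreover have nn: "0 \<le> a * (1 - a) * d k" for k using a by (simp add: d_def)
    ultimately have "summable (\<lambda>k. a * (1 - a) * d k)" "(\<Sum>k. a * (1 - a) * d k) \<le> 0"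
      by (auto simp: sums_iff)
    then have "(\<Sum>k. a * (1 - a) * d k) = 0" using suminf_nonneg[OF _ nn] by force
    then have "a * (1 - a) * d k = 0" for k
      using suminf_eq_zero_iff[OF \<open>summable (\<lambda>k. a * (1 - a) * d k)\<close> nn] by blast
    then have eq: "g1 (from_nat k) = g2 (from_nat k)" for k using a by (simp add: d_def)
    have "g1 u = g2 u" for u using eq[of "to_nat u"] by simp
    moreover from this have "g u = g1 u" for u using conv[of u] by (simp add: algebra_simps)
    ultimately have "g1 u = g u" for u by simp
    then show ?thesis by (rule ext)
  qed
  with g show ?thesis by (rule that)
qed

text \<open>With all naturals as letters a cylinder splits into infinitely many; support in
  \<open>Lang\<close> confines the mass to the finite alphabet \<open>Bt\<close> and makes the sums
  finite. The three identities correspond to the three summation conditions in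
  \<open>admissible\<close>.\<close>

lemma cylinder_sums:
  fixes w :: "'w list"
  assumes M: "prob_space M" "sets M = sets seq_space" and supp: "AE b in M. \<forall>n. prefix n b \<in> Lang"
  shows "measure M (cyl u) = (\<Sum>b\<in>Bt. measure M (cyl (u @ [b])))"
    and "measure M {b. shift b \<in> cyl u} = (\<Sum>b\<in>Bt. measure M (cyl (b # u)))"
    and "measure M {b. map proj (prefix (length w) b) = w}
      = (\<Sum>u\<in>{u. (set u \<subseteq> Bt \<and> length u = length w) \<and> map proj u = w}. measure M (cyl u))"
proof -
  interpret M: prob_space M by fact
  have [simp]: "cyl u \<in> sets M" for u by (simp add: M(2))
  have suppB: "AE b in M. \<forall>n. set (prefix n b) \<subseteq> Bt" using supp by eventually_elim (use Lang_sub in blast)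
  have un: "measure M A = (\<Sum>u\<in>U. measure M (cyl u))"
    if "finite U" "\<And>u. u \<in> U \<Longrightarrow> length u = n" "A \<in> sets M"
      "\<And>b. \<forall>n. set (prefix n b) \<subseteq> Bt \<Longrightarrow> b \<in> A \<longleftrightarrow> prefix n b \<in> U" for U n A
  proof -
    have iff: "b \<in> (\<Union>u\<in>U. cyl u) \<longleftrightarrow> prefix n b \<in> U" for b
    proof
      assume "b \<in> (\<Union>u\<in>U. cyl u)"
      then obtain u where "u \<in> U" "prefix (length u) b = u" by (auto simp: cyl_def)
      then show "prefix n b \<in> U" using that(2) by metis
    qed (auto simp: cyl_def intro!: bexI[of _ "prefix n b"])
    have "measure M A = measure M (\<Union>u\<in>U. cyl u)"
    proof (rule M.finite_measure_eq_AE[OF _ that(3)])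
      show "AE b in M. (b \<in> A) = (b \<in> (\<Union>u\<in>U. cyl u))"
        using suppB
      proof eventually_elim
        case (elim b)
        show ?case unfolding iff by (rule that(4)[OF elim])
      qed
    qed (auto intro!: sets.finite_UN that(1))
    also have "\<dots> = (\<Sum>u\<in>U. measure M (cyl u))"
    proof (rule M.finite_measure_finite_Union[OF that(1)])
      show "disjoint_family_on cyl U"
        unfolding disjoint_family_on_def
      proof (intro ballI impI)
        fix u v assume "u \<in> U" "v \<in> U" "u \<noteq> v"
        then show "cyl u \<inter> cyl v = {}" using cyl_Int[of u v] that(2)[of u] that(2)[of v] by simp
      qed
    qed (simp add: image_subset_iff)
    finally show ?thesis .
  qed
  have "measure M (cyl u) = (\<Sum>v\<in>(\<lambda>b. u @ [b]) ` Bt. measure M (cyl v))"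
  proof (rule un[of _ "Suc (length u)"])
    fix b :: "nat \<Rightarrow> nat" assume b: "\<forall>n. set (prefix n b) \<subseteq> Bt"
    have "b (length u) \<in> Bt" using b[rule_format, of "Suc (length u)"] by (simp add: prefix_Suc)
    then show "b \<in> cyl u \<longleftrightarrow> prefix (Suc (length u)) b \<in> (\<lambda>b. u @ [b]) ` Bt"
      by (auto simp: cyl_def prefix_Suc)
  qed (auto simp: finite_Bt)
  then show "measure M (cyl u) = (\<Sum>b\<in>Bt. measure M (cyl (u @ [b])))"
    by (simp add: sum.reindex inj_on_def)
  have "measure M {b. shift b \<in> cyl u} = (\<Sum>v\<in>(\<lambda>b. b # u) ` Bt. measure M (cyl v))"
  proof (rule un[of _ "Suc (length u)"])
    have "shift \<in> measurable M M" by (subst measurable_cong_sets[OF M(2) M(2)]) (rule measurable_shift)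
    from measurable_sets[OF this, of "cyl u"] show "{b. shift b \<in> cyl u} \<in> sets M"
      using sets_eq_imp_space_eq[OF M(2)] by (simp add: vimage_def)
    fix b :: "nat \<Rightarrow> nat" assume b: "\<forall>n. set (prefix n b) \<subseteq> Bt"
    have "b 0 \<in> Bt" using b[rule_format, of "Suc (length u)"] by (simp add: prefix_Suc_Cons)
    then show "b \<in> {b. shift b \<in> cyl u} \<longleftrightarrow> prefix (Suc (length u)) b \<in> (\<lambda>b. b # u) ` Bt"
      by (auto simp: cyl_def prefix_Suc_Cons)
  qed (auto simp: finite_Bt)
  then show "measure M {b. shift b \<in> cyl u} = (\<Sum>b\<in>Bt. measure M (cyl (b # u)))"
    by (simp add: sum.reindex inj_on_def)
  let ?U = "{u. (set u \<subseteq> Bt \<and> length u = length w) \<and> map proj u = w}"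
  show "measure M {b. map proj (prefix (length w) b) = w} = (\<Sum>u\<in>?U. measure M (cyl u))"
  proof (rule un[of _ "length w"])
    show "finite ?U" using finite_words[OF finite_Bt, of "length w"] by (rule rev_finite_subset) auto
    show "{b. map proj (prefix (length w) b) = w} \<in> sets M"
      using measurable_sets[OF measurable_prefix, of "{u. map proj u = w}" "length w"] by (simp add: vimage_def M(2))
  qed auto
qed

text \<open>Together with \<open>measure_of_admissible\<close> this identifies admissible functions
  with invariant lifts, so an extreme function gives an extreme lift.\<close>

lemma admissible_cylinders:
  assumes M: "prob_space M" "sets M = sets seq_space" and inv: "distr M M shift = M"
    and supp: "AE b in M. \<forall>n. prefix n b \<in> Lang"
    and marg: "\<And>w. measure M {b. map proj (prefix (length w) b) = w} = pmf (replicate_pmf (length w) p) w"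
  shows "admissible (\<lambda>u. measure M (cyl u))"
proof -
  interpret M: prob_space M by fact
  have [simp]: "space M = UNIV" using sets_eq_imp_space_eq[OF M(2)] by simp
  have cylM: "cyl u \<in> sets M" for u by (simp add: M(2))
  have shM: "shift \<in> measurable M M" by (subst measurable_cong_sets[OF M(2) M(2)]) (rule measurable_shift)
  note sums = cylinder_sums[OF M supp]
  show ?thesis unfolding admissible_def
  proof (intro conjI allI impI)
    fix u :: "nat list"
    show "0 \<le> measure M (cyl u)" "measure M (cyl u) \<le> 1" by (simp_all add: M.prob_le_1)
    show "measure M (cyl u) = (\<Sum>b\<in>Bt. measure M (cyl (u @ [b])))" by (rule sums(1))
    have "measure M (cyl u) = measure (distr M M shift) (cyl u)" by (simp add: inv)
    also have "\<dots> = measure M {b. shift b \<in> cyl u}"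
      by (subst measure_distr[OF shM cylM]) (simp add: vimage_def)
    finally show "measure M (cyl u) = (\<Sum>b\<in>Bt. measure M (cyl (b # u)))" by (simp only: sums(2))
  next
    fix u assume u: "u \<notin> Lang"
    have "AE b in M. b \<notin> cyl u" using supp
    proof eventually_elim
      case (elim b)
      then have "prefix (length u) b \<in> Lang" by blast
      with u show ?case by (auto simp: cyl_def)
    qed
    then have "emeasure M (cyl u) = 0" using AE_iff_measurable[OF cylM[of u]] by simp
    then show "measure M (cyl u) = 0" by (simp add: measure_def)
  next
    show "measure M (cyl []) = 1" using M.prob_space by simp
  next
    fix w :: "'w list"
    show "(\<Sum>u\<in>{u. (set u \<subseteq> Bt \<and> length u = length w) \<and> map proj u = w}. measure M (cyl u))
        = pmf (replicate_pmf (length w) p) w"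
      by (simp only: sums(3)[symmetric] marg)
  qed
qed

lemma measure_of_admissible:
  assumes adm: "admissible g"
  obtains \<theta> where "prob_space \<theta>" "sets \<theta> = sets seq_space" "distr \<theta> \<theta> shift = \<theta>"
    "\<And>u. measure \<theta> (cyl u) = g u" "AE b in \<theta>. \<forall>n. prefix n b \<in> Lang"
    "\<And>w. measure \<theta> {b. map proj (prefix (length w) b) = w} = pmf (replicate_pmf (length w) p) w"
proof -
  note ad = adm[unfolded admissible_def]
  have g0: "\<And>u. 0 \<le> g u" and gL: "\<And>u. u \<notin> Lang \<Longrightarrow> g u = 0" and g1: "g [] = 1"
    and gr: "\<And>u. g u = (\<Sum>b\<in>Bt. g (u @ [b]))" and gl: "\<And>u. g u = (\<Sum>b\<in>Bt. g (b # u))"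
    and gm: "\<And>w. (\<Sum>u\<in>{u. (set u \<subseteq> Bt \<and> length u = length w) \<and> map proj u = w}. g u)
          = pmf (replicate_pmf (length w) p) w"
    using ad by blast+
  have out: "g u = 0" if "\<not> set u \<subseteq> Bt" for u using that gL Lang_sub by blast
  obtain \<theta> where \<theta>: "prob_space \<theta>" "sets \<theta> = sets seq_space" "\<And>u. measure \<theta> (cyl u) = g u"
    using measure_from_cylinders[OF finite_Bt g0 g1 out gr] by blast
  interpret \<theta>: prob_space \<theta> by fact
  have cylM: "cyl u \<in> sets \<theta>" for u by (simp add: \<theta>(2))
  have shM: "shift \<in> measurable \<theta> \<theta>" by (subst measurable_cong_sets[OF \<theta>(2) \<theta>(2)]) (rule measurable_shift)
  have sp: "space \<theta> = UNIV" using sets_eq_imp_space_eq[OF \<theta>(2)] by simp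
  have "AE b in \<theta>. prefix n b \<in> Lang" for n
  proof -
    have "(\<Union>u\<in>{u. length u = n \<and> u \<notin> Lang}. cyl u) \<in> null_sets \<theta>"
    proof (rule null_sets_UN')
      show "countable {u :: nat list. length u = n \<and> u \<notin> Lang}" by simp
      show "cyl u \<in> null_sets \<theta>" if "u \<in> {u. length u = n \<and> u \<notin> Lang}" for u
        using that gL \<theta>(3)[of u] cylM by (simp add: null_sets_def \<theta>.emeasure_eq_measure)
    qed
    moreover have "{b \<in> space \<theta>. prefix n b \<notin> Lang} \<subseteq> (\<Union>u\<in>{u. length u = n \<and> u \<notin> Lang}. cyl u)"
      by (auto simp: cyl_def)
    ultimately show ?thesis by (rule AE_I')
  qed
  then have supp: "AE b in \<theta>. \<forall>n. prefix n b \<in> Lang" by (simp add: AE_all_countable)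
  note sums = cylinder_sums[OF \<theta>(1,2) supp]
  have inv: "distr \<theta> \<theta> shift = \<theta>"
  proof (rule seq_measure_eqI)
    show "prob_space (distr \<theta> \<theta> shift)" by (rule \<theta>.prob_space_distr[OF shM])
    fix u :: "nat list"
    have "measure (distr \<theta> \<theta> shift) (cyl u) = measure \<theta> {b. shift b \<in> cyl u}"
      by (subst measure_distr[OF shM cylM]) (simp add: vimage_def sp)
    then show "measure (distr \<theta> \<theta> shift) (cyl u) = measure \<theta> (cyl u)"
      by (simp only: sums(2) \<theta>(3) gl[symmetric])
  qed (use \<theta> in auto)
  have marg: "measure \<theta> {b. map proj (prefix (length w) b) = w} = pmf (replicate_pmf (length w) p) w" for w
    by (simp only: sums(3) \<theta>(3) gm)
  show ?thesis by (rule that[OF \<theta>(1,2) inv \<theta>(3) supp marg])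
qed

text \<open>An invariant set of intermediate mass would split \<open>\<theta>\<close> into its
  conditional measures on the set and on the complement. Both are lifts again, against extremality.
  The sets are invariant only up to null sets because the coding map of orbits will intertwine the
  dynamics only almost everywhere.\<close>

theorem ergodic_lift:
  obtains \<theta> where "prob_space \<theta>" "sets \<theta> = sets seq_space" "distr \<theta> \<theta> shift = \<theta>"
    "AE b in \<theta>. \<forall>n. prefix n b \<in> Lang"
    "\<And>n. distr \<theta> (count_space UNIV) (\<lambda>b. map proj (prefix n b)) = measure_pmf (replicate_pmf n p)"
    "\<And>A. A \<in> sets \<theta> \<Longrightarrow> AE b in \<theta>. shift b \<in> A \<longleftrightarrow> b \<in> A \<Longrightarrow> measure \<theta> A = 0 \<or> measure \<theta> A = 1"
proof -
  obtain g where g: "admissible g" and extreme: "\<And>a g1 g2. admissible g1 \<Longrightarrow> admissible g2 \<Longrightarrow> 0 < a \<Longrightarrow> a < 1 \<Longrightarrow>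
      (\<And>u. g u = a * g1 u + (1 - a) * g2 u) \<Longrightarrow> g1 = g"
    by (rule admissible_extreme) blast
  obtain \<theta> where \<theta>: "prob_space \<theta>" "sets \<theta> = sets seq_space" "distr \<theta> \<theta> shift = \<theta>"
    "\<And>u. measure \<theta> (cyl u) = g u" "AE b in \<theta>. \<forall>n. prefix n b \<in> Lang"
    "\<And>w. measure \<theta> {b. map proj (prefix (length w) b) = w} = pmf (replicate_pmf (length w) p) w"
    by (rule measure_of_admissible[OF g]) blast
  interpret \<theta>: prob_space \<theta> by fact
  have [simp]: "space \<theta> = UNIV" using sets_eq_imp_space_eq[OF \<theta>(2)] by simp
  have shM[measurable]: "shift \<in> measurable \<theta> \<theta>" using measurable_shift by (simp cong: measurable_cong_sets add: \<theta>(2))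
  have pm: "(\<lambda>b. map proj (prefix n b)) \<in> measurable \<theta> (count_space UNIV)" for n
    by (subst measurable_cong_sets[OF \<theta>(2) refl]) (rule measurable_compose[OF measurable_prefix], simp)
  have pms: "{b. map proj (prefix n b) \<in> V} \<in> sets \<theta>" for n V
    using measurable_sets[OF pm[of n], of V] by (simp add: vimage_def)
  have distr_eq: "distr \<theta> (count_space UNIV) (\<lambda>b. map proj (prefix n b)) = measure_pmf (replicate_pmf n p)" for n
  proof (rule measure_eqI_countable[where A=UNIV])
    fix w :: "'w list"
    have e: "emeasure (distr \<theta> (count_space UNIV) (\<lambda>b. map proj (prefix n b))) {w}
        = ennreal (measure \<theta> {b. map proj (prefix n b) = w})"
      by (subst emeasure_distr[OF pm]) (simp_all add: vimage_def \<theta>.emeasure_eq_measure)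
    show "emeasure (distr \<theta> (count_space UNIV) (\<lambda>b. map proj (prefix n b))) {w}
        = emeasure (measure_pmf (replicate_pmf n p)) {w}"
    proof (cases "length w = n")
      case True
      then show ?thesis unfolding e using \<theta>(6)[of w] by (simp add: emeasure_pmf_single)
    next
      case False
      then have "{b. map proj (prefix n b) = w} = {}" by auto
      moreover have "pmf (replicate_pmf n p) w = 0" using False by (auto simp: pmf_eq_0_set_pmf set_replicate_pmf)
      ultimately show ?thesis unfolding e by (simp add: emeasure_pmf_single)
    qed
  qed (auto simp: sets_measure_pmf)
  have joint: "measure \<theta> {b. map proj (prefix n b) \<in> V} = measure (replicate_pmf n p) V" for n V
    unfolding distr_eq[symmetric] by (subst measure_distr[OF pm]) (simp_all add: vimage_def)
  note shn = measurable_compose_n[OF shM] and shn_inv = distr_funpow[OF shM \<theta>(3)]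
  have meas_shn: "measure \<theta> {b. (shift ^^ j) b \<in> B} = measure \<theta> B" if "B \<in> sets \<theta>" for j B
  proof -
    have "measure \<theta> B = measure (distr \<theta> \<theta> (shift ^^ j)) B" by (simp only: shn_inv)
    also have "\<dots> = measure \<theta> {b. (shift ^^ j) b \<in> B}"
      by (subst measure_distr[OF shn that]) (simp add: vimage_def)
    finally show ?thesis by simp
  qed

  \<comment> \<open>Conditioning on an invariant set clearly keeps invariance and support; the point
    is that the projection stays Bernoulli.\<close>
  have cond: "admissible (\<lambda>u. measure (uniform_measure \<theta> A) (cyl u)) \<and> prob_space (uniform_measure \<theta> A)"
    if A[measurable]: "A \<in> sets \<theta>" and AE_A: "AE b in \<theta>. shift b \<in> A \<longleftrightarrow> b \<in> A" and pos: "measure \<theta> A > 0" for A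
  proof -
    define M where "M = uniform_measure \<theta> A"
    have M: "prob_space M" unfolding M_def
      using pos by (intro prob_space_uniform_measure) (auto simp: \<theta>.emeasure_eq_measure)
    have setsM: "sets M = sets \<theta>" and [simp]: "space M = UNIV" by (simp_all add: M_def)
    have mM: "measure M B = measure \<theta> (A \<inter> B) / measure \<theta> A" if "B \<in> sets \<theta>" for B
      unfolding M_def using that A pos by (intro measure_uniform_measure) (auto simp: \<theta>.emeasure_eq_measure)
    have shMM: "shift \<in> measurable M M" using shM by (simp cong: measurable_cong_sets add: setsM)
    have AEj: "AE b in \<theta>. (shift ^^ j) b \<in> A \<longleftrightarrow> b \<in> A" for j
    proof (induction j)
      case (Suc j)
      have "AE b in distr \<theta> \<theta> (shift ^^ j). shift b \<in> A \<longleftrightarrow> b \<in> A" using AE_A by (simp only: shn_inv)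
      moreover have "{b \<in> space \<theta>. shift b \<in> A \<longleftrightarrow> b \<in> A} \<in> sets \<theta>" by measurable
      ultimately have "AE b in \<theta>. shift ((shift ^^ j) b) \<in> A \<longleftrightarrow> (shift ^^ j) b \<in> A"
        by (subst (asm) AE_distr_iff[OF shn]) auto
      with Suc show ?case by eventually_elim simp
    qed simp
    have corr: "measure \<theta> (A \<inter> {b. (shift ^^ j) b \<in> B}) = measure \<theta> (A \<inter> B)" if B[measurable]: "B \<in> sets \<theta>" for j B
    proof -
      note [measurable] = shn[of j]
      have sB: "{b. (shift ^^ j) b \<in> B} \<in> sets \<theta>" if "B \<in> sets \<theta>" for B
        using measurable_sets[OF shn that] by (simp add: vimage_def)
      have "measure \<theta> (A \<inter> {b. (shift ^^ j) b \<in> B}) = measure \<theta> {b. (shift ^^ j) b \<in> A \<inter> B}"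
        using AEj[of j] by (intro \<theta>.finite_measure_eq_AE sB sets.Int A B) (auto elim: eventually_mono)
      then show ?thesis by (simp only: meas_shn[OF sets.Int[OF A B]])
    qed
    have "admissible (\<lambda>u. measure M (cyl u))"
    proof (rule admissible_cylinders)
      show "prob_space M" by fact
      show "sets M = sets seq_space" by (simp only: setsM \<theta>(2))
      show "AE b in M. \<forall>n. prefix n b \<in> Lang"
        unfolding M_def using pos \<theta>(5)
        by (intro AE_uniform_measureI A) (auto elim: eventually_mono)
      show "distr M M shift = M"
      proof (rule seq_measure_eqI)
        show "prob_space (distr M M shift)" by (rule prob_space.prob_space_distr[OF M shMM])
        fix u :: "nat list"
        have c: "cyl u \<in> sets \<theta>" by (simp add: \<theta>(2))
        have c': "{b. shift b \<in> cyl u} \<in> sets \<theta>" using measurable_sets[OF shM c] by (simp add: vimage_def)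
        have "measure (distr M M shift) (cyl u) = measure M {b. shift b \<in> cyl u}"
          using c setsM by (subst measure_distr[OF shMM]) (simp_all add: vimage_def)
        also have "\<dots> = measure M (cyl u)"
          using corr[OF c, of 1] by (simp add: mM c c')
        finally show "measure (distr M M shift) (cyl u) = measure M (cyl u)" .
      qed (use M setsM \<theta>(2) in auto)
      fix w :: "'w list"
      define k where "k = length w"
      \<comment> \<open>\<open>E i\<close> asks for \<open>w\<close> in the \<open>i\<close>-th of
        consecutive disjoint blocks of length \<open>k\<close>. By invariance \<open>A\<close>
        correlates equally with all of them, and they are pairwise independent, so \<open>A\<close>
        is independent of each.\<close>
      define E where "E i = {b. map proj (prefix k ((shift ^^ (k * i)) b)) = w}" for i
      define E0 where "E0 = {b. map proj (prefix k b) = w}"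
      have E0: "E0 \<in> sets \<theta>" using pms[of k "{w}"] by (simp add: E0_def)
      have E_eq: "E i = {b. (shift ^^ (k * i)) b \<in> E0}" for i by (simp add: E_def E0_def)
      have E: "E i \<in> sets \<theta>" for i using measurable_sets[OF shn E0] by (simp add: E_eq vimage_def)
      have "measure M E0 = pmf (replicate_pmf k p) w"
      proof (cases "k = 0")
        case True
        then have "w = []" "E0 = UNIV" by (auto simp: k_def E0_def prefix_def)
        then show ?thesis using prob_space.prob_space[OF M] True by simp
      next
        case False
        define P where "P = pmf (replicate_pmf k p) w"
        have P: "measure \<theta> (E i) = P" for i
          unfolding E_eq meas_shn[OF E0] using \<theta>(6)[of w] by (simp add: E0_def k_def P_def)
        have PP': "measure \<theta> (E i \<inter> E (i + Suc d)) = P * P" for i d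
        proof -
          define r where "r = k * d"
          have B: "E0 \<inter> {b. (shift ^^ (k + r)) b \<in> E0} \<in> sets \<theta>"
            using measurable_sets[OF shn E0] by (intro sets.Int E0) (simp add: vimage_def)
          have "E i \<inter> E (i + Suc d) = {b. (shift ^^ (k * i)) b \<in> E0 \<inter> {b. (shift ^^ (k + r)) b \<in> E0}}"
          proof -
            have "(shift ^^ (k * (i + Suc d))) b = (shift ^^ (k + r)) ((shift ^^ (k * i)) b)" for b :: "nat \<Rightarrow> nat"
              by (auto simp: fun_eq_iff shift_funpow r_def algebra_simps)
            then show ?thesis by (auto simp: E_eq)
          qed
          then have "measure \<theta> (E i \<inter> E (i + Suc d)) = measure \<theta> (E0 \<inter> {b. (shift ^^ (k + r)) b \<in> E0})"
            by (simp only: meas_shn[OF B])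
          also have "E0 \<inter> {b. (shift ^^ (k + r)) b \<in> E0}
              = {b. map proj (prefix (k + (r + k)) b) \<in> {v. (take k v, take k (drop (k + r) v)) = (w, w)}}"
            by (auto simp: E0_def take_map drop_map take_prefix drop_prefix)
          also have "measure \<theta> \<dots> = measure (replicate_pmf (k + (r + k)) p) {v. (take k v, take k (drop (k + r) v)) = (w, w)}"
            by (rule joint)
          also have "\<dots> = pmf (map_pmf (\<lambda>v. (take k v, take k (drop (k + r) v))) (replicate_pmf (k + (r + k)) p)) (w, w)"
            by (simp add: pmf_map vimage_def)
          also have "\<dots> = P * P" unfolding map_two_blocks_replicate_pmf by (simp add: pmf_pair P_def)
          finally show ?thesis .
        qed
        have PP: "measure \<theta> (E i \<inter> E j) = P * P" if "i \<noteq> j" for i j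
          using that
        proof (induction i j rule: linorder_wlog)
          case (le i j)
          then have "j = i + Suc (j - i - 1)" by simp
          then show ?case using PP'[of i "j - i - 1"] by simp
        next
          case (sym i j)
          then show ?case by (simp add: Int_commute)
        qed
        have "measure \<theta> (A \<inter> E0) = measure \<theta> A * P"
          by (rule \<theta>.uniform_correlation_eq[OF A E P PP]) (simp_all add: E_eq corr[OF E0])
        then show ?thesis using pos by (simp add: mM E0 P_def)
      qed
      then show "measure M {b. map proj (prefix (length w) b) = w} = pmf (replicate_pmf (length w) p) w"
        by (simp add: E0_def k_def)
    qed
    then show ?thesis using M by (simp add: M_def)
  qed

  have erg: "measure \<theta> A = 0 \<or> measure \<theta> A = 1"
    if A: "A \<in> sets \<theta>" and AE_A: "AE b in \<theta>. shift b \<in> A \<longleftrightarrow> b \<in> A" for A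
  proof (rule ccontr)
    assume "\<not> (measure \<theta> A = 0 \<or> measure \<theta> A = 1)"
    then have a: "0 < measure \<theta> A" "measure \<theta> A < 1"
      using \<theta>.prob_le_1[of A] by (auto simp: less_le)
    define C where "C = space \<theta> - A"
    have C: "C \<in> sets \<theta>" "measure \<theta> C = 1 - measure \<theta> A"
      using A by (auto simp: C_def \<theta>.prob_compl simp del: \<open>space \<theta> = UNIV\<close>)
    have "AE b in \<theta>. shift b \<in> C \<longleftrightarrow> b \<in> C" using AE_A by eventually_elim (simp add: C_def)
    then have 2: "admissible (\<lambda>u. measure (uniform_measure \<theta> C) (cyl u))"
      using cond[OF C(1)] C(2) a by simp
    have 1: "admissible (\<lambda>u. measure (uniform_measure \<theta> A) (cyl u))" "prob_space (uniform_measure \<theta> A)"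
      using cond[OF A AE_A a(1)] by auto
    have unif: "measure (uniform_measure \<theta> B) (cyl u) = measure \<theta> (B \<inter> cyl u) / measure \<theta> B"
      if "B \<in> sets \<theta>" "measure \<theta> B > 0" for B u
      using that by (intro measure_uniform_measure) (auto simp: \<theta>.emeasure_eq_measure \<theta>(2))
    have "(\<lambda>u. measure (uniform_measure \<theta> A) (cyl u)) = g"
    proof (rule extreme[OF 1(1) 2 a])
      fix u :: "nat list"
      have "g u = measure \<theta> ((A \<inter> cyl u) \<union> (C \<inter> cyl u))"
        unfolding \<theta>(4)[symmetric] by (rule arg_cong[where f="measure \<theta>"]) (auto simp: C_def)
      also have "\<dots> = measure \<theta> (A \<inter> cyl u) + measure \<theta> (C \<inter> cyl u)"
        using A C(1) by (intro \<theta>.finite_measure_Union) (auto simp: C_def \<theta>(2))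
      finally show "g u = measure \<theta> A * measure (uniform_measure \<theta> A) (cyl u)
          + (1 - measure \<theta> A) * measure (uniform_measure \<theta> C) (cyl u)"
        using a C A by (simp add: unif)
    qed
    \<comment> \<open>Conditioning on \<open>A\<close> changes nothing, yet the conditional measure
      gives \<open>A\<close> full mass.\<close>
    then have "uniform_measure \<theta> A = \<theta>"
      by (intro seq_measure_eqI 1(2) \<theta>(1,2)) (auto simp: \<theta>(2,4) fun_eq_iff)
    moreover have "measure (uniform_measure \<theta> A) A = 1"
      using A a by (subst measure_uniform_measure) (auto simp: \<theta>.emeasure_eq_measure)
    ultimately show False using a by simp
  qed
  show ?thesis by (rule that[OF \<theta>(1,2,3,5) distr_eq erg])
qed

end

section \<open>Compactness of the orbit space and expansivity\<close>

lemma compact_PiE_UNIV: "compact X \<Longrightarrow> compact {x :: nat \<Rightarrow> 'a::metric_space. \<forall>j. x j \<in> X}"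
proof -
  assume "compact X"
  then have "compactin (product_topology (\<lambda>_. euclidean) UNIV) (PiE UNIV (\<lambda>_ :: nat. X))"
    by (subst compactin_PiE) auto
  then have "compact (PiE UNIV (\<lambda>_ :: nat. X))"
    by (simp add: euclidean_product_topology)
  also have "PiE UNIV (\<lambda>_ :: nat. X) = {x. \<forall>j. x j \<in> X}" by auto
  finally show ?thesis .
qed

lemma continuous_on_coord: "continuous_on S (\<lambda>x :: nat \<Rightarrow> 'a::topological_space. x j)"
  by (rule continuous_on_subset[OF continuous_on_product_coordinates]) simp

lemma compact_corr_graph: "compact X \<Longrightarrow> correspondence X T \<Longrightarrow> compact (corr_graph X T)"
  unfolding correspondence_def by (intro closedin_compact[OF compact_Times]) auto

lemma orbit_space_eq: "orbit_space X T = {x. \<forall>j. (x j, x (Suc j)) \<in> corr_graph X T}"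
  by (auto simp: orbit_space_def corr_graph_def)

lemma compact_orbit_space:
  assumes "compact X" "correspondence X T"
  shows "compact (orbit_space X T)"
proof -
  have cl: "closed (corr_graph X T)" using compact_corr_graph[OF assms] by (rule compact_imp_closed)
  have "closed ((\<lambda>x. (x j, x (Suc j))) -` corr_graph X T)" for j
    by (intro closed_vimage cl continuous_on_Pair continuous_on_coord)
  then have "closed (\<Inter>j. (\<lambda>x. (x j, x (Suc j))) -` corr_graph X T)" by blast
  also have "(\<Inter>j. (\<lambda>x. (x j, x (Suc j))) -` corr_graph X T) = orbit_space X T"
    by (auto simp: orbit_space_eq)
  finally have "closed (orbit_space X T)" .
  then have "compact ({x. \<forall>j. x j \<in> X} \<inter> orbit_space X T)"
    by (rule compact_Int_closed[OF compact_PiE_UNIV[OF assms(1)]])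
  also have "{x. \<forall>j. x j \<in> X} \<inter> orbit_space X T = orbit_space X T"
    by (auto simp: orbit_space_def)
  finally show ?thesis .
qed

lemma shift_orbit_space: "y \<in> orbit_space X T \<Longrightarrow> shift y \<in> orbit_space X T"
  by (auto simp: orbit_space_def shift_def)

lemma continuous_on_shift: "continuous_on S (shift :: (nat \<Rightarrow> 'a::topological_space) \<Rightarrow> _)"
  unfolding shift_def[abs_def]
  by (rule continuous_on_coordinatewise_then_product) (rule continuous_on_coord)

lemma proj2_orbit_space: "y \<in> orbit_space X T \<Longrightarrow> proj2 y \<in> corr_graph X T"
  by (auto simp: orbit_space_eq proj2_def)

lemma continuous_on_proj2: "continuous_on S (proj2 :: (nat \<Rightarrow> 'a::topological_space) \<Rightarrow> _)"
  unfolding proj2_def[abs_def] by (intro continuous_on_Pair continuous_on_coord)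

text \<open>A subsequence staying away from \<open>y\<close> would itself have a limit point in
  \<open>K\<close>, and the only possible one is \<open>y\<close>.\<close>

lemma compact_unique_limit:
  fixes f :: "nat \<Rightarrow> 'b::metric_space"
  assumes "compact K" "\<And>n. f n \<in> K"
    and lim: "\<And>l r. l \<in> K \<Longrightarrow> strict_mono r \<Longrightarrow> (f \<circ> r) \<longlonglongrightarrow> l \<Longrightarrow> l = y"
  shows "f \<longlonglongrightarrow> y"
proof (rule ccontr)
  assume "\<not> f \<longlonglongrightarrow> y"
  then obtain e where e: "e > 0" "\<not> (\<forall>\<^sub>F n in sequentially. dist (f n) y < e)"
    by (auto simp: tendsto_iff)
  then have "\<exists>\<^sub>F n in sequentially. dist (f n) y \<ge> e"
    by (simp add: not_eventually not_less)
  then have "infinite {n. dist (f n) y \<ge> e}"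
    by (simp add: frequently_cofinite flip: cofinite_eq_sequentially)
  then obtain r :: "nat \<Rightarrow> nat" where r: "strict_mono r" "\<And>n. dist (f (r n)) y \<ge> e"
    using infinite_enumerate by blast
  have "\<forall>n. (f \<circ> r) n \<in> K" using assms(2) by simp
  with assms(1) obtain l r' where l: "l \<in> K" "strict_mono r'" "((f \<circ> r) \<circ> r') \<longlonglongrightarrow> l"
    unfolding compact_def by blast
  have "l = y" using lim[OF l(1) strict_mono_o[OF r(1) l(2)]] l(3) by (simp add: comp_assoc)
  with l(3) have "\<forall>\<^sub>F n in sequentially. dist (((f \<circ> r) \<circ> r') n) y < e"
    using e(1) by (simp add: tendsto_iff)
  then obtain n where "dist (((f \<circ> r) \<circ> r') n) y < e" by (auto simp: eventually_sequentially)
  then show False using r(2)[of "r' n"] by simp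
qed

text \<open>By compactness, pairs violating the claim for every \<open>m\<close> would accumulate at
  two distinct points all of whose coordinates are within \<open>e\<close>.\<close>

lemma uniform_expansivity:
  fixes \<Omega> :: "(nat \<Rightarrow> 'a::metric_space) set"
  assumes "compact \<Omega>" and exp: "\<And>x y. x \<in> \<Omega> \<Longrightarrow> y \<in> \<Omega> \<Longrightarrow> x \<noteq> y \<Longrightarrow> \<exists>j. dist (x j) (y j) > e"
    and "\<delta> > 0"
  obtains m where "\<And>x y. x \<in> \<Omega> \<Longrightarrow> y \<in> \<Omega> \<Longrightarrow> (\<And>j. j < m \<Longrightarrow> dist (x j) (y j) \<le> e) \<Longrightarrow> dist x y < \<delta>"
proof -
  have "\<exists>m. \<forall>x\<in>\<Omega>. \<forall>y\<in>\<Omega>. (\<forall>j<m. dist (x j) (y j) \<le> e) \<longrightarrow> dist x y < \<delta>"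
  proof (rule ccontr)
    assume "\<not> ?thesis"
    then have "\<exists>z. z \<in> \<Omega> \<times> \<Omega> \<and> (\<forall>j<m. dist (fst z j) (snd z j) \<le> e) \<and> \<delta> \<le> dist (fst z) (snd z)" for m
      by (metis SigmaI fst_conv snd_conv not_less)
    then obtain z where z: "\<And>m. z m \<in> \<Omega> \<times> \<Omega>" "\<And>m j. j < m \<Longrightarrow> dist (fst (z m) j) (snd (z m) j) \<le> e"
      "\<And>m. \<delta> \<le> dist (fst (z m)) (snd (z m))" by metis
    have "compact (\<Omega> \<times> \<Omega>)" using assms(1) by (rule compact_Times) fact
    then obtain l r where l: "l \<in> \<Omega> \<times> \<Omega>" "strict_mono r" "(z \<circ> r) \<longlonglongrightarrow> l"
      using z(1) unfolding compact_def by blast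
    have f: "(\<lambda>n. fst (z (r n))) \<longlonglongrightarrow> fst l" "(\<lambda>n. snd (z (r n))) \<longlonglongrightarrow> snd l"
      using tendsto_fst[OF l(3)] tendsto_snd[OF l(3)] by (simp_all add: comp_def)
    have "\<delta> \<le> dist (fst l) (snd l)"
      by (rule tendsto_lowerbound[OF tendsto_dist[OF f]]) (use z(3) in auto)
    then have "fst l \<noteq> snd l" using assms(3) by auto
    then obtain j where j: "dist (fst l j) (snd l j) > e" using exp[of "fst l" "snd l"] l(1) by (auto simp: mem_Times_iff)
    have "dist (fst l j) (snd l j) \<le> e"
    proof (rule tendsto_upperbound[OF tendsto_dist[OF tendsto_coord[OF f(1)] tendsto_coord[OF f(2)]]])
      have "dist (fst (z (r n)) j) (snd (z (r n)) j) \<le> e" if "n \<ge> Suc j" for n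
        using z(2)[of j "r n"] seq_suble[OF l(2), of n] that by simp
      then show "\<forall>\<^sub>F n in sequentially. dist (fst (z (r n)) j) (snd (z (r n)) j) \<le> e"
        by (rule eventually_sequentiallyI)
    qed simp
    with j show False by simp
  qed
  then show ?thesis using that by blast
qed

section \<open>Approximation of Borel sets by closed sets\<close>

text \<open>The sets that can be approximated from inside and from outside form a sigma-algebra;
  having both sides is what makes the step to complements work.\<close>

lemma closed_open_approximation:
  fixes A :: "'b::metric_space set"
  assumes M: "finite_measure M" and sM: "sets M = sets (borel :: 'b measure)" and A: "A \<in> sets borel" and e: "e > 0"
  shows "\<exists>C U. closed C \<and> open U \<and> C \<subseteq> A \<and> A \<subseteq> U \<and> measure M (U - C) < e"
proof -
  interpret finite_measure M by fact
  have sp: "space M = UNIV" using sets_eq_imp_space_eq[OF sM] by simp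
  have op: "open U \<Longrightarrow> U \<in> sets M" and cl: "closed C \<Longrightarrow> C \<in> sets M" for U C :: "'b set"
    using sM by auto
  have "A \<in> sigma_sets UNIV {S. open S}" using A by (simp add: borel_def)
  then show ?thesis using e
  proof (induction arbitrary: e rule: sigma_sets.induct)
    case (Basic A)
    then have oA: "open A" by simp
    show ?case
    proof (cases "A = UNIV")
      case True
      with Basic show ?thesis by (intro exI[of _ UNIV]) auto
    next
      case False
      \<comment> \<open>The distance to the complement is positive exactly on the open set
        \<open>A\<close>. The whole space is treated apart, since the distance to the empty set is
        \<open>0\<close> by convention.\<close>
      define C where "C n = {x. 1 / real (Suc n) \<le> infdist x (- A)}" for n
      have clC: "closed (C n)" for n unfolding C_def
        by (intro closed_Collect_le continuous_on_infdist continuous_on_const continuous_on_id)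
      have "incseq C" unfolding C_def incseq_Suc_iff
        by (auto elim!: order_trans[rotated] simp: frac_le)
      then have "(\<lambda>n. measure M (C n)) \<longlonglongrightarrow> measure M (\<Union>n. C n)"
        using clC cl by (intro finite_Lim_measure_incseq) auto
      also have "(\<Union>n. C n) = A"
      proof (intro equalityI subsetI)
        fix x assume "x \<in> (\<Union>n. C n)"
        then obtain n where "1 / real (Suc n) \<le> infdist x (- A)" by (auto simp: C_def)
        moreover have "0 < 1 / real (Suc n)" by simp
        ultimately have "0 < infdist x (- A)" by linarith
        then show "x \<in> A" using infdist_zero[of x "- A"] by (cases "x \<in> A") auto
      next
        fix x assume "x \<in> A"
        then have "infdist x (- A) \<noteq> 0"
          using in_closed_iff_infdist_zero[of "- A" x] oA False by (auto simp: closed_def)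
        then have "0 < infdist x (- A)" using infdist_nonneg[of x "- A"] by linarith
        then obtain n where "1 / real (Suc n) < infdist x (- A)" using nat_approx_posE by blast
        then show "x \<in> (\<Union>n. C n)" by (auto simp: C_def intro!: exI[of _ n])
      qed
      finally have "\<forall>\<^sub>F n in sequentially. measure M A - e < measure M (C n)"
        using Basic(2) by (intro order_tendstoD(1)) auto
      then obtain n where n: "measure M A - e < measure M (C n)"
        using eventually_happens by force
      have sub: "C n \<subseteq> A" using \<open>(\<Union>n. C n) = A\<close> by auto
      then have "measure M (A - C n) = measure M A - measure M (C n)"
        using op[OF oA] cl[OF clC] by (intro finite_measure_Diff) auto
      with n clC oA sub show ?thesis by (intro exI[of _ "C n"] exI[of _ A]) auto
    qed
  next
    case Empty
    then show ?case by (intro exI[of _ "{}"]) auto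
  next
    case (Compl A)
    obtain C U where CU: "closed C" "open U" "C \<subseteq> A" "A \<subseteq> U" "measure M (U - C) < e"
      using Compl.IH[OF Compl.prems] by blast
    have "- C - - U = U - C" by auto
    then have "measure M (- C - - U) < e" using CU(5) by (simp only:)
    moreover have "- U \<subseteq> UNIV - A" "UNIV - A \<subseteq> - C" using CU(3,4) by auto
    ultimately show ?case
      using closed_Compl[OF CU(2)] open_Compl[OF CU(1)] by blast
  next
    case (Union A)
    \<comment> \<open>Half of \<open>e\<close> is spread geometrically over the sequence. The other
      half pays for truncating the union of the closed sets, which as a whole need not be
      closed.\<close>
    have "\<exists>C U. closed C \<and> open U \<and> C \<subseteq> A i \<and> A i \<subseteq> U \<and> measure M (U - C) < e / 2 * (1/2)^Suc i" for i
      using Union(2)[of "e / 2 * (1/2)^Suc i" i] Union.prems by simp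
    then obtain C U where CU: "\<And>i. closed (C i)" "\<And>i. open (U i)" "\<And>i. C i \<subseteq> A i" "\<And>i. A i \<subseteq> U i"
      "\<And>i. measure M (U i - C i) < e / 2 * (1/2)^Suc i" by metis
    have geo: "(\<lambda>i. e / 2 * (1/2)^Suc i) sums (e / 2 * 1)"
      using sums_mult[OF power_half_series, of "e / 2"] .
    have D: "U i - C i \<in> sets M" for i using op[OF CU(2)] cl[OF CU(1)] by auto
    have summ: "summable (\<lambda>i. measure M (U i - C i))"
      using CU(5) by (intro summable_comparison_test'[OF sums_summable[OF geo], of 0]) (auto intro: less_imp_le)
    have "measure M (\<Union>i. U i - C i) \<le> (\<Sum>i. measure M (U i - C i))"
      using D summ by (intro finite_measure_subadditive_countably) auto
    also have "\<dots> \<le> (\<Sum>i. e / 2 * (1/2)^Suc i)"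
      using CU(5) by (intro suminf_le summ sums_summable[OF geo]) (auto intro: less_imp_le)
    also have "\<dots> = e / 2" using sums_unique[OF geo] by simp
    finally have b1: "measure M (\<Union>i. U i - C i) \<le> e / 2" .
    define K where "K n = (\<Union>i\<le>n. C i)" for n
    have clK: "closed (K n)" for n unfolding K_def using CU(1) by (intro closed_UN) auto
    have "incseq K" unfolding K_def incseq_def by (auto intro: order_trans)
    then have "(\<lambda>n. measure M (K n)) \<longlonglongrightarrow> measure M (\<Union>n. K n)"
      using clK cl by (intro finite_Lim_measure_incseq) auto
    then have "\<forall>\<^sub>F n in sequentially. measure M (\<Union>n. K n) - e / 2 < measure M (K n)"
      using Union.prems by (intro order_tendstoD(1)) auto
    then obtain n where n: "measure M (\<Union>n. K n) - e / 2 < measure M (K n)"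
      using eventually_happens by force
    have KU: "(\<Union>n. K n) \<in> sets M" using cl[OF clK] by auto
    have "measure M ((\<Union>n. K n) - K n) = measure M (\<Union>n. K n) - measure M (K n)"
      using KU cl[OF clK] by (intro finite_measure_Diff) auto
    then have b2: "measure M ((\<Union>n. K n) - K n) < e / 2" using n by simp
    have DU: "(\<Union>i. U i - C i) \<in> sets M" using D by auto
    have "C i \<subseteq> K i" for i by (auto simp: K_def)
    then have "(\<Union>i. U i) - K n \<subseteq> (\<Union>i. U i - C i) \<union> ((\<Union>n. K n) - K n)" by blast
    then have "measure M ((\<Union>i. U i) - K n) \<le> measure M ((\<Union>i. U i - C i) \<union> ((\<Union>n. K n) - K n))"
      using DU KU cl[OF clK] by (intro finite_measure_mono) auto
    also have "\<dots> \<le> measure M (\<Union>i. U i - C i) + measure M ((\<Union>n. K n) - K n)"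
      using DU KU cl[OF clK] by (intro measure_Un_le) auto
    also have "\<dots> < e" using b1 b2 by simp
    finally have "measure M ((\<Union>i. U i) - K n) < e" .
    moreover have "K n \<subseteq> (\<Union>i. A i)" "(\<Union>i. A i) \<subseteq> (\<Union>i. U i)"
      unfolding K_def using CU(3,4) by blast+
    moreover have "open (\<Union>i. U i)" using CU(2) by auto
    ultimately show ?case
      using clK by (intro exI[of _ "K n"] exI[of _ "\<Union>i. U i"] conjI)
  qed
qed

lemma closed_approximation:
  fixes A :: "'b::metric_space set"
  assumes M: "finite_measure M" and sM: "sets M = sets (borel :: 'b measure)" and A: "A \<in> sets borel" and e: "e > 0"
  obtains C where "closed C" "C \<subseteq> A" "measure M (A - C) < e"
proof -
  interpret finite_measure M by fact
  obtain C U where CU: "closed C" "open U" "C \<subseteq> A" "A \<subseteq> U" "measure M (U - C) < e"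
    using closed_open_approximation[OF assms] by blast
  have "measure M (A - C) \<le> measure M (U - C)"
    using CU A by (intro finite_measure_mono) (auto simp: sM)
  with CU show ?thesis by (intro that) auto
qed

lemma finite_compact_separation:
  fixes C :: "'i \<Rightarrow> 'b::metric_space set"
  assumes "finite I" "\<And>i. i \<in> I \<Longrightarrow> compact (C i)" "\<And>i j. i \<in> I \<Longrightarrow> j \<in> I \<Longrightarrow> i \<noteq> j \<Longrightarrow> C i \<inter> C j = {}"
  obtains s where "s > 0" "\<And>i j x y. i \<in> I \<Longrightarrow> j \<in> I \<Longrightarrow> i \<noteq> j \<Longrightarrow> x \<in> C i \<Longrightarrow> y \<in> C j \<Longrightarrow> s \<le> dist x y"
proof -
  have "\<exists>d>0. \<forall>x\<in>C i. \<forall>y\<in>C j. d \<le> dist x y" if "i \<in> I" "j \<in> I" "i \<noteq> j" for i j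
  proof (cases "C i \<times> C j = {}")
    case False
    have "compact (C i \<times> C j)" using that by (intro compact_Times assms(2))
    moreover have "continuous_on (C i \<times> C j) (\<lambda>w. dist (fst w) (snd w))"
      by (intro continuous_intros)
    ultimately obtain z where z: "z \<in> C i \<times> C j" "\<And>w. w \<in> C i \<times> C j \<Longrightarrow> dist (fst z) (snd z) \<le> dist (fst w) (snd w)"
      using continuous_attains_inf[OF _ False] by blast
    have "fst z \<noteq> snd z" using z(1) assms(3)[OF that] by (auto simp: mem_Times_iff)
    then show ?thesis using z(2) by (intro exI[of _ "dist (fst z) (snd z)"]) auto
  qed (auto intro!: exI[of _ 1])
  then obtain d where d: "\<And>i j. i \<in> I \<Longrightarrow> j \<in> I \<Longrightarrow> i \<noteq> j \<Longrightarrow> d i j > 0 \<and> (\<forall>x\<in>C i. \<forall>y\<in>C j. d i j \<le> dist x y)"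
    by metis
  \<comment> \<open>Including \<open>1\<close> keeps the minimum defined when there are fewer than
    two indices.\<close>
  define D where "D = insert 1 ((\<lambda>(i, j). d i j) ` {(i, j)\<in>I \<times> I. i \<noteq> j})"
  have "finite {(i, j)\<in>I \<times> I. i \<noteq> j}" using assms(1) by (auto intro: finite_subset[of _ "I \<times> I"])
  then have fin: "finite D" "D \<noteq> {}" by (auto simp: D_def)
  have "Min D > 0" using fin d by (subst Min_gr_iff) (auto simp: D_def)
  moreover have "Min D \<le> dist x y" if "i \<in> I" "j \<in> I" "i \<noteq> j" "x \<in> C i" "y \<in> C j" for i j x y
  proof -
    have "Min D \<le> d i j" using that by (intro Min_le fin) (auto simp: D_def)
    also have "\<dots> \<le> dist x y" using d[of i j] that by blast
    finally show ?thesis .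
  qed
  ultimately show ?thesis by (rule that)
qed

lemma measurable_embedding:
  assumes "sets \<nu> = sets (restrict_space borel Y)"
  shows "(\<lambda>y. y) \<in> measurable \<nu> borel"
  by (subst measurable_cong_sets[OF assms refl]) (rule measurable_restrict_space1, simp)

text \<open>Inside each level set of \<open>f\<close> take a closed set carrying nearly all its
  mass. These compact sets keep a distance \<open>s\<close> from each other, and names that locate
  points within \<open>s\<close> tell them apart, so the guess fails only on the leftover.\<close>

lemma simple_function_from_fine_names:
  fixes \<Omega> :: "'b::metric_space set" and name :: "nat \<Rightarrow> 'b \<Rightarrow> 'u" and f :: "'b \<Rightarrow> 'v"
  assumes \<nu>: "prob_space \<nu>" "sets \<nu> = sets (restrict_space borel \<Omega>)" and "compact \<Omega>"
    and fine: "\<And>\<delta>. \<delta> > 0 \<Longrightarrow> \<exists>m. \<forall>x\<in>\<Omega>. \<forall>y\<in>\<Omega>. name m x = name m y \<longrightarrow> dist x y < \<delta>"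
    and f: "simple_function \<nu> f" and "q > 0"
  shows "\<exists>m \<psi>. measure \<nu> {y \<in> space \<nu>. f y \<noteq> \<psi> (name m y)} \<le> q"
proof -
  interpret prob_space \<nu> by fact
  have sp: "space \<nu> = \<Omega>" using sets_eq_imp_space_eq[OF \<nu>(2)] by (simp add: space_restrict_space)
  define N where "N = distr \<nu> borel (\<lambda>y. y)"
  have em: "(\<lambda>y. y) \<in> measurable \<nu> borel" by (rule measurable_embedding[OF \<nu>(2)])
  interpret N: prob_space N unfolding N_def by (rule prob_space_distr[OF em])
  have mN: "measure N B = measure \<nu> (B \<inter> \<Omega>)" if "B \<in> sets borel" for B
    unfolding N_def by (subst measure_distr[OF em that]) (simp add: sp)
  have \<Omega>b: "\<Omega> \<in> sets borel" using assms(3) by (intro borel_compact)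
  define V where "V = f ` \<Omega>"
  have fV: "finite V" using f by (simp add: simple_function_def V_def sp)
  have V0: "card V > 0" using fV not_empty by (auto simp: card_gt_0_iff V_def sp)
  define A where "A v = {y \<in> \<Omega>. f y = v}" for v
  have A\<nu>: "A v \<in> sets \<nu>" for v using simple_function_level_sets(1)[OF f, of v] by (simp add: A_def sp)
  have Ab: "A v \<in> sets borel" for v
  proof -
    obtain B where "B \<in> sets borel" "A v = \<Omega> \<inter> B"
      using A\<nu>[of v] unfolding \<nu>(2) sets_restrict_space by blast
    then show ?thesis using \<Omega>b by simp
  qed
  have "\<exists>C. closed C \<and> C \<subseteq> A v \<and> measure N (A v - C) < q / card V" for v
  proof -
    have "sets N = sets borel" by (simp add: N_def)
    moreover have "q / card V > 0" using \<open>q > 0\<close> V0 by simp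
    ultimately obtain C where "closed C" "C \<subseteq> A v" "measure N (A v - C) < q / card V"
      by (rule closed_approximation[OF N.finite_measure_axioms _ Ab[of v]])
    then show ?thesis by blast
  qed
  then obtain C where C: "\<And>v. closed (C v)" "\<And>v. C v \<subseteq> A v" "\<And>v. measure N (A v - C v) < q / card V" by metis
  have "compact (C v)" for v
  proof -
    have "\<Omega> \<inter> C v = C v" using C(2)[of v] by (auto simp: A_def)
    then show ?thesis using compact_Int_closed[OF assms(3) C(1)[of v]] by simp
  qed
  moreover have "C v \<inter> C w = {}" if "v \<noteq> w" for v w using C(2)[of v] C(2)[of w] that by (auto simp: A_def)
  ultimately obtain s where s: "s > 0" "\<And>v w x y. v \<in> V \<Longrightarrow> w \<in> V \<Longrightarrow> v \<noteq> w \<Longrightarrow> x \<in> C v \<Longrightarrow> y \<in> C w \<Longrightarrow> s \<le> dist x y"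
    using finite_compact_separation[OF fV, of C] by metis
  obtain m where m: "\<And>x y. x \<in> \<Omega> \<Longrightarrow> y \<in> \<Omega> \<Longrightarrow> name m x = name m y \<Longrightarrow> dist x y < s"
    using fine[OF s(1)] by blast
  define \<psi> where "\<psi> u = (SOME v. v \<in> V \<and> (\<exists>y\<in>C v. name m y = u))" for u
  have \<psi>: "\<psi> (name m y) = v" if "v \<in> V" "y \<in> C v" for v y
  proof -
    have "\<exists>v. v \<in> V \<and> (\<exists>z\<in>C v. name m z = name m y)" using that by blast
    then obtain z where z: "\<psi> (name m y) \<in> V" "z \<in> C (\<psi> (name m y))" "name m z = name m y"
      unfolding \<psi>_def using someI_ex[of "\<lambda>v. v \<in> V \<and> (\<exists>z\<in>C v. name m z = name m y)"] by blast
    then have "dist z y < s" using that C(2) by (intro m) (auto simp: A_def)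
    then show ?thesis using s(2)[OF z(1) that(1) _ z(2) that(2)] by force
  qed
  have AC: "A v - C v \<in> sets \<nu>" for v
  proof -
    have "A v - C v \<in> sets borel" using Ab C(1) by auto
    moreover have "A v - C v = \<Omega> \<inter> (A v - C v)" by (auto simp: A_def)
    ultimately show ?thesis unfolding \<nu>(2) sets_restrict_space by blast
  qed
  have "{y \<in> space \<nu>. f y \<noteq> \<psi> (name m y)} \<subseteq> (\<Union>v\<in>V. A v - C v)"
  proof
    fix y assume y: "y \<in> {y \<in> space \<nu>. f y \<noteq> \<psi> (name m y)}"
    then have "f y \<in> V" "y \<in> A (f y)" by (auto simp: sp A_def V_def)
    moreover have "y \<notin> C (f y)" using \<psi>[OF \<open>f y \<in> V\<close>, of y] y by auto
    ultimately show "y \<in> (\<Union>v\<in>V. A v - C v)" by blast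
  qed
  then have "measure \<nu> {y \<in> space \<nu>. f y \<noteq> \<psi> (name m y)} \<le> measure \<nu> (\<Union>v\<in>V. A v - C v)"
    using AC fV by (intro finite_measure_mono) auto
  also have "\<dots> \<le> (\<Sum>v\<in>V. measure \<nu> (A v - C v))"
    using AC fV by (intro finite_measure_subadditive_finite) auto
  also have "\<dots> \<le> (\<Sum>v\<in>V. q / card V)"
  proof (rule sum_mono)
    fix v
    have "measure \<nu> (A v - C v) = measure N (A v - C v)"
      using Ab C(1) by (subst mN) (auto intro!: arg_cong[where f="measure \<nu>"] simp: A_def)
    then show "measure \<nu> (A v - C v) \<le> q / card V" using C(3)[of v] by simp
  qed
  also have "\<dots> = q" using V0 by simp
  finally show ?thesis by blast
qed

section \<open>Finite Borel partitions with small cells\<close>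

lemma small_cells:
  fixes X :: "'a::metric_space set"
  assumes "compact X" "\<delta> > 0"
  obtains K and pl :: "'a \<Rightarrow> nat" where "\<And>x. x \<in> X \<Longrightarrow> pl x < K"
    "\<And>x y. x \<in> X \<Longrightarrow> y \<in> X \<Longrightarrow> pl x = pl y \<Longrightarrow> dist x y \<le> \<delta>" "pl \<in> measurable borel (count_space UNIV)"
proof -
  obtain Z where Z: "finite Z" "Z \<subseteq> X" "X \<subseteq> (\<Union>z\<in>Z. ball z (\<delta> / 2))"
    using compactE_image[OF assms(1), of X "\<lambda>z. ball z (\<delta> / 2)"] assms(2) by force
  obtain z :: "nat \<Rightarrow> 'a" and K where z: "Z = z ` {i. i < K}"
    using finite_imp_nat_seg_image_inj_on[OF Z(1)] by blast
  \<comment> \<open>The index of the first ball containing the point. The extra value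
    \<open>K\<close> makes the minimum exist off \<open>X\<close> too, so that \<open>pl\<close> is
    measurable on the whole space.\<close>
  define pl where "pl x = (LEAST i. i = K \<or> x \<in> ball (z i) (\<delta> / 2))" for x
  have pl: "pl x < K \<and> x \<in> ball (z (pl x)) (\<delta> / 2)" if "x \<in> X" for x
  proof -
    have "x \<in> (\<Union>y\<in>Z. ball y (\<delta> / 2))" using Z(3) that by blast
    then obtain i where i: "i < K" "x \<in> ball (z i) (\<delta> / 2)" unfolding z by blast
    have "pl x \<le> i" unfolding pl_def using i by (intro Least_le) auto
    moreover have "pl x = K \<or> x \<in> ball (z (pl x)) (\<delta> / 2)"
      unfolding pl_def by (rule LeastI[of _ K]) simp
    ultimately show ?thesis using i(1) by auto
  qed
  show ?thesis
  proof (rule that)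
    show "pl x < K" if "x \<in> X" for x using pl[OF that] by blast
    fix x y assume xy: "x \<in> X" "y \<in> X" "pl x = pl y"
    have "dist x y \<le> dist (z (pl x)) x + dist (z (pl x)) y" by (rule dist_triangle3)
    also have "\<dots> < \<delta> / 2 + \<delta> / 2"
      using pl[OF xy(1)] pl[OF xy(2)] xy(3) by (intro add_strict_mono) auto
    finally show "dist x y \<le> \<delta>" by simp
  next
    show "pl \<in> measurable borel (count_space UNIV)"
      unfolding pl_def[abs_def]
    proof (rule measurable_Least)
      fix i
      show "Measurable.pred borel (\<lambda>x. i = K \<or> x \<in> ball (z i) (\<delta> / 2))"
      proof -
        have "{x. i = K \<or> x \<in> ball (z i) (\<delta> / 2)} = (if i = K then UNIV else ball (z i) (\<delta> / 2))"
          by (auto simp del: mem_ball)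
        moreover have "(if i = K then UNIV else ball (z i) (\<delta> / 2)) \<in> sets borel" by simp
        ultimately show ?thesis by (simp only: pred_def space_borel UNIV_I simp_thms)
      qed
    qed
  qed
qed

section \<open>Neighbourhoods in the weak-star topology\<close>

lemma topspace_weak_star:
  fixes Y :: "'b::topological_space set"
  shows "topspace (weak_star_topology Y) = borel_prob_measures Y"
proof -
  let ?B = "{{\<mu> \<in> borel_prob_measures Y. (\<integral>y. f y \<partial>\<mu>) \<in> U} | (f :: 'b \<Rightarrow> real) U. continuous_on Y f \<and> open U}"
  have "{\<mu> \<in> borel_prob_measures Y. (\<integral>y. (0::real) \<partial>\<mu>) \<in> UNIV} \<in> ?B"
    using continuous_on_const open_UNIV by blast
  then have "borel_prob_measures Y \<subseteq> \<Union> ?B" by auto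
  moreover have "\<Union> ?B \<subseteq> borel_prob_measures Y" by blast
  ultimately show ?thesis
    unfolding weak_star_topology_def topology_generated_by_topspace by (rule equalityI[rotated])
qed

text \<open>Induction over the generation of the topology: an intersection merges the two finite
  sets of test functions and takes the smaller \<open>\<delta>\<close>.\<close>

lemma weak_star_neighbourhood:
  fixes Y :: "'b::topological_space set"
  assumes "openin (weak_star_topology Y) W" "\<mu> \<in> W"
  shows "\<exists>(\<Phi> :: ('b \<Rightarrow> real) set) \<delta>. finite \<Phi> \<and> (\<forall>f\<in>\<Phi>. continuous_on Y f) \<and> \<delta> > 0 \<and>
    (\<forall>\<mu>'\<in>borel_prob_measures Y. (\<forall>f\<in>\<Phi>. \<bar>(\<integral>y. f y \<partial>\<mu>') - (\<integral>y. f y \<partial>\<mu>)\<bar> < \<delta>) \<longrightarrow> \<mu>' \<in> W)"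
proof -
  have "generate_topology_on {{\<mu> \<in> borel_prob_measures Y. (\<integral>y. f y \<partial>\<mu>) \<in> U} | (f :: 'b \<Rightarrow> real) U.
          continuous_on Y f \<and> open U} W"
    using assms(1) unfolding weak_star_topology_def by (rule openin_topology_generated_by)
  then show ?thesis using assms(2)
  proof (induction W rule: generate_topology_on.induct)
    case (Int a b)
    from Int.IH(1)[OF IntD1[OF Int.prems]] obtain \<Phi> :: "('b \<Rightarrow> real) set" and \<delta> where
      *: "finite \<Phi>" "\<forall>f\<in>\<Phi>. continuous_on Y f" "\<delta> > 0"
      "\<forall>\<mu>'\<in>borel_prob_measures Y. (\<forall>f\<in>\<Phi>. \<bar>(\<integral>y. f y \<partial>\<mu>') - (\<integral>y. f y \<partial>\<mu>)\<bar> < \<delta>) \<longrightarrow> \<mu>' \<in> a"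
      by blast
    from Int.IH(2)[OF IntD2[OF Int.prems]] obtain \<Phi>' :: "('b \<Rightarrow> real) set" and \<delta>' where
      **: "finite \<Phi>'" "\<forall>f\<in>\<Phi>'. continuous_on Y f" "\<delta>' > 0"
      "\<forall>\<mu>'\<in>borel_prob_measures Y. (\<forall>f\<in>\<Phi>'. \<bar>(\<integral>y. f y \<partial>\<mu>') - (\<integral>y. f y \<partial>\<mu>)\<bar> < \<delta>') \<longrightarrow> \<mu>' \<in> b"
      by blast
    show ?case
      by (intro exI[of _ "\<Phi> \<union> \<Phi>'"] exI[of _ "min \<delta> \<delta>'"]) (use * ** in auto)
  next
    case (UN K)
    then obtain k where k: "k \<in> K" "\<mu> \<in> k" by blast
    from UN.IH[OF this] show ?case using k(1) by (meson UnionI)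
  next
    case (Basis s)
    then obtain f :: "'b \<Rightarrow> real" and U where s: "s = {\<mu> \<in> borel_prob_measures Y. (\<integral>y. f y \<partial>\<mu>) \<in> U}"
      "continuous_on Y f" "open U" by blast
    then have "(\<integral>y. f y \<partial>\<mu>) \<in> U" using Basis by simp
    then obtain \<delta> where "\<delta> > 0" "ball (\<integral>y. f y \<partial>\<mu>) \<delta> \<subseteq> U" using s(3) open_contains_ball by blast
    moreover have "\<mu>' \<in> s" if "\<mu>' \<in> borel_prob_measures Y" "\<bar>(\<integral>y. f y \<partial>\<mu>') - (\<integral>y. f y \<partial>\<mu>)\<bar> < \<delta>" for \<mu>'
    proof -
      have "(\<integral>y. f y \<partial>\<mu>') \<in> ball (\<integral>y. f y \<partial>\<mu>) \<delta>"
        using that(2) by (simp add: dist_real_def abs_minus_commute)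
      then show ?thesis using that(1) calculation(2) unfolding s(1) by blast
    qed
    ultimately show ?case
      using s(2) by (intro exI[of _ "{f}"] exI[of _ \<delta>]) simp
  qed simp
qed

text \<open>Reduces closeness of energies to closeness of finitely many integrals, which shadowing
  can control.\<close>

lemma continuous_energy_neighbourhood:
  fixes Y :: "'b::topological_space set"
  assumes "continuous_map (weak_star_topology Y) euclideanreal E" "\<mu> \<in> borel_prob_measures Y" "\<eta> > 0"
  obtains \<Phi> :: "('b \<Rightarrow> real) set" and \<delta> where "finite \<Phi>" "\<And>f. f \<in> \<Phi> \<Longrightarrow> continuous_on Y f" "\<delta> > 0"
    "\<And>\<mu>'. \<mu>' \<in> borel_prob_measures Y \<Longrightarrow> (\<And>f. f \<in> \<Phi> \<Longrightarrow> \<bar>(\<integral>y. f y \<partial>\<mu>') - (\<integral>y. f y \<partial>\<mu>)\<bar> < \<delta>)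
      \<Longrightarrow> \<bar>E \<mu>' - E \<mu>\<bar> < \<eta>"
proof -
  let ?W = "{\<mu>' \<in> topspace (weak_star_topology Y). E \<mu>' \<in> ball (E \<mu>) \<eta>}"
  have "openin (weak_star_topology Y) ?W"
    using assms(1) by (intro openin_continuous_map_preimage) auto
  moreover have "\<mu> \<in> ?W" using assms by (simp add: topspace_weak_star)
  ultimately have "\<exists>(\<Phi> :: ('b \<Rightarrow> real) set) \<delta>. finite \<Phi> \<and> (\<forall>f\<in>\<Phi>. continuous_on Y f) \<and> \<delta> > 0 \<and>
    (\<forall>\<mu>'\<in>borel_prob_measures Y. (\<forall>f\<in>\<Phi>. \<bar>(\<integral>y. f y \<partial>\<mu>') - (\<integral>y. f y \<partial>\<mu>)\<bar> < \<delta>) \<longrightarrow> \<mu>' \<in> ?W)"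
    by (rule weak_star_neighbourhood)
  then obtain \<Phi> :: "('b \<Rightarrow> real) set" and \<delta> where "finite \<Phi>" "\<forall>f\<in>\<Phi>. continuous_on Y f" "\<delta> > 0"
    "\<forall>\<mu>'\<in>borel_prob_measures Y. (\<forall>f\<in>\<Phi>. \<bar>(\<integral>y. f y \<partial>\<mu>') - (\<integral>y. f y \<partial>\<mu>)\<bar> < \<delta>) \<longrightarrow> \<mu>' \<in> ?W"
    by (elim exE conjE)
  then show ?thesis
    by (intro that[of \<Phi> \<delta>]) (auto simp: dist_real_def abs_minus_commute)
qed

section \<open>Averaging a measure invariant under a power\<close>

locale power_mpt = prob_space \<kappa> for \<kappa> :: "'b measure" +
  fixes S :: "'b \<Rightarrow> 'b" and L :: nat
  assumes S_meas: "S \<in> measurable \<kappa> \<kappa>" and L_pos: "L > 0" and power_inv: "distr \<kappa> \<kappa> (S ^^ L) = \<kappa>"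
begin

text \<open>The mean of the images of \<open>\<kappa>\<close> under \<open>S ^^ j\<close> for
  \<open>j < L\<close>, written as a single image measure with random \<open>j\<close>, so that
  integrals are computed by Fubini.\<close>

definition avg :: "'b measure" where
  "avg = distr (measure_pmf (pmf_of_set {..<L}) \<Otimes>\<^sub>M \<kappa>) \<kappa> (\<lambda>(j, y). (S ^^ j) y)"

lemmas funpow_meas = measurable_compose_n[OF S_meas]

lemma funpow_space: "y \<in> space \<kappa> \<Longrightarrow> (S ^^ j) y \<in> space \<kappa>"
  using measurable_space[OF funpow_meas] .

lemma avg_map_meas: "(\<lambda>(j, y). (S ^^ j) y) \<in> measurable (measure_pmf (pmf_of_set {..<L}) \<Otimes>\<^sub>M \<kappa>) \<kappa>"
proof -
  have "(\<lambda>(j, y). (S ^^ j) y) \<in> measurable (count_space UNIV \<Otimes>\<^sub>M \<kappa>) \<kappa>"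
    by (rule measurable_pair_measure_countable1) (auto intro: funpow_meas)
  then show ?thesis
    by (subst measurable_cong_sets[OF sets_pair_measure_cong refl]) (auto simp: sets_measure_pmf)
qed

lemma sets_avg [simp]: "sets avg = sets \<kappa>" and space_avg [simp]: "space avg = space \<kappa>"
  by (simp_all add: avg_def)

interpretation pr: pair_prob_space "measure_pmf (pmf_of_set {..<L})" \<kappa>
  by (intro pair_prob_space.intro pair_sigma_finite.intro prob_space_imp_sigma_finite prob_space_axioms measure_pmf.prob_space_axioms)

lemma prob_space_avg: "prob_space avg"
  unfolding avg_def by (rule pr.prob_space_distr[OF avg_map_meas])

lemma integral_avg:
  fixes f :: "'b \<Rightarrow> real"
  assumes f: "f \<in> borel_measurable \<kappa>" and B: "\<And>y. y \<in> space \<kappa> \<Longrightarrow> \<bar>f y\<bar> \<le> B"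
  shows "(\<integral>y. f y \<partial>avg) = (\<Sum>j<L. \<integral>y. f ((S ^^ j) y) \<partial>\<kappa>) / L"
proof -
  have m: "(\<lambda>(j, y). f ((S ^^ j) y)) \<in> borel_measurable (measure_pmf (pmf_of_set {..<L}) \<Otimes>\<^sub>M \<kappa>)"
    using measurable_compose[OF avg_map_meas f] by (simp add: case_prod_beta')
  have int: "integrable (measure_pmf (pmf_of_set {..<L}) \<Otimes>\<^sub>M \<kappa>) (\<lambda>(j, y). f ((S ^^ j) y))"
    by (rule pr.integrable_const_bound[where B=B, OF _ m])
       (auto intro!: AE_I2 B funpow_space simp: space_pair_measure)
  have "(\<integral>y. f y \<partial>avg) = (\<integral>z. f ((\<lambda>(j, y). (S ^^ j) y) z) \<partial>(measure_pmf (pmf_of_set {..<L}) \<Otimes>\<^sub>M \<kappa>))"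
    unfolding avg_def by (rule integral_distr[OF avg_map_meas f])
  also have "\<dots> = (\<integral>z. (\<lambda>(j, y). f ((S ^^ j) y)) z \<partial>(measure_pmf (pmf_of_set {..<L}) \<Otimes>\<^sub>M \<kappa>))"
    by (simp add: case_prod_beta')
  also have "\<dots> = (\<integral>j. (\<integral>y. f ((S ^^ j) y) \<partial>\<kappa>) \<partial>measure_pmf (pmf_of_set {..<L}))"
    by (rule pr.integral_fst[OF int, symmetric])
  also have "\<dots> = (\<Sum>j<L. \<integral>y. f ((S ^^ j) y) \<partial>\<kappa>) / L"
    using L_pos by (subst integral_pmf_of_set) (auto simp: lessThan_empty_iff)
  finally show ?thesis .
qed

lemma measure_avg:
  assumes "A \<in> sets \<kappa>"
  shows "measure avg A = (\<Sum>j<L. measure \<kappa> {y \<in> space \<kappa>. (S ^^ j) y \<in> A}) / L"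
proof -
  have eq: "(\<integral>y. indicat_real A ((S ^^ j) y) \<partial>\<kappa>) = measure \<kappa> {y \<in> space \<kappa>. (S ^^ j) y \<in> A}" for j
  proof -
    have s: "{y \<in> space \<kappa>. (S ^^ j) y \<in> A} \<in> sets \<kappa>"
      using measurable_sets[OF funpow_meas assms, of j] by (simp add: vimage_def Int_def conj_commute)
    have "(\<integral>y. indicat_real A ((S ^^ j) y) \<partial>\<kappa>) = (\<integral>y. indicat_real {y \<in> space \<kappa>. (S ^^ j) y \<in> A} y \<partial>\<kappa>)"
      by (rule Bochner_Integration.integral_cong) (auto simp: indicator_def)
    then show ?thesis using s by simp
  qed
  have "measure avg A = (\<integral>y. indicat_real A y \<partial>avg)" using assms by simp
  also have "\<dots> = (\<Sum>j<L. \<integral>y. indicat_real A ((S ^^ j) y) \<partial>\<kappa>) / L"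
    using assms by (intro integral_avg[where B=1]) (auto simp: indicator_def)
  finally show ?thesis by (simp only: eq)
qed

text \<open>Applying \<open>S\<close> replaces \<open>j\<close> by \<open>Suc j\<close> in the mean,
  and the term at \<open>L\<close> equals the term at \<open>0\<close> because \<open>S ^^ L\<close>
  preserves \<open>\<kappa>\<close>.\<close>

lemma distr_avg: "distr avg avg S = avg"
proof (rule measure_eqI)
  interpret avg: prob_space avg by (rule prob_space_avg)
  have Sm: "S \<in> measurable avg avg" using S_meas by (simp cong: measurable_cong_sets)
  fix A assume "A \<in> sets (distr avg avg S)"
  then have A: "A \<in> sets \<kappa>" by simp
  have SA: "S -` A \<inter> space \<kappa> \<in> sets \<kappa>" using measurable_sets[OF S_meas A] .
  let ?m = "\<lambda>j. measure \<kappa> {y \<in> space \<kappa>. (S ^^ j) y \<in> A}"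
  have "measure (distr avg avg S) A = measure avg (S -` A \<inter> space \<kappa>)"
    using A by (subst measure_distr[OF Sm]) auto
  also have "\<dots> = (\<Sum>j<L. ?m (Suc j)) / L"
    unfolding measure_avg[OF SA] using funpow_space
    by (intro arg_cong2[where f="(/)"] sum.cong refl arg_cong[where f="measure \<kappa>"]) auto
  also have "(\<Sum>j<L. ?m (Suc j)) = (\<Sum>j<L. ?m j)"
  proof -
    have "?m L = measure (distr \<kappa> \<kappa> (S ^^ L)) A"
      by (subst measure_distr[OF funpow_meas A]) (simp add: vimage_def Int_def conj_commute)
    also have "\<dots> = ?m 0"
      using sets.sets_into_space[OF A] by (simp add: power_inv) (rule arg_cong[where f="measure \<kappa>"], auto)
    finally have "?m L = ?m 0" .
    moreover have "(\<Sum>j<L. ?m (Suc j) - ?m j) = ?m L - ?m 0"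
      by (rule sum_lessThan_telescope[of ?m L])
    ultimately show ?thesis by (simp only: sum_subtractf)
  qed
  also have "\<dots> / L = measure avg A" by (rule measure_avg[OF A, symmetric])
  finally show "emeasure (distr avg avg S) A = emeasure avg A"
    by (simp only: avg.emeasure_eq_measure
        finite_measure.emeasure_eq_measure[OF prob_space.finite_measure[OF avg.prob_space_distr[OF Sm]]])
qed simp

text \<open>A set equal to its own preimage has the same mass under every image of
  \<open>\<kappa>\<close>, hence under their mean.\<close>

lemma avg_zero_one:
  assumes "A \<in> sets \<kappa>" "S -` A \<inter> space \<kappa> = A" "measure \<kappa> A = 0 \<or> measure \<kappa> A = 1"
  shows "measure avg A = 0 \<or> measure avg A = 1"
proof -
  have "{y \<in> space \<kappa>. (S ^^ j) y \<in> A} = A" for j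
  proof (induction j)
    case 0
    then show ?case using sets.sets_into_space[OF assms(1)] by auto
  next
    case (Suc j)
    have "{y \<in> space \<kappa>. (S ^^ Suc j) y \<in> A} = {y \<in> space \<kappa>. (S ^^ j) y \<in> S -` A \<inter> space \<kappa>}"
      using funpow_space by auto
    then show ?case using assms(2) Suc by simp
  qed
  then show ?thesis using assms(3) L_pos by (simp add: measure_avg[OF assms(1)])
qed

text \<open>By concavity it suffices to treat each starting time \<open>j < L\<close>. An itinerary
  of \<open>Suc k\<close> blocks started at \<open>j\<close> contains the \<open>k\<close> full
  blocks that begin at time \<open>L\<close>, and these have the law of the first \<open>k\<close>
  since \<open>S ^^ L\<close> preserves \<open>\<kappa>\<close>. The price is one block.\<close>

lemma entropy_avg:
  assumes g: "simple_function \<kappa> g"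
  shows "rv_entropy \<kappa> (itinerary S g (k * L)) \<le> rv_entropy avg (itinerary S g (Suc k * L))"
proof -
  have it: "simple_function \<kappa> (itinerary S g m)" for m
    unfolding itinerary_def by (intro simple_function_map_upt simple_function_comp_measurable[OF funpow_meas g])
  let ?N = "Suc k * L"
  let ?Y = "\<lambda>j y. itinerary S g ?N ((S ^^ j) y)"
  have Y: "simple_function \<kappa> (?Y j)" for j
    by (rule simple_function_comp_measurable[OF funpow_meas it])
  have avg_it: "simple_function avg (itinerary S g ?N)"
    using it[of ?N] by (simp add: simple_function_def)
  have "(\<Sum>j<L. rv_entropy \<kappa> (?Y j)) / L \<le> rv_entropy avg (itinerary S g ?N)"
  proof (rule rv_entropy_mixture_ge[OF L_pos prob_space_avg avg_it prob_space_axioms Y])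
    fix u
    have s: "{y \<in> space \<kappa>. itinerary S g ?N y = u} \<in> sets \<kappa>" by (rule simple_function_level_sets(1)[OF it])
    show "law avg (itinerary S g ?N) u = (\<Sum>j<L. law \<kappa> (?Y j) u) / L"
      unfolding law_def space_avg measure_avg[OF s] using funpow_space
      by (intro arg_cong2[where f="(/)"] sum.cong refl arg_cong[where f="measure \<kappa>"]) auto
  qed
  moreover have "rv_entropy \<kappa> (itinerary S g (k * L)) \<le> rv_entropy \<kappa> (?Y j)" if j: "j < L" for j
  proof -
    have "rv_entropy \<kappa> (itinerary S g (k * L)) = rv_entropy (distr \<kappa> \<kappa> (S ^^ L)) (itinerary S g (k * L))"
      by (simp add: power_inv)
    also have "\<dots> = rv_entropy \<kappa> (\<lambda>y. itinerary S g (k * L) ((S ^^ L) y))"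
      by (rule rv_entropy_distr[OF funpow_meas it])
    also have "(\<lambda>y. itinerary S g (k * L) ((S ^^ L) y)) = (\<lambda>y. take (k * L) (drop (L - j) (?Y j y)))"
    proof
      fix y
      have N: "?N = (L - j) + (k * L + j)" using j by simp
      have "(S ^^ (L - j)) ((S ^^ j) y) = (S ^^ L) y"
        using j by (metis comp_apply funpow_add le_add_diff_inverse2 less_imp_le)
      then have "?Y j y = itinerary S g (L - j) ((S ^^ j) y) @ itinerary S g (k * L) ((S ^^ L) y) @ itinerary S g j ((S ^^ (k * L)) ((S ^^ L) y))"
        unfolding N itinerary_add by simp
      then show "itinerary S g (k * L) ((S ^^ L) y) = take (k * L) (drop (L - j) (?Y j y))" by simp
    qed
    also have "rv_entropy \<kappa> \<dots> \<le> rv_entropy \<kappa> (?Y j)"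
      by (rule rv_entropy_comp_le[OF prob_space_axioms Y, of "\<lambda>u. take (k * L) (drop (L - j) u)"])
    finally show ?thesis .
  qed
  then have "(\<Sum>j<L. rv_entropy \<kappa> (itinerary S g (k * L))) \<le> (\<Sum>j<L. rv_entropy \<kappa> (?Y j))"
    by (intro sum_mono) auto
  then have "rv_entropy \<kappa> (itinerary S g (k * L)) \<le> (\<Sum>j<L. rv_entropy \<kappa> (?Y j)) / L"
    using L_pos by (simp add: field_simps)
  ultimately show ?thesis by linarith
qed

end

section \<open>Coding orbits by block sequences\<close>

lemma space_restrict_borel [simp]: "space (restrict_space borel \<Omega>) = \<Omega>"
  by (simp add: space_restrict_space)

lemma measurable_shift_orbit:
  "shift \<in> measurable (restrict_space borel (orbit_space X T)) (restrict_space borel (orbit_space (X :: 'a::metric_space set) T))"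
  by (intro measurable_restrict_space2 borel_measurable_continuous_on_restrict continuous_on_shift)
     (auto intro: shift_orbit_space)

lemma funpow_shift_orbit: "y \<in> orbit_space X T \<Longrightarrow> (shift ^^ j) y \<in> orbit_space X T"
  by (induction j) (auto intro: shift_orbit_space)

text \<open>A letter of the coding alphabet describes a block of length \<open>L\<close>: a word \<open>w \<in> W\<close>, whose
  representative is shadowed during the first \<open>n\<close> steps, and labels of an \<open>e/2\<close>-net for all \<open>L\<close> steps.
  By expansivity the labels determine the shadowing orbit.\<close>

locale orbit_coding =
  fixes X :: "'a::metric_space set" and T :: "'a \<Rightarrow> 'a set" and e \<epsilon> :: real
    and z :: "nat \<Rightarrow> 'a" and K n L :: nat and W :: "'w::countable set" and rep :: "'w \<Rightarrow> nat \<Rightarrow> 'a"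
  assumes X: "compact X" and corr: "correspondence X T"
    and expansive: "\<And>x y. x \<in> orbit_space X T \<Longrightarrow> y \<in> orbit_space X T \<Longrightarrow> x \<noteq> y \<Longrightarrow> \<exists>j. dist (x j) (y j) > e"
    and net: "\<And>x. x \<in> X \<Longrightarrow> \<exists>c<K. dist x (z c) \<le> e / 2"
    and L_pos: "L > 0" and finW: "finite W" "W \<noteq> {}"
    and shadow: "\<And>ws. set ws \<subseteq> W \<Longrightarrow>
      \<exists>y\<in>orbit_space X T. \<forall>i<length ws. \<forall>j<n. dist (y (i * L + j)) (rep (ws ! i) j) \<le> \<epsilon>"
begin

abbreviation "\<Omega> \<equiv> orbit_space X T"

definition Bt :: "nat set" where
  "Bt = to_nat ` (W \<times> {c :: nat list. set c \<subseteq> {..<K} \<and> length c = L})"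

text \<open>Naturals whose decoded word lies outside \<open>W\<close> get some element of
  \<open>W\<close>, so that \<open>word b \<in> W\<close> holds for all \<open>b\<close>.\<close>

definition word :: "nat \<Rightarrow> 'w" where
  "word b = (let w = fst (from_nat b :: 'w \<times> nat list) in if w \<in> W then w else (SOME w. w \<in> W))"

definition labels :: "nat \<Rightarrow> nat list" where
  "labels b = snd (from_nat b :: 'w \<times> nat list)"

definition follows :: "(nat \<Rightarrow> 'a) \<Rightarrow> nat \<Rightarrow> nat \<Rightarrow> bool" where
  "follows y i b \<longleftrightarrow> (\<forall>j<L. dist (y (i * L + j)) (z (labels b ! j)) \<le> e / 2)
     \<and> (\<forall>j<n. dist (y (i * L + j)) (rep (word b) j) \<le> \<epsilon>)"

text \<open>The orbit is only asked to exist. It follows every initial part of \<open>u\<close> as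
  well, and its image under \<open>shift ^^ L\<close> follows the tail, which makes the language
  closed under factors.\<close>

definition Lang :: "nat list set" where
  "Lang = {u. set u \<subseteq> Bt \<and> (\<exists>y\<in>\<Omega>. \<forall>i<length u. follows y i (u ! i))}"

lemma word_in: "word b \<in> W"
  using finW(2) some_in_eq[of W] by (simp add: word_def Let_def)

lemma word_to_nat [simp]: "w \<in> W \<Longrightarrow> word (to_nat (w, c :: nat list)) = w"
  by (simp add: word_def)

lemma labels_to_nat [simp]: "labels (to_nat (w :: 'w, c :: nat list)) = c"
  by (simp add: labels_def)

lemma follows_shift: "follows ((shift ^^ L) y) i b \<longleftrightarrow> follows y (Suc i) b"
  by (simp add: follows_def shift_funpow ac_simps)

text \<open>Every time lies in some block, where both orbits are within \<open>e / 2\<close> of the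
  same net point; expansivity forbids distinct orbits to stay within \<open>e\<close>
  forever.\<close>

lemma follows_unique:
  assumes "x \<in> \<Omega>" "y \<in> \<Omega>" "\<And>i. follows x i (b i)" "\<And>i. follows y i (b i)"
  shows "x = y"
proof (rule ccontr)
  assume "x \<noteq> y"
  then obtain t where t: "dist (x t) (y t) > e" using expansive assms(1,2) by blast
  define i where "i = t div L"
  define j where "j = t mod L"
  have ij: "t = i * L + j" "j < L" using L_pos by (simp_all add: i_def j_def)
  have "dist (x t) (y t) \<le> dist (x t) (z (labels (b i) ! j)) + dist (y t) (z (labels (b i) ! j))"
    by (rule dist_triangle2)
  also have "\<dots> \<le> e / 2 + e / 2"
    using assms(3,4)[of i] ij by (intro add_mono) (auto simp: follows_def)
  finally show False using t by simp
qed

text \<open>The inequalities in \<open>follows\<close> are not strict, so they pass to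
  limits.\<close>

lemma follows_limit:
  assumes "f \<longlonglongrightarrow> l" "\<forall>\<^sub>F m in sequentially. follows (f m) i b"
  shows "follows l i b"
proof -
  have 1: "dist (l t) a \<le> r" if "\<forall>\<^sub>F m in sequentially. dist (f m t) a \<le> r" for t a r
    by (rule tendsto_upperbound[OF tendsto_dist[OF tendsto_coord[OF assms(1)] tendsto_const] that]) simp
  show ?thesis unfolding follows_def
    by (intro conjI allI impI 1; rule eventually_mono[OF assms(2)]; simp add: follows_def)
qed

section \<open>The coding map\<close>

definition pick :: "nat list \<Rightarrow> nat \<Rightarrow> 'a" where
  "pick u = (SOME y. y \<in> \<Omega> \<and> (\<forall>i<length u. follows y i (u ! i)))"

lemma LangI: "set u \<subseteq> Bt \<Longrightarrow> y \<in> \<Omega> \<Longrightarrow> (\<And>i. i < length u \<Longrightarrow> follows y i (u ! i)) \<Longrightarrow> u \<in> Lang"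
  unfolding Lang_def by blast

lemma LangE:
  assumes "u \<in> Lang"
  obtains y where "set u \<subseteq> Bt" "y \<in> \<Omega>" "\<forall>i<length u. follows y i (u ! i)"
  using assms unfolding Lang_def by blast

lemma pick: "u \<in> Lang \<Longrightarrow> pick u \<in> \<Omega> \<and> (\<forall>i<length u. follows (pick u) i (u ! i))"
proof -
  assume "u \<in> Lang"
  then have "\<exists>y. y \<in> \<Omega> \<and> (\<forall>i<length u. follows y i (u ! i))"
    by (simp add: Lang_def Bex_def)
  then show ?thesis unfolding pick_def by (rule someI_ex)
qed

definition good :: "(nat \<Rightarrow> nat) \<Rightarrow> bool" where
  "good b \<longleftrightarrow> (\<forall>m. prefix m b \<in> Lang)"

text \<open>Every limit point of the picked orbits follows all of \<open>b\<close>, and only one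
  orbit does. Convergence along the whole sequence, instead of a subsequence depending on
  \<open>b\<close>, is what makes \<open>code\<close> measurable.\<close>

lemma pick_limit:
  assumes "good b"
  obtains y where "y \<in> \<Omega>" "\<And>i. follows y i (b i)" "(\<lambda>m. pick (prefix m b)) \<longlonglongrightarrow> y"
proof -
  define f where "f m = pick (prefix m b)" for m
  have f\<Omega>: "f m \<in> \<Omega>" for m using pick assms by (simp add: f_def good_def)
  have ff: "follows (f m) i (b i)" if "i < m" for m i
    using pick[of "prefix m b"] assms that by (auto simp: f_def good_def)
  have cpt: "compact \<Omega>" by (rule compact_orbit_space[OF X corr])
  have lim: "follows l i (b i)" if "strict_mono r" "(f \<circ> r) \<longlonglongrightarrow> l" for l r i
  proof (rule follows_limit[OF that(2)])
    have "follows ((f \<circ> r) m) i (b i)" if "m \<ge> Suc i" for m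
      using ff[of i "r m"] seq_suble[OF \<open>strict_mono r\<close>, of m] that by simp
    then show "\<forall>\<^sub>F m in sequentially. follows ((f \<circ> r) m) i (b i)" by (rule eventually_sequentiallyI)
  qed
  obtain y r where y: "y \<in> \<Omega>" "strict_mono r" "(f \<circ> r) \<longlonglongrightarrow> y"
    using cpt f\<Omega> unfolding compact_def by blast
  have "f \<longlonglongrightarrow> y"
    by (rule compact_unique_limit[OF cpt f\<Omega>]) (rule follows_unique[OF _ y(1) lim lim[OF y(2,3)]])
  then show ?thesis using y lim[OF y(2,3)] by (intro that[of y]) (auto simp: f_def[abs_def])
qed

definition base :: "nat \<Rightarrow> 'a" where "base = (SOME y. y \<in> \<Omega>)"

lemma base: "base \<in> \<Omega>"
proof -
  have "\<exists>y. y \<in> \<Omega>" using shadow[of "[]"] by auto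
  then show ?thesis unfolding base_def by (rule someI_ex)
qed

definition code :: "(nat \<Rightarrow> nat) \<Rightarrow> nat \<Rightarrow> 'a" where
  "code b = (if good b then (THE y. y \<in> \<Omega> \<and> (\<forall>i. follows y i (b i))) else base)"

lemma code_eqI: "good b \<Longrightarrow> y \<in> \<Omega> \<Longrightarrow> (\<And>i. follows y i (b i)) \<Longrightarrow> code b = y"
  unfolding code_def by (auto intro!: the_equality follows_unique)

lemma code_good:
  assumes "good b"
  shows "code b \<in> \<Omega>" "follows (code b) i (b i)" "(\<lambda>m. pick (prefix m b)) \<longlonglongrightarrow> code b"
proof -
  obtain y where y: "y \<in> \<Omega>" "\<And>i. follows y i (b i)" "(\<lambda>m. pick (prefix m b)) \<longlonglongrightarrow> y"
    by (rule pick_limit[OF assms]) blast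
  have "code b = y" by (rule code_eqI[OF assms y(1,2)])
  with y show "code b \<in> \<Omega>" "follows (code b) i (b i)" "(\<lambda>m. pick (prefix m b)) \<longlonglongrightarrow> code b" by auto
qed

lemma code_in: "code b \<in> \<Omega>"
  using code_good(1) base by (cases "good b") (auto simp: code_def)

text \<open>On good sequences \<open>code\<close> is the pointwise limit of maps depending on
  finitely many letters; elsewhere it is constant.\<close>

lemma measurable_code: "code \<in> measurable seq_space (restrict_space borel \<Omega>)"
proof (rule measurable_restrict_space2)
  have good: "{b. good b} \<in> sets seq_space"
  proof -
    have "{b. good b} = (\<Inter>m. {b. prefix m b \<in> Lang})" by (auto simp: good_def)
    also have "\<dots> \<in> sets seq_space"
      using measurable_sets[OF measurable_prefix, of Lang] by (intro sets.countable_INT) (auto simp: vimage_def)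
    finally show ?thesis .
  qed
  define f where "f m b = (if good b then pick (prefix m b) else base)" for m b
  show "code \<in> borel_measurable seq_space"
  proof (rule borel_measurable_LIMSEQ_metric)
    show "f m \<in> borel_measurable seq_space" for m
      unfolding f_def using good
      by (intro measurable_If measurable_compose[OF measurable_prefix]) auto
    show "(\<lambda>m. f m b) \<longlonglongrightarrow> code b" for b
      using code_good(3)[of b] by (cases "good b") (auto simp: f_def code_def)
  qed
qed (auto intro: code_in)

text \<open>An orbit shadowing the words of \<open>w\<close> is annotated at each time, gaps
  included, with a nearby net point; the annotated word lies in \<open>Lang\<close> and projects to
  \<open>w\<close>.\<close>

lemma factorial_lift_Lang:
  assumes "set_pmf p = W"
  shows "factorial_lift Bt Lang word p"
proof
  show "finite Bt" unfolding Bt_def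
    using finW(1) finite_lists_length_eq[of "{..<K}" L] by auto
  show "set u \<subseteq> Bt" if "u \<in> Lang" for u using that by (simp add: Lang_def)
  show "u \<in> Lang" if ub: "u @ [b] \<in> Lang" for u b
  proof -
    obtain y where y: "set (u @ [b]) \<subseteq> Bt" "y \<in> \<Omega>" "\<forall>i<length (u @ [b]). follows y i ((u @ [b]) ! i)"
      by (rule LangE[OF ub])
    show ?thesis
    proof (rule LangI[OF _ y(2)])
      show "set u \<subseteq> Bt" using y(1) by simp
      show "follows y i (u ! i)" if "i < length u" for i using y(3)[rule_format, of i] that by (simp add: nth_append)
    qed
  qed
  show "u \<in> Lang" if bu: "b # u \<in> Lang" for u b
  proof -
    obtain y where y: "set (b # u) \<subseteq> Bt" "y \<in> \<Omega>" "\<forall>i<length (b # u). follows y i ((b # u) ! i)"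
      by (rule LangE[OF bu])
    show ?thesis
    proof (rule LangI[OF _ funpow_shift_orbit[OF y(2)]])
      show "set u \<subseteq> Bt" using y(1) by simp
      show "follows ((shift ^^ L) y) i (u ! i)" if "i < length u" for i
        unfolding follows_shift using y(3)[rule_format, of "Suc i"] that by simp
    qed
  qed
  show "\<exists>u\<in>Lang. map word u = w" if w: "set w \<subseteq> set_pmf p" for w
  proof -
    have wW: "set w \<subseteq> W" using w \<open>set_pmf p = W\<close> by simp
    obtain y where y: "y \<in> \<Omega>" "\<And>i j. i < length w \<Longrightarrow> j < n \<Longrightarrow> dist (y (i * L + j)) (rep (w ! i) j) \<le> \<epsilon>"
      using shadow[OF wW] by blast
    have "\<exists>c<K. dist (y t) (z c) \<le> e / 2" for t
    proof (rule net)
      show "y t \<in> X" using y(1) unfolding orbit_space_def by blast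
    qed
    then obtain c where c: "\<And>t. c t < K" "\<And>t. dist (y t) (z (c t)) \<le> e / 2" by metis
    define u where "u = map (\<lambda>i. to_nat (w ! i, map (\<lambda>j. c (i * L + j)) [0..<L])) [0..<length w]"
    have wi: "w ! i \<in> W" if "i < length w" for i using wW that nth_mem by blast
    have fol: "follows y i (u ! i)" if "i < length u" for i
    proof -
      have i: "i < length w" using that by (simp add: u_def)
      have "u ! i = to_nat (w ! i, map (\<lambda>j. c (i * L + j)) [0..<L])" using i by (simp add: u_def)
      then have "word (u ! i) = w ! i" "labels (u ! i) = map (\<lambda>j. c (i * L + j)) [0..<L]"
        using wi[OF i] by simp_all
      then show ?thesis unfolding follows_def using c(2) y(2)[OF i] by simp
    qed
    have "set u \<subseteq> Bt"
    proof
      fix b assume "b \<in> set u"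
      then obtain i where i: "i < length w" "b = to_nat (w ! i, map (\<lambda>j. c (i * L + j)) [0..<L])"
        unfolding u_def by auto
      have "(w ! i, map (\<lambda>j. c (i * L + j)) [0..<L]) \<in> W \<times> {c. set c \<subseteq> {..<K} \<and> length c = L}"
        using wi[OF i(1)] c(1) by auto
      then show "b \<in> Bt" unfolding Bt_def i(2) by (rule imageI)
    qed
    then have "u \<in> Lang" by (rule LangI[OF _ y(1) fol])
    moreover have "map word u = w" using wi by (intro nth_equalityI) (simp_all add: u_def)
    ultimately show ?thesis by blast
  qed
qed

lemma code_shift: "good b \<Longrightarrow> code (shift b) = (shift ^^ L) (code b)"
proof (rule code_eqI)
  assume g: "good b"
  show "good (shift b)"
    unfolding good_def
  proof
    fix m
    have "prefix (Suc m) b \<in> Lang" using g by (simp add: good_def)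
    then obtain y where y: "set (prefix (Suc m) b) \<subseteq> Bt" "y \<in> \<Omega>"
      "\<forall>i<length (prefix (Suc m) b). follows y i (prefix (Suc m) b ! i)"
      by (rule LangE)
    show "prefix m (shift b) \<in> Lang"
    proof (rule LangI[OF _ funpow_shift_orbit[OF y(2)]])
      show "set (prefix m (shift b)) \<subseteq> Bt" using y(1) by (simp add: prefix_Suc_Cons)
      show "follows ((shift ^^ L) y) i (prefix m (shift b) ! i)" if "i < length (prefix m (shift b))" for i
        unfolding follows_shift using y(3)[rule_format, of "Suc i"] that by (simp add: shift_def)
    qed
  qed
  show "(shift ^^ L) (code b) \<in> \<Omega>" by (rule funpow_shift_orbit[OF code_in])
  show "follows ((shift ^^ L) (code b)) i (shift b i)" for i
    unfolding follows_shift shift_def by (rule code_good(2)[OF g])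
qed

text \<open>One letter stands for \<open>L\<close> steps, so invariance holds for
  \<open>shift ^^ L\<close>. A set invariant under \<open>shift\<close> is invariant under this
  power, hence its preimage under \<open>code\<close> is shift-invariant on good sequences, and the
  zero-one law of \<open>\<theta>\<close> applies.\<close>

lemma coding_measure:
  assumes p: "set_pmf p = W"
  obtains \<theta> where "prob_space \<theta>" "sets \<theta> = sets seq_space"
    "\<And>k. distr \<theta> (count_space UNIV) (\<lambda>b. map word (prefix k b)) = measure_pmf (replicate_pmf k p)"
    "AE b in \<theta>. \<forall>i. \<forall>j<n. dist (code b (i * L + j)) (rep (word (b i)) j) \<le> \<epsilon>"
    "power_mpt (distr \<theta> (restrict_space borel \<Omega>) code) shift L"
    "\<And>A. A \<in> sets (restrict_space borel \<Omega>) \<Longrightarrow> shift -` A \<inter> \<Omega> = A \<Longrightarrow>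
      measure (distr \<theta> (restrict_space borel \<Omega>) code) A = 0 \<or> measure (distr \<theta> (restrict_space borel \<Omega>) code) A = 1"
proof -
  obtain \<theta> where \<theta>: "prob_space \<theta>" "sets \<theta> = sets seq_space" "distr \<theta> \<theta> shift = \<theta>"
    "AE b in \<theta>. \<forall>n. prefix n b \<in> Lang"
    "\<And>n. distr \<theta> (count_space UNIV) (\<lambda>b. map word (prefix n b)) = measure_pmf (replicate_pmf n p)"
    "\<And>A. A \<in> sets \<theta> \<Longrightarrow> AE b in \<theta>. shift b \<in> A \<longleftrightarrow> b \<in> A \<Longrightarrow> measure \<theta> A = 0 \<or> measure \<theta> A = 1"
    by (rule factorial_lift.ergodic_lift[OF factorial_lift_Lang[OF p]]) blast
  interpret \<theta>: prob_space \<theta> by fact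
  let ?OM = "restrict_space borel \<Omega>"
  have sp: "space \<theta> = UNIV" using sets_eq_imp_space_eq[OF \<theta>(2)] by simp
  have code: "code \<in> measurable \<theta> ?OM"
    by (subst measurable_cong_sets[OF \<theta>(2) refl]) (rule measurable_code)
  have sh: "shift \<in> measurable \<theta> \<theta>"
    by (subst measurable_cong_sets[OF \<theta>(2) \<theta>(2)]) (rule measurable_shift)
  have good: "AE b in \<theta>. good b" using \<theta>(4) by eventually_elim (simp add: good_def)
  have fol: "AE b in \<theta>. \<forall>i. \<forall>j<n. dist (code b (i * L + j)) (rep (word (b i)) j) \<le> \<epsilon>"
    using good
  proof eventually_elim
    case (elim b)
    show ?case using code_good(2)[OF elim] unfolding follows_def by blast
  qed
  define \<kappa> where "\<kappa> = distr \<theta> ?OM code"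
  have s\<kappa>: "sets \<kappa> = sets ?OM" "space \<kappa> = \<Omega>" by (simp_all add: \<kappa>_def)
  interpret \<kappa>: prob_space \<kappa> unfolding \<kappa>_def by (rule \<theta>.prob_space_distr[OF code])
  have sm: "shift \<in> measurable ?OM ?OM" by (rule measurable_shift_orbit)
  note smL = measurable_compose_n[OF sm]
  have pm: "power_mpt \<kappa> shift L"
  proof
    show "shift \<in> measurable \<kappa> \<kappa>"
      by (subst measurable_cong_sets[OF s\<kappa>(1) s\<kappa>(1)]) (rule sm)
    show "0 < L" by (rule L_pos)
    have "distr \<kappa> \<kappa> (shift ^^ L) = distr \<kappa> ?OM (shift ^^ L)"
      by (rule distr_cong) (simp_all add: s\<kappa>)
    also have "\<dots> = distr \<theta> ?OM ((shift ^^ L) \<circ> code)"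
      unfolding \<kappa>_def by (rule distr_distr[OF smL code])
    also have "\<dots> = distr \<theta> ?OM (code \<circ> shift)"
    proof (rule distr_cong_AE)
      show "AE b in \<theta>. ((shift ^^ L) \<circ> code) b = (code \<circ> shift) b"
        using good by eventually_elim (simp add: code_shift)
    qed (use measurable_comp[OF code smL] measurable_comp[OF sh code] in auto)
    also have "\<dots> = distr (distr \<theta> \<theta> shift) ?OM code"
      by (rule distr_distr[OF code sh, symmetric])
    also have "\<dots> = \<kappa>" by (simp add: \<theta>(3) \<kappa>_def)
    finally show "distr \<kappa> \<kappa> (shift ^^ L) = \<kappa>" .
  qed
  have erg: "measure \<kappa> A = 0 \<or> measure \<kappa> A = 1" if A: "A \<in> sets ?OM" "shift -` A \<inter> \<Omega> = A" for A
  proof -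
    have inv1: "(shift y \<in> A) = (y \<in> A)" if "y \<in> \<Omega>" for y using A(2) that by blast
    have inv: "((shift ^^ j) y \<in> A) = (y \<in> A)" if "y \<in> \<Omega>" for y j
    proof (induction j)
      case (Suc j)
      then show ?case using inv1[OF funpow_shift_orbit[OF that, of j]] by simp
    qed simp
    have cA: "code -` A \<inter> space \<theta> \<in> sets \<theta>" by (rule measurable_sets[OF code A(1)])
    have "AE b in \<theta>. shift b \<in> code -` A \<inter> space \<theta> \<longleftrightarrow> b \<in> code -` A \<inter> space \<theta>"
      using good by eventually_elim (simp add: sp code_shift inv[OF code_in])
    then have "measure \<theta> (code -` A \<inter> space \<theta>) = 0 \<or> measure \<theta> (code -` A \<inter> space \<theta>) = 1"
      by (rule \<theta>(6)[OF cA])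
    then show ?thesis unfolding \<kappa>_def by (simp only: measure_distr[OF code A(1)])
  qed
  show ?thesis
    by (rule that[OF \<theta>(1,2,5) fol pm[unfolded \<kappa>_def] erg[unfolded \<kappa>_def]])
qed

end

section \<open>Entropy and integrals of the coded measure\<close>

lemma simple_function_if_finite_range:
  "Z \<in> measurable M (count_space UNIV) \<Longrightarrow> finite (Z ` space M) \<Longrightarrow> simple_function M Z"
  by (auto simp: simple_function_def intro: measurable_sets)

lemma law_eq_pmf:
  assumes Z: "Z \<in> measurable M (count_space UNIV)" and d: "distr M (count_space UNIV) Z = measure_pmf p"
  shows "law M Z x = pmf p x"
proof -
  have "pmf p x = measure (distr M (count_space UNIV) Z) {x}" unfolding d by (simp add: pmf.rep_eq)
  also have "\<dots> = law M Z x"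
    by (subst measure_distr[OF Z]) (auto simp: law_def intro!: arg_cong[where f="measure M"])
  finally show ?thesis by simp
qed

lemma simple_function_pmf:
  fixes Z :: "'b \<Rightarrow> 'c::countable"
  assumes M: "prob_space M" and Z: "simple_function M Z"
  obtains p where "distr M (count_space UNIV) Z = measure_pmf p"
proof -
  interpret prob_space M by fact
  have fin: "finite (Z ` space M)" using Z by (simp add: simple_function_def)
  define p where "p = embed_pmf (law M Z)"
  have pmf: "pmf p x = law M Z x" for x
    unfolding p_def
  proof (rule pmf_embed_pmf)
    have "(\<integral>\<^sup>+ x. ennreal (law M Z x) \<partial>count_space UNIV) = (\<Sum>x\<in>Z ` space M. ennreal (law M Z x))"
      using law_outside[of _ Z M] by (intro nn_integral_count_space'[OF fin]) auto
    also have "\<dots> = ennreal (\<Sum>x\<in>Z ` space M. law M Z x)" by (rule sum_ennreal) simp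
    finally show "(\<integral>\<^sup>+ x. ennreal (law M Z x) \<partial>count_space UNIV) = 1"
      by (simp add: sum_law[OF M Z fin])
  qed simp
  have m: "Z \<in> measurable M (count_space UNIV)" by (rule measurable_simple_function[OF Z])
  have "distr M (count_space UNIV) Z = measure_pmf p"
  proof (rule measure_eqI_countable[where A=UNIV])
    fix x
    have "emeasure (distr M (count_space UNIV) Z) {x} = ennreal (law M Z x)"
      by (subst emeasure_distr[OF m]) (auto simp: emeasure_eq_measure law_def intro!: arg_cong[where f="measure M"])
    then show "emeasure (distr M (count_space UNIV) Z) {x} = emeasure (measure_pmf p) {x}"
      by (simp add: emeasure_pmf_single pmf)
  qed (auto simp: sets_measure_pmf)
  then show ?thesis by (rule that)
qed

lemma replicate_pmf_entropy:
  assumes "finite (set_pmf p)"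
  defines "V \<equiv> \<lambda>k. {ws. set ws \<subseteq> set_pmf p \<and> length ws = k}"
  shows "- (\<Sum>ws\<in>V k. pmf (replicate_pmf k p) ws * ln (pmf (replicate_pmf k p) ws))
    = k * - (\<Sum>w\<in>set_pmf p. pmf p w * ln (pmf p w))"
proof (induction k)
  case 0
  have "V 0 = {[]}" by (auto simp: V_def)
  then show ?case by simp
next
  case (Suc k)
  let ?W = "set_pmf p" and ?r = "pmf (replicate_pmf k p)"
  have finV: "finite (V k)" unfolding V_def by (rule finite_lists_length_eq[OF assms(1)])
  have VS: "V (Suc k) = (\<lambda>(x, xs). x # xs) ` (?W \<times> V k)"
    by (auto simp: V_def length_Suc_conv image_iff)
  have inj: "inj (\<lambda>(x, xs). x # xs)" by (auto simp: inj_def)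
  have "replicate_pmf (Suc k) p = map_pmf (\<lambda>(x, xs). x # xs) (pair_pmf p (replicate_pmf k p))"
    by (simp add: pair_pmf_def map_bind_pmf map_pmf_def[symmetric] map_pmf_comp)
  then have pm: "pmf (replicate_pmf (Suc k) p) (x # xs) = pmf p x * ?r xs" for x xs
    using pmf_map_inj'[OF inj, of "pair_pmf p (replicate_pmf k p)" "(x, xs)"] by (simp add: pmf_pair)
  have s1: "(\<Sum>w\<in>?W. pmf p w) = 1" using assms(1) by (intro sum_pmf_eq_1) auto
  have s2: "(\<Sum>ws\<in>V k. ?r ws) = 1"
    using finV by (intro sum_pmf_eq_1) (auto simp: V_def set_replicate_pmf lists_eq_set)
  have ln: "ln (pmf p x * ?r xs) = ln (pmf p x) + ln (?r xs)" if "x \<in> ?W" "xs \<in> V k" for x xs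
  proof -
    have "xs \<in> set_pmf (replicate_pmf k p)" using that(2) by (auto simp: V_def set_replicate_pmf lists_eq_set)
    then show ?thesis using that(1) by (intro ln_mult_pos) (auto simp: pmf_positive)
  qed
  have "(\<Sum>ws\<in>V (Suc k). pmf (replicate_pmf (Suc k) p) ws * ln (pmf (replicate_pmf (Suc k) p) ws))
      = (\<Sum>(x, xs)\<in>?W \<times> V k. pmf p x * ?r xs * ln (pmf p x * ?r xs))"
    unfolding VS by (subst sum.reindex) (auto simp: inj_on_def pm case_prod_beta simp del: replicate_pmf.simps)
  also have "\<dots> = (\<Sum>x\<in>?W. \<Sum>xs\<in>V k. pmf p x * ?r xs * ln (pmf p x * ?r xs))"
    by (rule sum.cartesian_product[symmetric])
  also have "\<dots> = (\<Sum>x\<in>?W. \<Sum>xs\<in>V k. pmf p x * ln (pmf p x) * ?r xs + pmf p x * (?r xs * ln (?r xs)))"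
    by (intro sum.cong refl) (simp add: ln algebra_simps)
  also have "\<dots> = (\<Sum>x\<in>?W. pmf p x * ln (pmf p x) * (\<Sum>xs\<in>V k. ?r xs)) + (\<Sum>x\<in>?W. pmf p x * (\<Sum>xs\<in>V k. ?r xs * ln (?r xs)))"
    by (simp only: sum.distrib sum_distrib_left)
  also have "\<dots> = (\<Sum>x\<in>?W. pmf p x * ln (pmf p x)) + (\<Sum>xs\<in>V k. ?r xs * ln (?r xs))"
    by (simp only: s1 s2 sum_distrib_right[symmetric] mult_1 mult_1_right)
  finally show ?case using Suc by (simp add: algebra_simps)
qed

lemma map_nth_replicate_pmf: "map_pmf (\<lambda>ws. ws ! i) (replicate_pmf (Suc i) p) = p"
proof -
  have "map_pmf (\<lambda>ws. ws ! i) (replicate_pmf (Suc i) p) = map_pmf (hd \<circ> (\<lambda>ws. take 1 (drop i ws))) (replicate_pmf (Suc i) p)"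
    by (intro pmf.map_cong0) (auto simp: set_replicate_pmf hd_drop_conv_nth simp del: replicate_pmf.simps)
  also have "\<dots> = map_pmf hd (replicate_pmf 1 p)"
    using map_take_drop_replicate_pmf[of i 1 "Suc i" p] by (simp only: pmf.map_comp[symmetric])
  also have "\<dots> = p" unfolding replicate_pmf_1 by (simp add: map_pmf_comp)
  finally show ?thesis .
qed

lemma (in prob_space) integral_close:
  fixes f g :: "'a \<Rightarrow> real"
  assumes "integrable M f" "integrable M g" "AE x in M. \<bar>f x - g x\<bar> \<le> \<tau>"
  shows "\<bar>(\<integral>x. f x \<partial>M) - (\<integral>x. g x \<partial>M)\<bar> \<le> \<tau>"
proof -
  have "(\<integral>x. f x \<partial>M) - (\<integral>x. g x \<partial>M) = (\<integral>x. f x - g x \<partial>M)" using assms by simp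
  also have "\<bar>\<dots>\<bar> \<le> (\<integral>x. \<bar>f x - g x\<bar> \<partial>M)" by (rule integral_abs_bound)
  also have "\<dots> \<le> (\<integral>x. \<tau> \<partial>M)" using assms by (intro integral_mono_AE) auto
  finally show ?thesis by (simp add: prob_space)
qed

section \<open>Entropy of the coded measure\<close>

context orbit_coding
begin

lemma measurable_word_prefix:
  assumes "sets \<theta> = sets seq_space"
  shows "(\<lambda>b. map word (prefix k b)) \<in> measurable \<theta> (count_space UNIV)"
    and "(\<lambda>b. word (b i)) \<in> measurable \<theta> (count_space UNIV)"
  by (subst measurable_cong_sets[OF assms refl], rule measurable_compose[OF measurable_prefix], simp)
     (subst measurable_cong_sets[OF assms refl], rule measurable_compose[OF component_measurable], simp)

lemma distr_word:
  assumes s: "sets \<theta> = sets seq_space"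
    and marg: "\<And>k. distr \<theta> (count_space UNIV) (\<lambda>b. map word (prefix k b)) = measure_pmf (replicate_pmf k p)"
  shows "distr \<theta> (count_space UNIV) (\<lambda>b. word (b i)) = measure_pmf p"
proof -
  have "distr \<theta> (count_space UNIV) (\<lambda>b. word (b i))
      = distr \<theta> (count_space UNIV) ((\<lambda>ws. ws ! i) \<circ> (\<lambda>b. map word (prefix (Suc i) b)))"
    by (simp add: comp_def)
  also have "\<dots> = distr (distr \<theta> (count_space UNIV) (\<lambda>b. map word (prefix (Suc i) b))) (count_space UNIV) (\<lambda>ws. ws ! i)"
    by (rule distr_distr[symmetric]) (simp_all add: measurable_word_prefix[OF s])
  also have "\<dots> = measure_pmf (map_pmf (\<lambda>ws. ws ! i) (replicate_pmf (Suc i) p))"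
    unfolding marg map_pmf_rep_eq ..
  finally show ?thesis unfolding map_nth_replicate_pmf .
qed

text \<open>The letters are read off the orbit by \<open>D\<close> at the times
  \<open>i * L + j\<close> with \<open>j < n\<close>; observing the gaps can only add information. A
  letter below \<open>K0\<close> is recovered exactly, and the others are errors of probability at
  most \<open>q\<close>. By \<open>inj\<close> the letters determine the words, and independence
  makes the entropy of \<open>k\<close> words \<open>k\<close> times that of
  \<open>p\<close>.\<close>

lemma coded_entropy_ge:
  fixes letter :: "'w \<Rightarrow> nat \<Rightarrow> nat" and D :: "'a \<Rightarrow> nat"
  assumes \<theta>: "prob_space \<theta>" "sets \<theta> = sets seq_space"
    and p: "set_pmf p = W"
    and marg: "\<And>k. distr \<theta> (count_space UNIV) (\<lambda>b. map word (prefix k b)) = measure_pmf (replicate_pmf k p)"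
    and fol: "AE b in \<theta>. \<forall>i. \<forall>j<n. dist (code b (i * L + j)) (rep (word (b i)) j) \<le> \<epsilon>"
    and n: "n > 0" "n \<le> L"
    and letter: "\<And>w j. w \<in> W \<Longrightarrow> j < n \<Longrightarrow> letter w j < c"
    and inj: "\<And>w w'. w \<in> W \<Longrightarrow> w' \<in> W \<Longrightarrow> (\<And>j. j < n \<Longrightarrow> letter w j = letter w' j) \<Longrightarrow> w = w'"
    and D: "D \<in> measurable borel (count_space UNIV)" "\<And>x. D x \<le> K0"
    and guess: "\<And>w j x. w \<in> W \<Longrightarrow> j < n \<Longrightarrow> letter w j < K0 \<Longrightarrow> dist x (rep w j) \<le> \<epsilon> \<Longrightarrow> D x = letter w j"
    and q: "0 < q" "q < 1" and err: "\<And>j. j < n \<Longrightarrow> measure p {w. K0 \<le> letter w j} \<le> q"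
  shows "real k * (- (\<Sum>w\<in>W. pmf p w * ln (pmf p w)))
    \<le> rv_entropy (distr \<theta> (restrict_space borel \<Omega>) code) (itinerary shift (\<lambda>y. D (y 0)) (k * L))
      + real (k * n) * fano_bound c q"
proof -
  interpret \<theta>: prob_space \<theta> by fact
  have sp: "space \<theta> = UNIV" using sets_eq_imp_space_eq[OF \<theta>(2)] by simp
  have code: "code \<in> measurable \<theta> (restrict_space borel \<Omega>)"
    by (subst measurable_cong_sets[OF \<theta>(2) refl]) (rule measurable_code)
  let ?g = "\<lambda>y :: nat \<Rightarrow> 'a. D (y 0)"
  let ?it = "itinerary shift ?g (k * L)"
  have it_eq: "?it y = map (\<lambda>t. D (y t)) [0..<k * L]" for y
    unfolding itinerary_def by (rule map_cong[OF refl]) (simp only: shift_funpow add_0)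
  have coord: "(\<lambda>y. y t) \<in> measurable (restrict_space borel \<Omega>) borel" for t :: nat
    by (rule borel_measurable_continuous_on_restrict[OF continuous_on_coord])
  have it: "simple_function (restrict_space borel \<Omega>) ?it"
    unfolding it_eq[abs_def]
  proof (intro simple_function_map_upt simple_function_if_finite_range)
    fix t
    show "(\<lambda>y. D (y t)) \<in> measurable (restrict_space borel \<Omega>) (count_space UNIV)"
      by (rule measurable_compose[OF coord D(1)])
    show "finite ((\<lambda>y. D (y t)) ` space (restrict_space borel \<Omega>))"
      by (rule finite_subset[of _ "{..K0}"]) (use D(2) in blast, simp)
  qed
  define Y where "Y b = ?it (code b)" for b
  have Y: "simple_function \<theta> Y" unfolding Y_def by (rule simple_function_comp_measurable[OF code it])
  \<comment> \<open>The letters of all words in one list: position \<open>l\<close> is place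
    \<open>l mod n\<close> of word \<open>l div n\<close>. Because of the gaps its time in the orbit
    is \<open>l div n * L + l mod n\<close>.\<close>
  define Xl where "Xl l b = letter (word (b (l div n))) (l mod n)" for l b
  have Xl_m: "Xl l \<in> measurable \<theta> (count_space UNIV)" for l
    unfolding Xl_def by (rule measurable_compose[OF measurable_word_prefix(2)[OF \<theta>(2)]]) simp
  have Xl_range: "Xl l ` space \<theta> \<subseteq> {..<c}" for l
  proof
    fix x assume "x \<in> Xl l ` space \<theta>"
    then obtain b where "x = letter (word (b (l div n))) (l mod n)" unfolding Xl_def by blast
    then show "x \<in> {..<c}" using letter[OF word_in] n(1) by simp
  qed
  have Xl: "simple_function \<theta> (Xl l)" for l
    by (rule simple_function_if_finite_range[OF Xl_m finite_subset[OF Xl_range]]) simp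
  have "rv_entropy \<theta> (\<lambda>b. map (\<lambda>l. Xl l b) [0..<k * n]) \<le> rv_entropy \<theta> Y + real (k * n) * fano_bound c q"
  proof (rule fano_list[OF \<theta>(1) Xl Y q])
    fix l assume l: "l < k * n"
    show "card (Xl l ` space \<theta>) \<le> c"
      using card_mono[OF _ Xl_range[of l]] by simp
    define i where "i = l div n"
    define j where "j = l mod n"
    have j: "j < n" using n(1) by (simp add: j_def)
    have i: "i < k" using l n(1) by (simp add: i_def less_mult_imp_div_less)
    have t: "i * L + j < k * L"
    proof -
      have "i * L + j < Suc i * L" using j n(2) by simp
      also have "\<dots> \<le> k * L" using i by (intro mult_right_mono) auto
      finally show ?thesis .
    qed
    have Ym: "Y b ! (i * L + j) = D (code b (i * L + j))" for b
      unfolding Y_def it_eq using t by simp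
    let ?B = "{b. K0 \<le> letter (word (b i)) j}"
    have B: "?B \<in> sets \<theta>"
      using measurable_sets[OF measurable_word_prefix(2)[OF \<theta>(2)], of "{w. K0 \<le> letter w j}" i]
      by (simp add: sp vimage_def)
    have "measure \<theta> {b \<in> space \<theta>. Xl l b \<noteq> Y b ! (i * L + j)} \<le> measure \<theta> ?B"
    proof (rule \<theta>.finite_measure_mono_AE[OF _ B])
      show "AE b in \<theta>. b \<in> {b \<in> space \<theta>. Xl l b \<noteq> Y b ! (i * L + j)} \<longrightarrow> b \<in> ?B"
        using fol
      proof eventually_elim
        case (elim b)
        have "Y b ! (i * L + j) = letter (word (b i)) j" if "letter (word (b i)) j < K0"
        proof -
          have "dist (code b (i * L + j)) (rep (word (b i)) j) \<le> \<epsilon>" using elim j by blast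
          then show ?thesis unfolding Ym by (rule guess[OF word_in j that])
        qed
        then show ?case unfolding Xl_def i_def[symmetric] j_def[symmetric]
          by (cases "letter (word (b i)) j < K0") simp_all
      qed
    qed
    also have "\<dots> = measure (distr \<theta> (count_space UNIV) (\<lambda>b. word (b i))) {w. K0 \<le> letter w j}"
      by (subst measure_distr[OF measurable_word_prefix(2)[OF \<theta>(2)]]) (simp_all add: sp vimage_def)
    also have "\<dots> \<le> q" unfolding distr_word[OF \<theta>(2) marg] by (rule err[OF j])
    finally show "measure \<theta> {b \<in> space \<theta>. Xl l b \<noteq> Y b ! (l div n * L + l mod n)} \<le> q"
      by (simp only: i_def j_def)
  qed
  moreover have "rv_entropy \<theta> (\<lambda>b. map word (prefix k b)) \<le> rv_entropy \<theta> (\<lambda>b. map (\<lambda>l. Xl l b) [0..<k * n])"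
  proof -
    define dec where "dec xs = map (\<lambda>i. SOME w. w \<in> W \<and> (\<forall>j<n. letter w j = xs ! (i * n + j))) [0..<k]" for xs
    have "map word (prefix k b) = dec (map (\<lambda>l. Xl l b) [0..<k * n])" for b
    proof (rule nth_equalityI)
      fix i assume "i < length (map word (prefix k b))"
      then have i: "i < k" by simp
      have Xv: "map (\<lambda>l. Xl l b) [0..<k * n] ! (i * n + j) = letter (word (b i)) j" if "j < n" for j
      proof -
        have "i * n + j < Suc i * n" using that by simp
        also have "\<dots> \<le> k * n" using i by (intro mult_right_mono) auto
        finally have "i * n + j < k * n" .
        then show ?thesis using that by (simp add: Xl_def)
      qed
      have "(SOME w. w \<in> W \<and> (\<forall>j<n. letter w j = map (\<lambda>l. Xl l b) [0..<k * n] ! (i * n + j))) = word (b i)"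
      proof (rule some_equality)
        show "word (b i) \<in> W \<and> (\<forall>j<n. letter (word (b i)) j = map (\<lambda>l. Xl l b) [0..<k * n] ! (i * n + j))"
          by (intro conjI allI impI word_in Xv[symmetric])
        fix w assume w: "w \<in> W \<and> (\<forall>j<n. letter w j = map (\<lambda>l. Xl l b) [0..<k * n] ! (i * n + j))"
        have "letter w j = letter (word (b i)) j" if "j < n" for j
          using w that unfolding Xv[OF that, symmetric] by blast
        then show "w = word (b i)" using w word_in by (intro inj) simp_all
      qed
      then show "map word (prefix k b) ! i = dec (map (\<lambda>l. Xl l b) [0..<k * n]) ! i"
        using i by (simp add: dec_def)
    qed (simp add: dec_def)
    then have "rv_entropy \<theta> (\<lambda>b. map word (prefix k b)) = rv_entropy \<theta> (\<lambda>b. dec (map (\<lambda>l. Xl l b) [0..<k * n]))"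
      by (intro rv_entropy_cong)
    also have "\<dots> \<le> rv_entropy \<theta> (\<lambda>b. map (\<lambda>l. Xl l b) [0..<k * n])"
      by (rule rv_entropy_comp_le[OF \<theta>(1) simple_function_map_upt[OF Xl]])
    finally show ?thesis .
  qed
  moreover have "rv_entropy \<theta> (\<lambda>b. map word (prefix k b)) = real k * (- (\<Sum>w\<in>W. pmf p w * ln (pmf p w)))"
  proof -
    let ?V = "{ws. set ws \<subseteq> W \<and> length ws = k}"
    have "rv_entropy \<theta> (\<lambda>b. map word (prefix k b))
        = - (\<Sum>ws\<in>?V. pmf (replicate_pmf k p) ws * ln (pmf (replicate_pmf k p) ws))"
      unfolding law_eq_pmf[OF measurable_word_prefix(1)[OF \<theta>(2)] marg, symmetric]
      using finite_lists_length_eq[OF finW(1), of k] word_in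
      by (intro rv_entropy_superset) auto
    then show ?thesis using replicate_pmf_entropy[of p k] finW(1) by (simp only: p)
  qed
  moreover have "rv_entropy (distr \<theta> (restrict_space borel \<Omega>) code) ?it = rv_entropy \<theta> Y"
    unfolding Y_def by (rule rv_entropy_distr[OF code it])
  ultimately show ?thesis by linarith
qed

end

lemma finite_uniform_continuity:
  fixes \<Phi> :: "('b::metric_space \<Rightarrow> real) set"
  assumes "compact K" "finite \<Phi>" "\<And>f. f \<in> \<Phi> \<Longrightarrow> continuous_on K f" "\<tau> > 0"
  shows "\<exists>d>0. \<forall>f\<in>\<Phi>. \<forall>u\<in>K. \<forall>v\<in>K. dist u v < d \<longrightarrow> \<bar>f u - f v\<bar> < \<tau>"
  using assms(2,3)
proof (induction \<Phi> rule: finite_induct)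
  case empty
  show ?case by (intro exI[of _ 1]) simp
next
  case (insert f \<Phi>)
  then obtain d where d: "d > 0" "\<forall>f\<in>\<Phi>. \<forall>u\<in>K. \<forall>v\<in>K. dist u v < d \<longrightarrow> \<bar>f u - f v\<bar> < \<tau>" by auto
  have "uniformly_continuous_on K f" using insert.prems assms(1) by (intro compact_uniformly_continuous) auto
  then obtain d' where d': "d' > 0" "\<forall>u\<in>K. \<forall>v\<in>K. dist v u < d' \<longrightarrow> dist (f v) (f u) < \<tau>"
    using assms(4) unfolding uniformly_continuous_on_def by blast
  show ?case
  proof (intro exI[of _ "min d d'"] conjI ballI impI)
    fix h u v assume "h \<in> insert f \<Phi>" "u \<in> K" "v \<in> K" "dist u v < min d d'"
    then show "\<bar>h u - h v\<bar> < \<tau>" using d(2) d'(2) by (auto simp: dist_real_def)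
  qed (use d d' in simp)
qed

lemma finite_uniform_bound:
  fixes \<Phi> :: "('b::metric_space \<Rightarrow> real) set"
  assumes "compact K" "finite \<Phi>" "\<And>f. f \<in> \<Phi> \<Longrightarrow> continuous_on K f"
  shows "\<exists>B\<ge>0. \<forall>f\<in>\<Phi>. \<forall>u\<in>K. \<bar>f u\<bar> \<le> B"
  using assms(2,3)
proof (induction \<Phi> rule: finite_induct)
  case empty
  show ?case by (intro exI[of _ 0]) simp
next
  case (insert f \<Phi>)
  then obtain B where B: "B \<ge> 0" "\<forall>f\<in>\<Phi>. \<forall>u\<in>K. \<bar>f u\<bar> \<le> B" by auto
  have "bounded (f ` K)" using insert.prems assms(1) by (intro compact_imp_bounded compact_continuous_image) auto
  then obtain B' where B': "\<forall>u\<in>K. \<bar>f u\<bar> \<le> B'" by (auto simp: bounded_iff)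
  show ?case
  proof (intro exI[of _ "max B B'"] conjI ballI)
    fix h u assume "h \<in> insert f \<Phi>" "u \<in> K"
    then show "\<bar>h u\<bar> \<le> max B B'" using B(2) B' by fastforce
  qed (use B in simp)
qed

lemma measurable_coord_orbit:
  "(\<lambda>y. y j) \<in> measurable (restrict_space borel \<Omega>) (borel :: 'a::topological_space measure)" for j :: nat
  by (rule borel_measurable_continuous_on_restrict[OF continuous_on_coord])

lemma measurable_proj2_orbit:
  "proj2 \<in> measurable (restrict_space borel (orbit_space X T)) (restrict_space borel (corr_graph (X :: 'a::metric_space set) T))"
  by (intro measurable_restrict_space2 borel_measurable_continuous_on_restrict continuous_on_proj2)
     (auto intro: proj2_orbit_space)

lemma invariant_measures_mpt:
  fixes X :: "'a::metric_space set"
  assumes "\<nu> \<in> invariant_measures (orbit_space X T) shift"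
  shows "prob_space \<nu>" "sets \<nu> = sets (restrict_space borel (orbit_space X T))" "mpt \<nu> shift"
proof -
  show p: "prob_space \<nu>" and s: "sets \<nu> = sets (restrict_space borel (orbit_space X T))"
    using assms by (auto simp: invariant_measures_def borel_prob_measures_def)
  have "shift \<in> measurable \<nu> \<nu>" by (subst measurable_cong_sets[OF s s]) (rule measurable_shift_orbit)
  then show "mpt \<nu> shift"
    using p assms by (auto simp: mpt_def mpt_axioms_def invariant_measures_def)
qed

lemma simple_function_letter:
  fixes X :: "'a::metric_space set" and rl :: "'a \<Rightarrow> nat"
  assumes s: "sets \<nu> = sets (restrict_space borel (orbit_space X T))"
    and rl: "rl \<in> measurable borel (count_space UNIV)" "\<And>x. x \<in> X \<Longrightarrow> rl x < c"
  shows "simple_function \<nu> (\<lambda>y. rl (y 0))"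
proof (rule simple_function_if_finite_range)
  show "(\<lambda>y. rl (y 0)) \<in> measurable \<nu> (count_space UNIV)"
    by (subst measurable_cong_sets[OF s refl]) (rule measurable_compose[OF measurable_coord_orbit rl(1)])
  have "space \<nu> = orbit_space X T" using sets_eq_imp_space_eq[OF s] by simp
  then have "(\<lambda>y. rl (y 0)) ` space \<nu> \<subseteq> {..<c}" using rl(2) by (auto simp: orbit_space_def)
  then show "finite ((\<lambda>y. rl (y 0)) ` space \<nu>)" by (rule finite_subset) simp
qed

text \<open>Cells have diameter at most \<open>e\<close>, so equal itineraries of length
  \<open>m\<close> mean orbits within \<open>e\<close> for \<open>m\<close> steps, and uniform
  expansivity turns this into closeness in the orbit space. The itineraries thus name points as
  finely as the generator lemma needs.\<close>

lemma KS_entropy_le_letters: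
  fixes X :: "'a::metric_space set" and rl :: "'a \<Rightarrow> nat"
  assumes X: "compact X" "correspondence X T"
    and exp: "\<And>x y. x \<in> orbit_space X T \<Longrightarrow> y \<in> orbit_space X T \<Longrightarrow> x \<noteq> y \<Longrightarrow> \<exists>j. dist (x j) (y j) > e"
    and \<nu>: "\<nu> \<in> invariant_measures (orbit_space X T) shift"
    and rl: "rl \<in> measurable borel (count_space UNIV)" "\<And>x. x \<in> X \<Longrightarrow> rl x < c"
    and cells: "\<And>x y. x \<in> X \<Longrightarrow> y \<in> X \<Longrightarrow> rl x = rl y \<Longrightarrow> dist x y \<le> e"
  shows "KS_entropy \<nu> shift \<le> ereal (entropy_rate \<nu> shift (\<lambda>y. rl (y 0)))"
proof (rule mpt.KS_entropy_le_generator)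
  note inv = invariant_measures_mpt[OF \<nu>]
  show "mpt \<nu> shift" by (rule inv(3))
  show "simple_function \<nu> (\<lambda>y. rl (y 0))" by (rule simple_function_letter[OF inv(2) rl])
  fix f :: "(nat \<Rightarrow> 'a) \<Rightarrow> (nat \<Rightarrow> 'a) set" and q :: real
  assume f: "simple_function \<nu> f" and q: "0 < q"
  have cpt: "compact (orbit_space X T)" by (rule compact_orbit_space[OF X])
  show "\<exists>m \<psi>. measure \<nu> {y \<in> space \<nu>. f y \<noteq> \<psi> (itinerary shift (\<lambda>y. rl (y 0)) m y)} \<le> q"
  proof (rule simple_function_from_fine_names[OF inv(1,2) cpt _ f q])
    fix \<delta> :: real assume "\<delta> > 0"
    then obtain m where m: "\<And>x y. x \<in> orbit_space X T \<Longrightarrow> y \<in> orbit_space X T \<Longrightarrow>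
        (\<And>j. j < m \<Longrightarrow> dist (x j) (y j) \<le> e) \<Longrightarrow> dist x y < \<delta>"
      using uniform_expansivity[OF cpt exp] by metis
    have "dist x y < \<delta>" if xy: "x \<in> orbit_space X T" "y \<in> orbit_space X T"
      "itinerary shift (\<lambda>y. rl (y 0)) m x = itinerary shift (\<lambda>y. rl (y 0)) m y" for x y
    proof (rule m[OF xy(1,2)])
      fix j assume "j < m"
      then have "rl (x j) = rl (y j)"
        using xy(3) unfolding itinerary_eq_iff by (simp only: shift_funpow add_0)
      then show "dist (x j) (y j) \<le> e"
        using xy(1,2) by (intro cells) (auto simp: orbit_space_def)
    qed
    then show "\<exists>m. \<forall>x\<in>orbit_space X T. \<forall>y\<in>orbit_space X T.
        itinerary shift (\<lambda>y. rl (y 0)) m x = itinerary shift (\<lambda>y. rl (y 0)) m y \<longrightarrow> dist x y < \<delta>"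
      by blast
  qed
qed

section \<open>Integrals under the coded measure\<close>

context orbit_coding
begin

text \<open>There are two errors of \<open>\<tau>\<close>: the coded orbit stays within
  \<open>d\<close> of the representative of its first word, and that representative within
  \<open>d\<close> of every orbit with the same name. In between, the word of block \<open>0\<close>
  under \<open>\<theta>\<close> and the name under \<open>\<nu>\<close> have the same law
  \<open>p\<close>. \<open>Suc j < n\<close> keeps both coordinates inside the shadowed
  part.\<close>

lemma coded_integral:
  fixes \<phi> :: "'a \<times> 'a \<Rightarrow> real" and nm :: "(nat \<Rightarrow> 'a) \<Rightarrow> 'w"
  assumes \<theta>: "prob_space \<theta>" "sets \<theta> = sets seq_space"
    and p: "set_pmf p = W"
    and marg: "\<And>k. distr \<theta> (count_space UNIV) (\<lambda>b. map word (prefix k b)) = measure_pmf (replicate_pmf k p)"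
    and fol: "AE b in \<theta>. \<forall>i. \<forall>j<n. dist (code b (i * L + j)) (rep (word (b i)) j) \<le> \<epsilon>"
    and \<nu>: "prob_space \<nu>" "sets \<nu> = sets (restrict_space borel \<Omega>)"
    and nm: "nm \<in> measurable \<nu> (count_space UNIV)" "distr \<nu> (count_space UNIV) nm = measure_pmf p"
    and rep: "\<And>w. w \<in> W \<Longrightarrow> rep w \<in> \<Omega>"
    and near: "\<And>y i. y \<in> \<Omega> \<Longrightarrow> nm y \<in> W \<Longrightarrow> i < n \<Longrightarrow> dist (rep (nm y) i) (y i) \<le> d"
    and \<epsilon>: "\<epsilon> \<le> d" and j: "Suc j < n"
    and \<phi>: "continuous_on (corr_graph X T) \<phi>" "\<And>u. u \<in> corr_graph X T \<Longrightarrow> \<bar>\<phi> u\<bar> \<le> B"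
      "\<And>a b a' b'. (a, b) \<in> corr_graph X T \<Longrightarrow> (a', b') \<in> corr_graph X T \<Longrightarrow> dist a a' \<le> d \<Longrightarrow> dist b b' \<le> d
        \<Longrightarrow> \<bar>\<phi> (a, b) - \<phi> (a', b')\<bar> \<le> \<tau>"
  shows "\<bar>(\<integral>y. \<phi> (y j, y (Suc j)) \<partial>distr \<theta> (restrict_space borel \<Omega>) code) - (\<integral>y. \<phi> (y j, y (Suc j)) \<partial>\<nu>)\<bar> \<le> 2 * \<tau>"
proof -
  interpret \<theta>: prob_space \<theta> by fact
  interpret \<nu>: prob_space \<nu> by fact
  have sp: "space \<nu> = \<Omega>" using sets_eq_imp_space_eq[OF \<nu>(2)] by simp
  have code: "code \<in> measurable \<theta> (restrict_space borel \<Omega>)"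
    by (subst measurable_cong_sets[OF \<theta>(2) refl]) (rule measurable_code)
  have graph: "(y j, y (Suc j)) \<in> corr_graph X T" if "y \<in> \<Omega>" for y
    using that by (simp add: orbit_space_eq)
  define F where "F y = \<phi> (y j, y (Suc j))" for y
  have F_meas: "F \<in> borel_measurable (restrict_space borel \<Omega>)"
    unfolding F_def
  proof (rule borel_measurable_continuous_on_restrict)
    show "continuous_on \<Omega> (\<lambda>y. \<phi> (y j, y (Suc j)))"
      by (rule continuous_on_compose2[OF \<phi>(1) continuous_on_Pair[OF continuous_on_coord continuous_on_coord]])
         (use graph in blast)
  qed
  have F\<nu>: "F \<in> borel_measurable \<nu>" by (subst measurable_cong_sets[OF \<nu>(2) refl]) (rule F_meas)
  have FB: "\<bar>F y\<bar> \<le> B" if "y \<in> \<Omega>" for y unfolding F_def by (rule \<phi>(2)[OF graph[OF that]])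
  \<comment> \<open>Off \<open>W\<close> nothing is known of \<open>rep\<close>, and the value
    \<open>0\<close> keeps \<open>R\<close> bounded; such names have probability zero.\<close>
  define R where "R w = (if w \<in> W then F (rep w) else 0)" for w
  have B0: "0 \<le> B" using FB[OF base] abs_ge_zero order_trans by blast
  have RB: "\<bar>R w\<bar> \<le> B" for w using FB[OF rep] B0 by (simp add: R_def)
  note wm = measurable_word_prefix(2)[OF \<theta>(2), of 0]
  have "\<bar>(\<integral>b. F (code b) \<partial>\<theta>) - (\<integral>b. R (word (b 0)) \<partial>\<theta>)\<bar> \<le> \<tau>"
  proof (rule \<theta>.integral_close)
    show "integrable \<theta> (\<lambda>b. F (code b))"
      by (rule \<theta>.integrable_const_bound[where B=B, OF _ measurable_compose[OF code F_meas]])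
         (simp add: FB[OF code_in])
    show "integrable \<theta> (\<lambda>b. R (word (b 0)))"
      by (rule \<theta>.integrable_const_bound[where B=B, OF _ measurable_compose[OF wm]]) (simp_all add: RB)
    show "AE b in \<theta>. \<bar>F (code b) - R (word (b 0))\<bar> \<le> \<tau>"
      using fol
    proof eventually_elim
      case (elim b)
      have *: "dist (code b i) (rep (word (b 0)) i) \<le> d" if "i < n" for i
        using elim[rule_format, of i 0] that \<epsilon> by simp
      have "\<bar>F (code b) - F (rep (word (b 0)))\<bar> \<le> \<tau>"
        unfolding F_def using j by (intro \<phi>(3) graph code_in rep word_in *) auto
      then show ?case by (simp add: R_def word_in)
    qed
  qed
  moreover have "\<bar>(\<integral>y. R (nm y) \<partial>\<nu>) - (\<integral>y. F y \<partial>\<nu>)\<bar> \<le> \<tau>"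
  proof (rule \<nu>.integral_close)
    show "integrable \<nu> F"
      by (rule \<nu>.integrable_const_bound[where B=B, OF _ F\<nu>]) (auto intro!: AE_I2 FB simp: sp)
    show "integrable \<nu> (\<lambda>y. R (nm y))"
      by (rule \<nu>.integrable_const_bound[where B=B, OF _ measurable_compose[OF nm(1)]]) (simp_all add: RB)
    have "AE w in distr \<nu> (count_space UNIV) nm. w \<in> W"
      unfolding nm(2) by (simp add: AE_measure_pmf_iff p)
    then have "AE y in \<nu>. nm y \<in> W" by (subst (asm) AE_distr_iff[OF nm(1)]) auto
    with AE_space show "AE y in \<nu>. \<bar>R (nm y) - F y\<bar> \<le> \<tau>"
    proof eventually_elim
      case (elim y)
      then have y: "y \<in> \<Omega>" "nm y \<in> W" by (simp_all add: sp)
      have "\<bar>F (rep (nm y)) - F y\<bar> \<le> \<tau>"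
        unfolding F_def using j y by (intro \<phi>(3) graph rep near) auto
      then show ?case using y by (simp add: R_def)
    qed
  qed
  moreover have "(\<integral>b. R (word (b 0)) \<partial>\<theta>) = (\<integral>y. R (nm y) \<partial>\<nu>)"
  proof -
    have "(\<integral>b. R (word (b 0)) \<partial>\<theta>) = (\<integral>w. R w \<partial>distr \<theta> (count_space UNIV) (\<lambda>b. word (b 0)))"
      by (rule integral_distr[OF wm, symmetric]) simp
    also have "\<dots> = (\<integral>w. R w \<partial>distr \<nu> (count_space UNIV) nm)"
      by (simp only: distr_word[OF \<theta>(2) marg] nm(2))
    also have "\<dots> = (\<integral>y. R (nm y) \<partial>\<nu>)"
      by (rule integral_distr[OF nm(1)]) simp
    finally show ?thesis .
  qed
  moreover have "(\<integral>y. F y \<partial>distr \<theta> (restrict_space borel \<Omega>) code) = (\<integral>b. F (code b) \<partial>\<theta>)"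
    by (rule integral_distr[OF code F_meas])
  ultimately have "\<bar>(\<integral>y. F y \<partial>distr \<theta> (restrict_space borel \<Omega>) code) - (\<integral>y. F y \<partial>\<nu>)\<bar> \<le> 2 * \<tau>"
    by linarith
  then show ?thesis by (simp only: F_def)
qed

end

section \<open>Letters and words\<close>

text \<open>Equal lengths and equal spacing give all words the common period
  \<open>n + M + 1\<close>. A segment of \<open>n\<close> points has last index
  \<open>n - 1\<close>, so consecutive segments leave \<open>M + 1 > M\<close> free times.
  \<open>M\<close> does not depend on \<open>n\<close>, which can therefore be chosen after
  it.\<close>

lemma specification_words:
  fixes X :: "'a::metric_space set"
  assumes sp: "specification_property X T" and "\<epsilon> > 0" and ne: "orbit_space X T \<noteq> {}"
  obtains M where "\<And>n xs. n > 0 \<Longrightarrow> set xs \<subseteq> orbit_space X T \<Longrightarrow>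
    \<exists>y\<in>orbit_space X T. \<forall>i<length xs. \<forall>j<n. dist (y (i * (n + M + 1) + j)) ((xs ! i) j) \<le> \<epsilon>"
proof -
  from sp[unfolded specification_property_def, THEN spec, THEN mp, OF \<open>\<epsilon> > 0\<close>]
  obtain M :: nat where M: "\<forall>(k::nat) (n::nat \<Rightarrow> nat) (x::nat \<Rightarrow> nat \<Rightarrow> 'a) (a::nat \<Rightarrow> int).
        k \<ge> 1 \<longrightarrow>
        (\<forall>i\<in>{1..k}. orbit_segment X T (n i) (x i)) \<longrightarrow>
        a 1 = 0 \<longrightarrow>
        (\<forall>i\<in>{1..<k}. a i < a (i + 1)) \<longrightarrow>
        (\<forall>i\<in>{1..<k}. a (i + 1) - (a i + int (n i) + 1) > int M) \<longrightarrow>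
        (\<exists>y \<in> orbit_space X T. \<forall>i\<in>{1..k}. \<forall>j\<le>n i.
           dist (y (nat (a i) + j)) (x i j) < \<epsilon>)"
    by (rule exE)
  show ?thesis
  proof (rule that[of M])
    fix n :: nat and xs :: "(nat \<Rightarrow> 'a) list"
    assume n: "n > 0" and xs: "set xs \<subseteq> orbit_space X T"
    define L where "L = n + M + 1"
    show "\<exists>y\<in>orbit_space X T. \<forall>i<length xs. \<forall>j<n. dist (y (i * (n + M + 1) + j)) ((xs ! i) j) \<le> \<epsilon>"
    proof (cases "xs = []")
      case True
      then show ?thesis using ne by auto
    next
      case False
      have in\<Omega>: "xs ! i \<in> orbit_space X T" if "i < length xs" for i using xs that nth_mem by blast
      have step: "int ((i + 1 - 1) * L) = int ((i - 1) * L) + int L" if "i \<ge> 1" for i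
        using that by (cases i) simp_all
      have c1: "length xs \<ge> 1" using False by (simp add: Suc_leI)
      have c2: "\<forall>i\<in>{1..length xs}. orbit_segment X T (n - 1) (xs ! (i - 1))"
      proof
        fix i assume "i \<in> {1..length xs}"
        then have "xs ! (i - 1) \<in> orbit_space X T" by (intro in\<Omega>) auto
        then show "orbit_segment X T (n - 1) (xs ! (i - 1))"
          unfolding orbit_space_def orbit_segment_def by blast
      qed
      have c3: "\<forall>i\<in>{1..<length xs}. int ((i - 1) * L) < int ((i + 1 - 1) * L)"
      proof
        fix i assume "i \<in> {1..<length xs}"
        then show "int ((i - 1) * L) < int ((i + 1 - 1) * L)"
          using step[of i] by (simp add: L_def)
      qed
      have c4: "\<forall>i\<in>{1..<length xs}. int ((i + 1 - 1) * L) - (int ((i - 1) * L) + int (n - 1) + 1) > int M"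
      proof
        fix i assume i: "i \<in> {1..<length xs}"
        have "int (n - 1) = int n - 1" using n by simp
        moreover have "int L = int n + int M + 1" by (simp add: L_def)
        ultimately show "int ((i + 1 - 1) * L) - (int ((i - 1) * L) + int (n - 1) + 1) > int M"
          using step[of i] i by simp
      qed
      have c0: "int ((1 - 1) * L) = 0" by simp
      have "\<exists>y\<in>orbit_space X T. \<forall>i\<in>{1..length xs}. \<forall>j\<le>n - 1.
          dist (y (nat (int ((i - 1) * L)) + j)) ((xs ! (i - 1)) j) < \<epsilon>"
        by (rule M[THEN spec[of _ "length xs"], THEN spec[of _ "\<lambda>_. n - 1"], THEN spec[of _ "\<lambda>i. xs ! (i - 1)"],
              THEN spec[of _ "\<lambda>i. int ((i - 1) * L)"], THEN mp, OF c1, THEN mp, OF c2, THEN mp, OF c0,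
              THEN mp, OF c3, THEN mp, OF c4])
      then obtain y where y: "y \<in> orbit_space X T"
        "\<And>i j. i \<in> {1..length xs} \<Longrightarrow> j \<le> n - 1 \<Longrightarrow> dist (y (nat (int ((i - 1) * L)) + j)) ((xs ! (i - 1)) j) < \<epsilon>"
        by blast
      have "dist (y (i * (n + M + 1) + j)) ((xs ! i) j) \<le> \<epsilon>" if "i < length xs" "j < n" for i j
      proof -
        have "dist (y (nat (int ((Suc i - 1) * L)) + j)) ((xs ! (Suc i - 1)) j) < \<epsilon>"
          using that by (intro y(2)) auto
        then show ?thesis by (simp only: diff_Suc_1 nat_int L_def less_imp_le)
      qed
      then show ?thesis using y(1) by blast
    qed
  qed
qed

text \<open>Each cell is split into a compact kernel with letter \<open>i < K0\<close> and a
  remainder with letter \<open>K0 + i\<close>. Kernels are separated, so their letters can be read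
  from a nearby point; remainders keep distinct letters so that \<open>rl\<close> still refines
  \<open>pl\<close> and its cells stay small.\<close>

lemma good_letters:
  fixes X :: "'a::metric_space set" and pl :: "'a \<Rightarrow> nat"
  assumes N: "prob_space N" "sets N = sets borel" and X: "compact X"
    and pl: "pl \<in> measurable borel (count_space UNIV)" "\<And>x. x \<in> X \<Longrightarrow> pl x < K0" and K0: "K0 > 0" and q: "q > 0"
  obtains C rl where "\<And>i. compact (C i)" "\<And>i j. i \<noteq> j \<Longrightarrow> C i \<inter> C j = {}"
    "rl \<in> measurable borel (count_space UNIV)" "\<And>x. x \<in> X \<Longrightarrow> rl x < 2 * K0"
    "\<And>x. x \<in> X \<Longrightarrow> rl x < K0 \<Longrightarrow> x \<in> C (rl x)" "\<And>x y. x \<in> X \<Longrightarrow> y \<in> X \<Longrightarrow> rl x = rl y \<Longrightarrow> pl x = pl y"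
    "measure N {x \<in> X. K0 \<le> rl x} \<le> q"
proof -
  interpret N: prob_space N by fact
  define A where "A i = {x \<in> X. pl x = i}" for i
  have Xb: "X \<in> sets borel" using X by (rule borel_compact)
  have pls: "{x. pl x = i} \<in> sets borel" for i
    using measurable_sets[OF pl(1), of "{i}"] by (simp add: vimage_def)
  have A_eq: "A i = X \<inter> {x. pl x = i}" for i unfolding A_def by blast
  have Ab: "A i \<in> sets borel" for i unfolding A_eq by (rule sets.Int[OF Xb pls])
  have qK: "q / K0 > 0" using q K0 by simp
  have "\<exists>C. closed C \<and> C \<subseteq> A i \<and> measure N (A i - C) < q / K0" for i
  proof -
    obtain C where "closed C" "C \<subseteq> A i" "measure N (A i - C) < q / K0"
      by (rule closed_approximation[OF N.finite_measure_axioms N(2) Ab[of i] qK])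
    then show ?thesis by blast
  qed
  then obtain C where C: "\<And>i. closed (C i)" "\<And>i. C i \<subseteq> A i" "\<And>i. measure N (A i - C i) < q / K0" by metis
  define rl where "rl x = (if x \<in> C (pl x) then pl x else K0 + pl x)" for x
  show ?thesis
  proof (rule that[of C rl])
    fix i
    have "X \<inter> C i = C i" using C(2)[of i] by (auto simp: A_def)
    then show "compact (C i)" using compact_Int_closed[OF X C(1)[of i]] by simp
  next
    fix i j :: nat assume "i \<noteq> j"
    then show "C i \<inter> C j = {}" using C(2)[of i] C(2)[of j] by (auto simp: A_def)
  next
    have "{x. x \<in> C (pl x)} = (\<Union>i. {x. pl x = i} \<inter> C i)" by auto
    moreover have "(\<Union>i. {x. pl x = i} \<inter> C i) \<in> sets borel"
      using C(1) by (intro sets.countable_UN') (auto intro!: sets.Int pls)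
    ultimately have "{x \<in> space borel. x \<in> C (pl x)} \<in> sets borel" by simp
    then show "rl \<in> measurable borel (count_space UNIV)"
      unfolding rl_def[abs_def] by (intro measurable_If pl(1) measurable_compose[OF pl(1)]) simp_all
  next
    fix x assume x: "x \<in> X"
    show "rl x < 2 * K0" using pl(2)[OF x] by (simp add: rl_def)
    show "x \<in> C (rl x)" if "rl x < K0" using that by (simp add: rl_def split: if_splits)
    fix y assume y: "y \<in> X"
    show "pl x = pl y" if "rl x = rl y" using that pl(2)[OF x] pl(2)[OF y] by (simp add: rl_def split: if_splits)
  next
    have AC: "A i - C i \<in> sets N" for i unfolding N(2) using Ab C(1) by (intro sets.Diff) auto
    have "{x \<in> X. K0 \<le> rl x} \<subseteq> (\<Union>i<K0. A i - C i)"
    proof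
      fix x assume x: "x \<in> {x \<in> X. K0 \<le> rl x}"
      then have "pl x < K0" using pl(2) by blast
      moreover from this have "x \<notin> C (pl x)" using x by (auto simp: rl_def)
      moreover have "x \<in> A (pl x)" using x by (simp add: A_def)
      ultimately show "x \<in> (\<Union>i<K0. A i - C i)" by blast
    qed
    then have "measure N {x \<in> X. K0 \<le> rl x} \<le> measure N (\<Union>i<K0. A i - C i)"
      using AC by (intro N.finite_measure_mono) auto
    also have "\<dots> \<le> (\<Sum>i<K0. measure N (A i - C i))"
      using AC by (intro N.finite_measure_subadditive_finite) auto
    also have "\<dots> \<le> (\<Sum>i<K0. q / K0)" by (rule sum_mono) (rule less_imp_le[OF C(3)])
    also have "\<dots> = q" using K0 by simp
    finally show "measure N {x \<in> X. K0 \<le> rl x} \<le> q" .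
  qed
qed

text \<open>A point within half the separation of one kernel is that close to no other, so the first
  kernel found close by is the right one. The value \<open>K0\<close> stands for a point close to
  none.\<close>

lemma guess_letter:
  fixes C :: "nat \<Rightarrow> 'a::metric_space set"
  assumes "\<And>i. compact (C i)" "\<And>i j. i \<noteq> j \<Longrightarrow> C i \<inter> C j = {}"
  obtains s D where "s > 0" "D \<in> measurable borel (count_space UNIV)" "\<And>y. D y \<le> K0"
    "\<And>i x y. i < K0 \<Longrightarrow> x \<in> C i \<Longrightarrow> dist y x < s \<Longrightarrow> D y = i"
proof -
  obtain s where s: "s > 0" "\<And>i j x y. i \<in> {..<K0} \<Longrightarrow> j \<in> {..<K0} \<Longrightarrow> i \<noteq> j \<Longrightarrow> x \<in> C i \<Longrightarrow> y \<in> C j \<Longrightarrow> s \<le> dist x y"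
    using finite_compact_separation[of "{..<K0}" C] assms by blast
  define D where "D y = (LEAST i. i = K0 \<or> (\<exists>x\<in>C i. dist x y < s / 2))" for y
  have D: "D y = K0 \<or> (\<exists>x\<in>C (D y). dist x y < s / 2)" for y
    unfolding D_def by (rule LeastI[of _ K0]) simp
  have D_le: "D y \<le> i" if "i = K0 \<or> (\<exists>x\<in>C i. dist x y < s / 2)" for y i
    unfolding D_def using that by (rule Least_le)
  show ?thesis
  proof (rule that[of "s / 2" D])
    show "s / 2 > 0" using s(1) by simp
    show "D y \<le> K0" for y by (rule D_le) simp
    show "D \<in> measurable borel (count_space UNIV)"
      unfolding D_def[abs_def]
    proof (rule measurable_Least)
      fix i
      have "{y. i = K0 \<or> (\<exists>x\<in>C i. dist x y < s / 2)} = (if i = K0 then UNIV else (\<Union>x\<in>C i. ball x (s / 2)))"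
        by auto
      moreover have "(if i = K0 then UNIV else (\<Union>x\<in>C i. ball x (s / 2))) \<in> sets borel"
        by (simp add: borel_open open_UN)
      ultimately show "Measurable.pred borel (\<lambda>y. i = K0 \<or> (\<exists>x\<in>C i. dist x y < s / 2))"
        by (simp only: pred_def space_borel UNIV_I simp_thms)
    qed
    fix i x y assume i: "i < K0" "x \<in> C i" "dist y x < s / 2"
    have "D y \<le> i" by (rule D_le) (use i in \<open>auto simp: dist_commute\<close>)
    show "D y = i"
    proof (rule ccontr)
      assume ne: "D y \<noteq> i"
      have "D y < K0" using \<open>D y \<le> i\<close> i(1) by simp
      then obtain x' where x': "x' \<in> C (D y)" "dist x' y < s / 2" using D[of y] by auto
      have "s \<le> dist x' x" using \<open>D y < K0\<close> i ne x' by (intro s(2)[of "D y" i]) auto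
      also have "\<dots> \<le> dist x' y + dist y x" by (rule dist_triangle)
      also have "\<dots> < s" using x'(2) i(3) by simp
      finally show False by simp
    qed
  qed
qed

lemma small_net:
  fixes X :: "'a::metric_space set"
  assumes "compact X" "\<delta> > 0"
  obtains K and z :: "nat \<Rightarrow> 'a" where "\<And>x. x \<in> X \<Longrightarrow> \<exists>c<K. dist x (z c) \<le> \<delta>"
proof -
  obtain K and pl :: "'a \<Rightarrow> nat" where pl: "\<And>x. x \<in> X \<Longrightarrow> pl x < K"
    "\<And>x y. x \<in> X \<Longrightarrow> y \<in> X \<Longrightarrow> pl x = pl y \<Longrightarrow> dist x y \<le> \<delta>"
    by (rule small_cells[OF assms]) blast
  define z where "z c = (SOME x. x \<in> X \<and> pl x = c)" for c
  have "z (pl x) \<in> X \<and> pl (z (pl x)) = pl x" if "x \<in> X" for x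
    unfolding z_def by (rule someI[of _ x]) (simp add: that)
  then have "pl x < K \<and> dist x (z (pl x)) \<le> \<delta>" if "x \<in> X" for x
    using pl that by simp
  then show ?thesis by (intro that[of K z]) blast
qed

text \<open>There are \<open>n - 1\<close> times with \<open>Suc j < n\<close>. The other
  \<open>M + 2\<close> of the \<open>L\<close> times are the gap and the last step of the segment,
  whose successor already lies in the gap.\<close>

lemma weighted_average_close:
  fixes I :: "nat \<Rightarrow> real" and n M L :: nat and b c t :: real
  assumes L: "L = n + M + 1" and n: "n > 0" and near: "\<And>j. Suc j < n \<Longrightarrow> \<bar>I j - c\<bar> \<le> t"
    and far: "\<And>j. \<bar>I j - c\<bar> \<le> b" and t: "0 \<le> t"
  shows "\<bar>(\<Sum>j<L. I j) / L - c\<bar> \<le> t + (M + 2) * b / L"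
proof -
  have L0: "real L > 0" using L by simp
  have b: "0 \<le> b" using far[of 0] by linarith
  have "(\<Sum>j<L. I j) / L - c = (\<Sum>j<L. I j - c) / L"
    using L0 by (simp add: sum_subtractf field_simps)
  also have "\<bar>\<dots>\<bar> = \<bar>\<Sum>j<L. I j - c\<bar> / L" using L0 by simp
  also have "\<bar>\<Sum>j<L. I j - c\<bar> \<le> (\<Sum>j<L. \<bar>I j - c\<bar>)" by (rule sum_abs)
  also have "\<dots> = (\<Sum>j<n - 1. \<bar>I j - c\<bar>) + (\<Sum>j=n - 1..<L. \<bar>I j - c\<bar>)"
  proof -
    have split: "{..<L} = {..<n - 1} \<union> {n - 1..<L}" using L by auto
    show ?thesis unfolding split by (rule sum.union_disjoint) auto
  qed
  also have "\<dots> \<le> (\<Sum>j<n - 1. t) + (\<Sum>j=n - 1..<L. b)"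
    using near far by (intro add_mono sum_mono) auto
  also have "\<dots> = (n - 1) * t + (M + 2) * b" using L n by simp
  also have "\<dots> \<le> L * t + (M + 2) * b"
    using L t by (intro add_right_mono mult_right_mono) auto
  finally have "\<bar>(\<Sum>j<L. I j) / L - c\<bar> \<le> (L * t + (M + 2) * b) / L"
    using L0 by (simp add: divide_right_mono)
  also have "\<dots> = t + (M + 2) * b / L" using L0 by (simp add: add_divide_distrib)
  finally show ?thesis .
qed

lemma entropy_rate_nonneg:
  assumes "mpt M S" "simple_function M g"
  shows "0 \<le> entropy_rate M S g"
proof -
  interpret mpt M S by fact
  show ?thesis
    by (rule LIMSEQ_le_const[OF entropy_rate_limit(1)[OF assms(2)]])
       (auto intro!: divide_nonneg_nonneg rv_entropy_nonneg prob_space_axioms)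
qed

text \<open>The rate is computed along multiples of \<open>L\<close>; the block lost in
  \<open>entropy_avg\<close> costs the factor \<open>k / Suc k\<close>, which tends to one.\<close>

lemma (in power_mpt) entropy_rate_avg_ge:
  assumes g: "simple_function \<kappa> g" and k: "\<And>k. real k * a \<le> rv_entropy \<kappa> (itinerary S g (k * L))"
  shows "a / L \<le> entropy_rate avg S g"
proof -
  interpret avg: prob_space avg by (rule prob_space_avg)
  interpret avg: mpt avg S
  proof
    show "S \<in> measurable avg avg" by (subst measurable_cong_sets[OF sets_avg sets_avg]) (rule S_meas)
    show "distr avg avg S = avg" by (rule distr_avg)
  qed
  have g': "simple_function avg g" using g by (simp add: simple_function_def)
  let ?H = "\<lambda>N. rv_entropy avg (itinerary S g N)"
  have "filterlim (\<lambda>k. Suc k * L) sequentially sequentially"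
    using L_pos by (intro filterlim_subseq strict_monoI) (simp add: mult_less_mono1)
  then have lim: "(\<lambda>k. ?H (Suc k * L) / real (Suc k * L)) \<longlonglongrightarrow> entropy_rate avg S g"
    by (rule filterlim_compose[OF avg.entropy_rate_limit(1)[OF g']])
  have "(\<lambda>k. a / L * (real k / real (Suc k))) \<longlonglongrightarrow> a / L * 1"
    by (intro tendsto_mult tendsto_const LIMSEQ_n_over_Suc_n)
  then have lim2: "(\<lambda>k. a / L * (real k / real (Suc k))) \<longlonglongrightarrow> a / L" by simp
  have "a / L * (real k / real (Suc k)) \<le> ?H (Suc k * L) / real (Suc k * L)" for k
  proof -
    have "a / L * (real k / real (Suc k)) = (real k * a) / real (Suc k * L)"
      by (simp add: algebra_simps)
    also have "\<dots> \<le> ?H (Suc k * L) / real (Suc k * L)"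
      using order_trans[OF k[of k] entropy_avg[OF g]] by (intro divide_right_mono) auto
    finally show ?thesis .
  qed
  then show ?thesis by (intro LIMSEQ_le[OF lim2 lim]) blast
qed

section \<open>Choice of the constants and conclusion\<close>

theorem corollary4p3:
  fixes X :: "'a::metric_space set"
    and T :: "'a \<Rightarrow> 'a set"
    and E :: "('a \<times> 'a) measure \<Rightarrow> real"
  assumes "compact X"
    and "correspondence X T"
    and "forward_expansive X T"
    and "specification_property X T"
    and "continuous_map (weak_star_topology (corr_graph X T)) euclideanreal E"
  shows "abundance_of_ergodic_path_measures X T E"
  unfolding abundance_of_ergodic_path_measures_def
proof (intro ballI allI impI)
  fix \<nu> and \<eta> :: real
  assume \<nu>: "\<nu> \<in> invariant_measures (orbit_space X T) shift" and \<eta>: "\<eta> > 0"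
  let ?\<Omega> = "orbit_space X T" and ?\<Gamma> = "corr_graph X T"
  let ?OM = "restrict_space borel ?\<Omega>" and ?GM = "restrict_space borel ?\<Gamma>"
  note inv = invariant_measures_mpt[OF \<nu>]
  interpret \<nu>: mpt \<nu> shift by (rule inv(3))
  have sp: "space \<nu> = ?\<Omega>" using sets_eq_imp_space_eq[OF inv(2)] by simp
  have ne: "?\<Omega> \<noteq> {}" using \<nu>.not_empty by (simp add: sp)
  have in_X: "y j \<in> X" if "y \<in> ?\<Omega>" for y j using that unfolding orbit_space_def by blast
  from assms(3)[unfolded forward_expansive_def]
  obtain e where e: "e > 0" and exp0: "\<forall>x\<in>?\<Omega>. \<forall>y\<in>?\<Omega>. x \<noteq> y \<longrightarrow> (\<exists>j. dist (x j) (y j) > e)"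
    by (elim exE conjE)
  note exp = exp0[rule_format]
  have cG: "compact ?\<Gamma>" by (rule compact_corr_graph[OF assms(1,2)])
  have p2: "proj2 \<in> measurable M ?GM" if "sets M = sets ?OM" for M
    by (subst measurable_cong_sets[OF that refl]) (rule measurable_proj2_orbit)

  have \<mu>0: "distr \<nu> ?GM proj2 \<in> borel_prob_measures ?\<Gamma>"
    using \<nu>.prob_space_distr[OF p2[OF inv(2)]] by (simp add: borel_prob_measures_def)
  \<comment> \<open>Half of \<open>\<eta>\<close> is reserved for the energy, half for the
    entropy.\<close>
  have \<eta>2: "\<eta> / 2 > 0" using \<eta> by simp
  obtain \<Phi> :: "('a \<times> 'a \<Rightarrow> real) set" and \<delta> where \<Phi>: "finite \<Phi>" "\<And>f. f \<in> \<Phi> \<Longrightarrow> continuous_on ?\<Gamma> f" "\<delta> > 0"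
    and E_near: "\<And>\<mu>'. \<mu>' \<in> borel_prob_measures ?\<Gamma> \<Longrightarrow>
      (\<And>f. f \<in> \<Phi> \<Longrightarrow> \<bar>(\<integral>u. f u \<partial>\<mu>') - (\<integral>u. f u \<partial>distr \<nu> ?GM proj2)\<bar> < \<delta>)
      \<Longrightarrow> \<bar>E \<mu>' - E (distr \<nu> ?GM proj2)\<bar> < \<eta> / 2"
  proof (rule continuous_energy_neighbourhood[OF assms(5) \<mu>0 \<eta>2], goal_cases)
    case (1 \<Phi> \<delta>)
    show ?case by (rule that[of \<Phi> \<delta>]) (fact 1)+
  qed
  \<comment> \<open>\<open>\<delta> / 8\<close> enters twice in \<open>coded_integral\<close> and
    gives \<open>\<delta> / 4\<close>; the gaps will cost less than \<open>\<delta> / 2\<close>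
    more.\<close>
  have "\<exists>d>0. \<forall>f\<in>\<Phi>. \<forall>u\<in>?\<Gamma>. \<forall>v\<in>?\<Gamma>. dist u v < d \<longrightarrow> \<bar>f u - f v\<bar> < \<delta> / 8"
    by (rule finite_uniform_continuity[OF cG \<Phi>(1,2)]) (use \<Phi>(3) in simp_all)
  then obtain d where d0: "d > 0" "\<forall>f\<in>\<Phi>. \<forall>u\<in>?\<Gamma>. \<forall>v\<in>?\<Gamma>. dist u v < d \<longrightarrow> \<bar>f u - f v\<bar> < \<delta> / 8"
    by (elim exE conjE)
  note d = d0(1) d0(2)[rule_format]
  have "\<exists>B\<ge>0. \<forall>f\<in>\<Phi>. \<forall>u\<in>?\<Gamma>. \<bar>f u\<bar> \<le> B"
    by (rule finite_uniform_bound[OF cG \<Phi>(1,2)])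
  then obtain B where B0: "B \<ge> 0" "\<forall>f\<in>\<Phi>. \<forall>u\<in>?\<Gamma>. \<bar>f u\<bar> \<le> B"
    by (elim exE conjE)
  note B = B0(1) B0(2)[rule_format]

  \<comment> \<open>Diameter at most \<open>e\<close> makes the cells generate; \<open>d / 4\<close>
    in each of two coordinates keeps pairs closer than \<open>d\<close>.\<close>
  have mn: "min e (d / 4) > 0" using e d(1) by simp
  obtain K0 and pl :: "'a \<Rightarrow> nat" where pl: "\<And>x. x \<in> X \<Longrightarrow> pl x < K0"
    "\<And>x y. x \<in> X \<Longrightarrow> y \<in> X \<Longrightarrow> pl x = pl y \<Longrightarrow> dist x y \<le> min e (d / 4)" "pl \<in> measurable borel (count_space UNIV)"
  proof (rule small_cells[OF assms(1) mn], goal_cases)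
    case (1 K0 pl)
    show ?case by (rule that[of pl K0]) (fact 1)+
  qed
  have K0: "K0 > 0"
  proof -
    obtain y where "y \<in> ?\<Omega>" using ne by blast
    then have "pl (y 0) < K0" by (intro pl(1) in_X)
    then show ?thesis by (cases K0) simp_all
  qed
  \<comment> \<open>\<open>2 * K0\<close> counts the letters once each cell is split in two.
    \<open>\<eta> / 4\<close> bounds the Fano loss per step, and \<open>1\<close> allows
    \<open>h - F\<close> to be estimated by \<open>h + 1\<close>.\<close>
  have "eventually (\<lambda>q. \<bar>fano_bound (2 * K0) q\<bar> < min 1 (\<eta> / 4)) (at_right 0)"
  proof -
    have "min 1 (\<eta> / 4) > 0" using \<eta> by simp
    from tendstoD[OF fano_bound_tendsto[of "2 * K0"] this] show ?thesis by (simp only: dist_real_def diff_0_right)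
  qed
  moreover have "eventually (\<lambda>q. 0 < q \<and> q < (1::real)) (at_right 0)"
    unfolding eventually_at_right_field by (rule exI[of _ 1]) simp
  ultimately have "eventually (\<lambda>q. \<bar>fano_bound (2 * K0) q\<bar> < min 1 (\<eta> / 4) \<and> 0 < q \<and> q < 1) (at_right 0)"
    by (rule eventually_conj)
  from eventually_happens'[OF trivial_limit_at_right_real this]
  obtain q where q: "\<bar>fano_bound (2 * K0) q\<bar> < min 1 (\<eta> / 4)" "0 < q" "q < 1"
    by (elim exE conjE)
  define F where "F = fano_bound (2 * K0) q"
  have F: "\<bar>F\<bar> < 1" "\<bar>F\<bar> < \<eta> / 4" using q(1) unfolding F_def by simp_all

  have em: "(\<lambda>y. y 0) \<in> measurable \<nu> borel"
    by (subst measurable_cong_sets[OF inv(2) refl]) (rule measurable_coord_orbit)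
  define N where "N = distr \<nu> borel (\<lambda>y. y 0)"
  have N: "prob_space N" "sets N = sets borel"
    unfolding N_def by (rule \<nu>.prob_space_distr[OF em]) simp
  obtain C rl where C: "\<And>i. compact (C i)" "\<And>i j. i \<noteq> j \<Longrightarrow> C i \<inter> C j = {}"
    and rl: "rl \<in> measurable borel (count_space UNIV)" "\<And>x. x \<in> X \<Longrightarrow> rl x < 2 * K0"
    "\<And>x. x \<in> X \<Longrightarrow> rl x < K0 \<Longrightarrow> x \<in> C (rl x)" "\<And>x y. x \<in> X \<Longrightarrow> y \<in> X \<Longrightarrow> rl x = rl y \<Longrightarrow> pl x = pl y"
    "measure N {x \<in> X. K0 \<le> rl x} \<le> q"
  proof (rule good_letters[OF N assms(1) pl(3) _ K0 q(2)], goal_cases)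
    case (1 x)
    show ?case by (rule pl(1)[OF 1(2)])
  next
    case (2 C rl)
    show ?case by (rule that[of C rl]) (fact 2)+
  qed
  have cells: "dist x y \<le> min e (d / 4)" if "x \<in> X" "y \<in> X" "rl x = rl y" for x y
    by (rule pl(2)[OF that(1,2) rl(4)[OF that]])
  obtain s D where s: "s > 0" and D: "D \<in> measurable borel (count_space UNIV)" "\<And>y. D y \<le> K0"
    "\<And>i x y. i < K0 \<Longrightarrow> x \<in> C i \<Longrightarrow> dist y x < s \<Longrightarrow> D y = i"
  proof (rule guess_letter[of C K0], goal_cases)
    case (1 i)
    show ?case by (rule C(1))
  next
    case (2 i j)
    show ?case by (rule C(2)[OF 2(2)])
  next
    case (3 s D)
    show ?case by (rule that[of s D]) (fact 3)+
  qed

  let ?g = "\<lambda>y :: nat \<Rightarrow> 'a. rl (y 0)"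
  define h where "h = entropy_rate \<nu> shift ?g"
  have g: "simple_function \<nu> ?g" by (rule simple_function_letter[OF inv(2) rl(1,2)])
  have KS\<nu>: "KS_entropy \<nu> shift \<le> ereal h"
    unfolding h_def
  proof (rule KS_entropy_le_letters[OF assms(1,2) exp \<nu> rl(1,2)])
    show "dist x y \<le> e" if "x \<in> X" "y \<in> X" "rl x = rl y" for x y using cells[OF that] by simp
  qed
  have h0: "0 \<le> h" unfolding h_def by (rule entropy_rate_nonneg[OF inv(3) g])

  \<comment> \<open>\<open>s / 2\<close> keeps the shadowing orbit strictly within the reading
    radius \<open>s\<close>; \<open>d / 4\<close> serves the integrals.\<close>
  define \<epsilon> where "\<epsilon> = min (s / 2) (d / 4)"
  have \<epsilon>: "\<epsilon> > 0" "\<epsilon> < s" "\<epsilon> \<le> d / 4" using s d(1) by (auto simp: \<epsilon>_def)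
  obtain M where M: "\<And>n xs. n > 0 \<Longrightarrow> set xs \<subseteq> ?\<Omega> \<Longrightarrow>
    \<exists>y\<in>?\<Omega>. \<forall>i<length xs. \<forall>j<n. dist (y (i * (n + M + 1) + j)) ((xs ! i) j) \<le> \<epsilon>"
  proof (rule specification_words[OF assms(4) \<epsilon>(1) ne], goal_cases)
    case (1 M)
    show ?case by (rule that[of M]) (fact 1)+
  qed
  obtain Kz and z :: "nat \<Rightarrow> 'a" where z: "\<And>x. x \<in> X \<Longrightarrow> \<exists>c<Kz. dist x (z c) \<le> e / 2"
  proof (rule small_net[OF assms(1) half_gt_zero[OF e]], goal_cases)
    case (1 Kz z)
    show ?case by (rule that[of Kz z]) (fact 1)+
  qed

  \<comment> \<open>With \<open>M\<close> fixed, long segments make the gaps negligible. Their cost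
    is at most \<open>(h + 1) * (M + 1) / L\<close> in entropy and
    \<open>(M + 2) * (2 * B) / L\<close> in the integrals.\<close>
  obtain n :: nat where n: "real n > (h + 1) * (M + 1) / (\<eta> / 4)" "real n > (M + 2) * (2 * B) / (\<delta> / 2)" "n > 0"
  proof -
    obtain n1 n2 :: nat where "real n1 > (h + 1) * (M + 1) / (\<eta> / 4)" "real n2 > (M + 2) * (2 * B) / (\<delta> / 2)"
      using reals_Archimedean2 by meson
    then show ?thesis by (intro that[of "max (max n1 n2) 1"]) auto
  qed
  define L where "L = n + M + 1"
  have L0: "real L > 0" and nL: "n \<le> L" "real L \<ge> real n" by (simp_all add: L_def)
  have L1: "(h + 1) * (M + 1) / L < \<eta> / 4"
  proof -
    have "(h + 1) * (M + 1) < \<eta> / 4 * n" using n(1) \<eta> by (simp add: divide_less_eq mult.commute)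
    also have "\<dots> \<le> \<eta> / 4 * L" using nL \<eta> by (intro mult_left_mono) auto
    finally show ?thesis using L0 by (simp add: divide_less_eq)
  qed
  have L2: "(M + 2) * (2 * B) / L < \<delta> / 2"
  proof -
    have "(M + 2) * (2 * B) < \<delta> / 2 * n" using n(2) \<Phi>(3) by (simp add: divide_less_eq mult.commute)
    also have "\<dots> \<le> \<delta> / 2 * L" using nL \<Phi>(3) by (intro mult_left_mono) auto
    finally show ?thesis using L0 by (simp add: divide_less_eq)
  qed

  define nm where "nm = itinerary shift ?g n"
  have nm: "simple_function \<nu> nm" unfolding nm_def by (rule \<nu>.simple_itinerary[OF g])
  have nm_m: "nm \<in> measurable \<nu> (count_space UNIV)" by (rule measurable_simple_function[OF nm])
  have nm_nth: "nm y ! j = rl (y j)" if "j < n" for y j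
    unfolding nm_def using that by (simp add: shift_funpow)
  obtain p where p: "distr \<nu> (count_space UNIV) nm = measure_pmf p"
    by (rule simple_function_pmf[OF inv(1) nm])
  \<comment> \<open>Words of positive probability occur along some orbit, and such an orbit is taken
    as representative.\<close>
  define W where "W = set_pmf p"
  have law: "law \<nu> nm w = pmf p w" for w by (rule law_eq_pmf[OF nm_m p])
  have W_sub: "W \<subseteq> nm ` ?\<Omega>"
  proof
    fix w assume "w \<in> W"
    then have "law \<nu> nm w \<noteq> 0" by (simp add: W_def law set_pmf_iff)
    then show "w \<in> nm ` ?\<Omega>" using law_outside[of w nm \<nu>] unfolding sp by blast
  qed
  have finW: "finite W" using nm unfolding simple_function_def sp by (intro finite_subset[OF W_sub]) blast
  have W0: "W \<noteq> {}" unfolding W_def by (rule set_pmf_not_empty)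
  define rep where "rep w = (SOME y. y \<in> ?\<Omega> \<and> nm y = w)" for w
  have rep: "rep w \<in> ?\<Omega>" "nm (rep w) = w" if w: "w \<in> W" for w
  proof -
    have "\<exists>y. y \<in> ?\<Omega> \<and> nm y = w" using W_sub w by blast
    from someI_ex[OF this] show "rep w \<in> ?\<Omega>" "nm (rep w) = w" unfolding rep_def by blast+
  qed
  have letter: "w ! j = rl (rep w j)" if "w \<in> W" "j < n" for w j
    using nm_nth[OF that(2), of "rep w"] rep(2)[OF that(1)] by simp
  have lenW: "length w = n" if "w \<in> W" for w
    using rep(2)[OF that] length_itinerary[of shift ?g n "rep w"] unfolding nm_def by simp
  have near: "dist (rep (nm y) i) (y i) \<le> d / 4" if "y \<in> ?\<Omega>" "nm y \<in> W" "i < n" for y i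
  proof -
    have "rl (rep (nm y) i) = rl (y i)" using letter[OF that(2,3)] nm_nth[OF that(3)] by simp
    then show ?thesis using cells[OF in_X[OF rep(1)[OF that(2)]] in_X[OF that(1)]] by simp
  qed

  interpret cod: orbit_coding X T e \<epsilon> z Kz n L W rep
  proof
    show "0 < L" by (simp add: L_def)
    fix ws assume ws: "set ws \<subseteq> W"
    have "set (map rep ws) \<subseteq> ?\<Omega>" using ws rep(1) by auto
    from M[OF n(3) this] show "\<exists>y\<in>?\<Omega>. \<forall>i<length ws. \<forall>j<n. dist (y (i * L + j)) (rep (ws ! i) j) \<le> \<epsilon>"
      by (simp add: L_def)
  next
    show "compact X" "correspondence X T" by (rule assms)+
    show "finite W" "W \<noteq> {}" by (rule finW, rule W0)
    show "\<exists>c<Kz. dist x (z c) \<le> e / 2" if "x \<in> X" for x by (rule z[OF that])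
    show "\<exists>j. dist (x j) (y j) > e" if "x \<in> ?\<Omega>" "y \<in> ?\<Omega>" "x \<noteq> y" for x y by (rule exp[OF that])
  qed

  obtain \<theta> where \<theta>: "prob_space \<theta>" "sets \<theta> = sets seq_space"
    "\<And>k. distr \<theta> (count_space UNIV) (\<lambda>b. map cod.word (prefix k b)) = measure_pmf (replicate_pmf k p)"
    "AE b in \<theta>. \<forall>i. \<forall>j<n. dist (cod.code b (i * L + j)) (rep (cod.word (b i)) j) \<le> \<epsilon>"
    and pm: "power_mpt (distr \<theta> ?OM cod.code) shift L"
    and erg: "\<And>A. A \<in> sets ?OM \<Longrightarrow> shift -` A \<inter> ?\<Omega> = A \<Longrightarrow>
      measure (distr \<theta> ?OM cod.code) A = 0 \<or> measure (distr \<theta> ?OM cod.code) A = 1"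
  proof (rule cod.coding_measure[OF W_def[symmetric]], goal_cases)
    case (1 \<theta>)
    show ?case by (rule that[of \<theta>]) (fact 1)+
  qed
  define \<kappa> where "\<kappa> = distr \<theta> ?OM cod.code"
  have s\<kappa>: "sets \<kappa> = sets ?OM" "space \<kappa> = ?\<Omega>" by (simp_all add: \<kappa>_def)
  interpret \<kappa>: power_mpt \<kappa> shift L unfolding \<kappa>_def by (rule pm)
  define \<rho> where "\<rho> = \<kappa>.avg"
  have s\<rho>: "sets \<rho> = sets ?OM" "space \<rho> = ?\<Omega>" by (simp_all add: \<rho>_def s\<kappa>)
  interpret \<rho>: prob_space \<rho> unfolding \<rho>_def by (rule \<kappa>.prob_space_avg)

  have \<rho>_inv: "\<rho> \<in> invariant_measures ?\<Omega> shift"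
    using \<rho>.prob_space_axioms s\<rho>(1) \<kappa>.distr_avg
    by (simp add: invariant_measures_def borel_prob_measures_def \<rho>_def)
  have \<rho>_erg: "\<rho> \<in> ergodic_measures ?\<Omega> shift"
    unfolding ergodic_measures_def
  proof (intro CollectI conjI ballI impI \<rho>_inv)
    fix A assume "A \<in> sets \<rho>" "shift -` A \<inter> space \<rho> = A"
    then have A: "A \<in> sets ?OM" "shift -` A \<inter> ?\<Omega> = A" by (simp_all only: s\<rho>)
    have "measure \<kappa> A = 0 \<or> measure \<kappa> A = 1" unfolding \<kappa>_def by (rule erg[OF A])
    then show "measure \<rho> A = 0 \<or> measure \<rho> A = 1"
      unfolding \<rho>_def using A by (intro \<kappa>.avg_zero_one) (simp_all only: s\<kappa>)
  qed

  have KS\<rho>: "ereal (h - \<eta> / 2) < KS_entropy \<rho> shift"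
  proof -
    \<comment> \<open>The entropy of \<open>\<rho>\<close> is bounded below through the reading rule
      \<open>D\<close> and not through \<open>rl\<close>, whose cells are not respected by
      shadowing.\<close>
    let ?gD = "\<lambda>y :: nat \<Rightarrow> 'a. D (y 0)"
    have gD: "simple_function M ?gD" if "sets M = sets ?OM" for M
      by (rule simple_function_letter[OF that D(1), of "Suc K0"]) (simp add: D(2) less_Suc_eq_le)
    have k: "real k * (n * (h - F)) \<le> rv_entropy \<kappa> (itinerary shift ?gD (k * L))" for k
    proof -
      have "real k * (- (\<Sum>w\<in>W. pmf p w * ln (pmf p w)))
          \<le> rv_entropy \<kappa> (itinerary shift ?gD (k * L)) + real (k * n) * fano_bound (2 * K0) q"
        unfolding \<kappa>_def
      proof (rule cod.coded_entropy_ge[where letter="\<lambda>w j. w ! j",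
            OF \<theta>(1,2) W_def[symmetric] \<theta>(3,4) n(3) nL(1) _ _ D(1,2) _ q(2,3)])
        show "w ! j < 2 * K0" if "w \<in> W" "j < n" for w j
          unfolding letter[OF that] by (rule rl(2)[OF in_X[OF rep(1)[OF that(1)]]])
        show "w = w'" if "w \<in> W" "w' \<in> W" "\<And>j. j < n \<Longrightarrow> w ! j = w' ! j" for w w'
          using lenW[OF that(1)] lenW[OF that(2)] that(3) by (intro nth_equalityI) simp_all
        show "D x = w ! j" if "w \<in> W" "j < n" "w ! j < K0" "dist x (rep w j) \<le> \<epsilon>" for w j x
        proof (rule D(3)[OF that(3)])
          show "rep w j \<in> C (w ! j)"
            using rl(3)[OF in_X[OF rep(1)[OF that(1)]], of j] letter[OF that(1,2)] that(3) by simp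
          show "dist x (rep w j) < s" using that(4) \<epsilon>(2) by simp
        qed
        fix j assume j: "j < n"
        \<comment> \<open>The letter at place \<open>j\<close> is the letter at place
          \<open>0\<close> after \<open>j\<close> shifts, so by invariance it belongs to a remainder
          with the same probability for every \<open>j\<close>.\<close>
        have "measure p {w. K0 \<le> w ! j} = measure \<nu> (nm -` {w. K0 \<le> w ! j} \<inter> space \<nu>)"
          unfolding p[symmetric] by (rule measure_distr[OF nm_m]) simp
        also have "nm -` {w. K0 \<le> w ! j} \<inter> space \<nu> = (shift ^^ j) -` {y \<in> ?\<Omega>. K0 \<le> rl (y 0)} \<inter> space \<nu>"
          using nm_nth[OF j] funpow_shift_orbit[of _ X T j] by (auto simp: sp shift_funpow)
        also have "measure \<nu> \<dots> = measure (distr \<nu> \<nu> (shift ^^ j)) {y \<in> ?\<Omega>. K0 \<le> rl (y 0)}"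
          using simple_function_level_sets(2)[OF g, of "{K0..}"]
          by (subst measure_distr[OF \<nu>.funpow_meas]) (simp_all add: sp)
        also have "\<dots> = measure \<nu> ((\<lambda>y. y 0) -` {x \<in> X. K0 \<le> rl x} \<inter> space \<nu>)"
          unfolding \<nu>.funpow_inv using in_X by (intro arg_cong[where f="measure \<nu>"]) (auto simp: sp)
        also have "\<dots> = measure N {x \<in> X. K0 \<le> rl x}"
        proof -
          have "{x. K0 \<le> rl x} \<in> sets borel"
            using measurable_sets[OF rl(1), of "{K0..}"] by (simp add: vimage_def)
          then have "X \<inter> {x. K0 \<le> rl x} \<in> sets borel" using borel_compact[OF assms(1)] by (rule sets.Int[rotated])
          then have "{x \<in> X. K0 \<le> rl x} \<in> sets borel" by (simp add: Int_def)
          then show ?thesis unfolding N_def by (rule measure_distr[OF em, symmetric])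
        qed
        also have "\<dots> \<le> q" by (rule rl(5))
        finally show "measure p {w. K0 \<le> w ! j} \<le> q" .
      qed
      moreover have "- (\<Sum>w\<in>W. pmf p w * ln (pmf p w)) = rv_entropy \<nu> nm"
      proof -
        have "(\<Sum>w\<in>W. pmf p w * ln (pmf p w)) = (\<Sum>w\<in>nm ` ?\<Omega>. pmf p w * ln (pmf p w))"
          using nm W_sub unfolding simple_function_def sp
          by (intro sum.mono_neutral_left) (auto simp: W_def set_pmf_iff)
        then show ?thesis by (simp add: rv_entropy_def law sp)
      qed
      \<comment> \<open>The rate is the infimum of the normalised entropies, so \<open>n * h\<close>
        is below the entropy of words of length \<open>n\<close> for this very
        \<open>n\<close>.\<close>
      moreover have "real k * (n * h) \<le> real k * rv_entropy \<nu> nm"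
        using \<nu>.entropy_rate_limit(2)[OF g, of n] by (intro mult_left_mono) (simp_all add: h_def nm_def)
      ultimately show ?thesis by (simp add: F_def algebra_simps)
    qed
    have "n * (h - F) / L \<le> entropy_rate \<rho> shift ?gD"
      unfolding \<rho>_def by (rule \<kappa>.entropy_rate_avg_ge[OF gD[OF s\<kappa>(1)] k])
    moreover have "ereal (entropy_rate \<rho> shift ?gD) \<le> KS_entropy \<rho> shift"
      by (rule mpt.entropy_rate_le_KS[OF invariant_measures_mpt(3)[OF \<rho>_inv] gD[OF s\<rho>(1)]])
    \<comment> \<open>As \<open>n = L - (M + 1)\<close>, the loss consists of \<open>F\<close> and
      the gap term, each below \<open>\<eta> / 4\<close>.\<close>
    moreover have "h - \<eta> / 2 < n * (h - F) / L"
    proof -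
      have n_eq: "real n = real L - real (M + 1)" by (simp add: L_def)
      have "n * (h - F) / L = (h - F) - (M + 1) * (h - F) / L"
        unfolding n_eq left_diff_distrib diff_divide_distrib using L0 by simp
      moreover have "(M + 1) * (h - F) / L \<le> (h + 1) * (M + 1) / L"
        using F(1) L0 by (subst mult.commute, intro divide_right_mono mult_right_mono) auto
      ultimately show ?thesis using F(2) L1 by linarith
    qed
    ultimately show ?thesis using less_le_trans[of "ereal (h - \<eta> / 2)" "ereal (entropy_rate \<rho> shift ?gD)"] by simp
  qed

  have E\<rho>: "\<bar>path_energy X T E \<rho> - path_energy X T E \<nu>\<bar> < \<eta> / 2"
    unfolding path_energy_def
  proof (rule E_near)
    show "distr \<rho> ?GM proj2 \<in> borel_prob_measures ?\<Gamma>"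
      using \<rho>.prob_space_distr[OF p2[OF s\<rho>(1)]] by (simp add: borel_prob_measures_def)
    fix f assume f: "f \<in> \<Phi>"
    have f_meas: "f \<in> borel_measurable ?GM" by (rule borel_measurable_continuous_on_restrict[OF \<Phi>(2)[OF f]])
    have fp: "(\<lambda>y. f (proj2 y)) \<in> borel_measurable M" if "sets M = sets ?OM" for M
      by (rule measurable_compose[OF p2[OF that] f_meas])
    have fB: "\<bar>f (proj2 y)\<bar> \<le> B" if "y \<in> ?\<Omega>" for y by (rule B(2)[OF f proj2_orbit_space[OF that]])
    have pj: "proj2 ((shift ^^ j) y) = (y j, y (Suc j))" for y :: "nat \<Rightarrow> 'a" and j
      by (simp add: proj2_def shift_funpow)
    define I where "I j = (\<integral>y. f (y j, y (Suc j)) \<partial>\<kappa>)" for j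
    define c where "c = (\<integral>u. f u \<partial>distr \<nu> ?GM proj2)"
    have c_eq: "c = (\<integral>y. f (proj2 y) \<partial>\<nu>)"
      unfolding c_def by (rule integral_distr[OF p2[OF inv(2)] f_meas])
    \<comment> \<open>Invariance of \<open>\<nu>\<close> lets the target integral be read at any
      time \<open>j\<close>, which matches it with each term of the average over a period.\<close>
    have c_j: "c = (\<integral>y. f (y j, y (Suc j)) \<partial>\<nu>)" for j
    proof -
      have "c = (\<integral>y. f (proj2 y) \<partial>distr \<nu> \<nu> (shift ^^ j))" unfolding c_eq \<nu>.funpow_inv ..
      also have "\<dots> = (\<integral>y. f (proj2 ((shift ^^ j) y)) \<partial>\<nu>)"
        by (rule integral_distr[OF \<nu>.funpow_meas fp[OF inv(2)]])
      finally show ?thesis by (simp only: pj)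
    qed
    have "(\<integral>u. f u \<partial>distr \<rho> ?GM proj2) = (\<integral>y. f (proj2 y) \<partial>\<rho>)"
      by (rule integral_distr[OF p2[OF s\<rho>(1)] f_meas])
    also have "\<dots> = (\<Sum>j<L. \<integral>y. f (proj2 ((shift ^^ j) y)) \<partial>\<kappa>) / L"
      unfolding \<rho>_def by (rule \<kappa>.integral_avg[where B=B, OF fp[OF s\<kappa>(1)]]) (simp add: s\<kappa> fB)
    finally have avg: "(\<integral>u. f u \<partial>distr \<rho> ?GM proj2) = (\<Sum>j<L. I j) / L" by (simp only: pj I_def)
    have int_bound: "\<bar>\<integral>y. f (y j, y (Suc j)) \<partial>M\<bar> \<le> B" if M: "prob_space M" "sets M = sets ?OM" for M j
    proof -
      interpret prob_space M by fact
      have spM: "space M = ?\<Omega>" using sets_eq_imp_space_eq[OF M(2)] by simp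
      have "\<bar>\<integral>y. f (y j, y (Suc j)) \<partial>M\<bar> \<le> (\<integral>y. \<bar>f (y j, y (Suc j))\<bar> \<partial>M)" by (rule integral_abs_bound)
      also have "\<dots> \<le> B"
      proof (rule integral_le_const)
        have fj: "\<bar>f (y j, y (Suc j))\<bar> \<le> B" if "y \<in> ?\<Omega>" for y
          using fB[OF funpow_shift_orbit[OF that, of j]] by (simp only: pj)
        then show "AE y in M. \<bar>f (y j, y (Suc j))\<bar> \<le> B" by (intro AE_I2) (simp add: spM)
        have "(shift ^^ j) \<in> measurable M M"
        proof -
          have "(shift ^^ j) \<in> measurable \<nu> \<nu>" by (rule \<nu>.funpow_meas)
          then show ?thesis
            by (subst measurable_cong_sets[OF trans[OF M(2) inv(2)[symmetric]] trans[OF M(2) inv(2)[symmetric]]])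
        qed
        from measurable_compose[OF this fp[OF M(2)]]
        have "(\<lambda>y. f (y j, y (Suc j))) \<in> borel_measurable M" by (simp only: pj)
        then show "integrable M (\<lambda>y. \<bar>f (y j, y (Suc j))\<bar>)"
          using fj by (intro integrable_abs integrable_const_bound[where B=B] AE_I2) (simp_all add: spM)
      qed
      finally show ?thesis .
    qed
    have "\<bar>(\<Sum>j<L. I j) / L - c\<bar> \<le> \<delta> / 4 + (M + 2) * (2 * B) / L"
    proof (rule weighted_average_close[OF L_def n(3)])
      show "\<bar>I j - c\<bar> \<le> 2 * B" for j
      proof -
        have "\<bar>I j\<bar> \<le> B" unfolding I_def by (rule int_bound[OF \<kappa>.prob_space_axioms s\<kappa>(1)])
        moreover have "\<bar>c\<bar> \<le> B" unfolding c_j[of j] by (rule int_bound[OF inv(1,2)])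
        ultimately show ?thesis by linarith
      qed
      show "0 \<le> \<delta> / 4" using \<Phi>(3) by simp
      fix j assume j: "Suc j < n"
      have "\<bar>I j - c\<bar> \<le> 2 * (\<delta> / 8)"
        unfolding c_j[of j] I_def \<kappa>_def
      proof (rule cod.coded_integral[OF \<theta>(1,2) W_def[symmetric] \<theta>(3,4) inv(1,2) nm_m p rep(1) near \<epsilon>(3) j \<Phi>(2)[OF f] B(2)[OF f]])
        fix a b a' b'
        assume ab: "(a, b) \<in> ?\<Gamma>" "(a', b') \<in> ?\<Gamma>" "dist a a' \<le> d / 4" "dist b b' \<le> d / 4"
        have "dist (a, b) (a', b') \<le> dist a a' + dist b b'"
          unfolding dist_Pair_Pair by (rule sqrt_sum_squares_le_sum) simp_all
        also have "\<dots> < d" using ab(3,4) d(1) by simp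
        finally show "\<bar>f (a, b) - f (a', b')\<bar> \<le> \<delta> / 8"
          using d(2)[OF f ab(1,2)] by simp
      qed
      then show "\<bar>I j - c\<bar> \<le> \<delta> / 4" by simp
    qed
    also have "\<dots> < \<delta>" using L2 \<Phi>(3) by simp
    finally show "\<bar>(\<integral>u. f u \<partial>distr \<rho> ?GM proj2) - (\<integral>u. f u \<partial>distr \<nu> ?GM proj2)\<bar> < \<delta>"
      unfolding avg c_def .
  qed

  \<comment> \<open>The real bound \<open>h\<close> replaces the entropy of \<open>\<nu>\<close>, so
    the comparison takes place between real numbers.\<close>
  have "KS_entropy \<nu> shift + ereal (path_energy X T E \<nu>) - ereal \<eta> \<le> ereal h + ereal (path_energy X T E \<nu>) - ereal \<eta>"
    by (intro ereal_minus_mono add_right_mono KS\<nu> order_refl)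
  also have "\<dots> = ereal (h + path_energy X T E \<nu> - \<eta>)" by simp
  also have "\<dots> < ereal (h - \<eta> / 2 + path_energy X T E \<rho>)"
  proof -
    have "h + path_energy X T E \<nu> - \<eta> < h - \<eta> / 2 + path_energy X T E \<rho>" using E\<rho> by linarith
    then show ?thesis by simp
  qed
  also have "\<dots> = ereal (h - \<eta> / 2) + ereal (path_energy X T E \<rho>)" by simp
  also have "\<dots> \<le> KS_entropy \<rho> shift + ereal (path_energy X T E \<rho>)"
    by (intro add_right_mono less_imp_le KS\<rho>)
  finally show "\<exists>\<rho>\<in>ergodic_measures ?\<Omega> shift. KS_entropy \<rho> shift + ereal (path_energy X T E \<rho>)
      > KS_entropy \<nu> shift + ereal (path_energy X T E \<nu>) - ereal \<eta>"
    using \<rho>_erg by blast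
qed

end
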